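(* Let $0\le \mu\in L^1(\mathbb{R}^N)$ be the density of a probability measure $d\mu=\mu(x)\,dx$ on $\mathbb{R}^N$ such that: (a) $\mu\in H^1_{\rm loc}(\mathbb{R}^N)$ and $\frac{\nabla\mu}{\mu}\in L^r_{\rm loc}(\mathbb{R}^N,\mathbb{R}^N)$ for some $r>N$; (b) $\inf_{x\in K}\mu(x)>0$ for every compact $K\subset\mathbb{R}^N$. Let $A$ be the operator on $L^2_\mu(\mathbb{R}^N)$ associated with the form $a_L(u,v)=\int_{\mathbb{R}^N}Lu\,\overline{Lv}\,d\mu$, $u,v\in D(L)$. Assume that there exists $n\in\mathbb{N}$ such that $D(A^n)\subset L^\infty_{\rm loc}(\mathbb{R}^N)$ and that $0$ is a simple pole for $\sigma(-A)$. Then the semigroup $(e^{-tA})_{t\ge0}$ is locally uniformly eventually positive, i.e. for every compact set $K\subset\mathbb{R}^N$ there exists $t_0>0$ such that for every $f\in L^2_\mu(\mathbb{R}^N)\cap L^2_\mu(K)_>$ there exists $c>0$ with $$e^{-tA}(\chi_Kf)(x)\ge c\qquad\text{for all }t\ge t_0\text{ and a.e. }x\in K.$$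
   Context: $L^2_\mu(\mathbb{R}^N)=L^2(\mathbb{R}^N,d\mu)$; $\chi_K$ is the characteristic function of $K$; $f\in L^2_\mu(\mathbb{R}^N)\cap L^2_\mu(K)_>$ means that $f\in L^2_\mu(\mathbb{R}^N)$, $f\ge0$ a.e. on $K$, and $f>0$ on a Borel subset of $K$ of positive Lebesgue measure. "$0$ is a simple pole for $\sigma(-A)$" means that $0$ is an isolated point of the spectrum $\sigma(-A)$ and a simple (first-order) pole of the resolvent of $-A$. $(L,D(L))$ is the closure in $L^2_\mu(\mathbb{R}^N)$ of $Lf=\Delta f+\frac{\nabla\mu}{\mu}\cdot\nabla f$, $f\in C_c^\infty(\mathbb{R}^N)$; under (a)-(b) it is known to generate an analytic contraction $C_0$-semigroup on $L^2_\mu(\mathbb{R}^N)$. The operator $A$: $u\in D(A)$, $Au=f$ iff $u\in D(L)$, $f\in L^2_\mu(\mathbb{R}^N)$ and $\int_{\mathbb{R}^N}Lu\,\overline{Lv}\,d\mu=\int_{\mathbb{R}^N}f\,\overline v\,d\mu$ for all $v\in D(L)$. The operator $-A$ generates an analytic contraction $C_0$-semigroup $(e^{-tA})_{t\ge0}$ on $L^2_\mu(\mathbb{R}^N)$. *)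

theory Defs
  imports
    "HOL-Analysis.Analysis"
    "HOL-Probability.Probability_Measure"
    "HOL-Library.Complex_Order"
begin

section \<open>Test functions and weak gradients\<close>

text \<open>The space \<open>\<real>\<^sup>N\<close> is an arbitrary type \<open>'a\<close> of class \<^class>\<open>euclidean_space\<close>, with
  \<open>N = DIM('a)\<close>; partial derivatives are taken along the orthonormal basis \<open>Basis\<close>.\<close>

definition partial_deriv ::
    "'a::euclidean_space \<Rightarrow> ('a \<Rightarrow> 'b::real_normed_vector) \<Rightarrow> 'a \<Rightarrow> 'b" where
  "partial_deriv b f x = frechet_derivative f (at x) b"

primrec Ck :: "nat \<Rightarrow> ('a::euclidean_space \<Rightarrow> 'b::real_normed_vector) \<Rightarrow> bool" where
  "Ck 0 f \<longleftrightarrow> continuous_on UNIV f"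
| "Ck (Suc k) f \<longleftrightarrow>
     (\<forall>x. f differentiable at x) \<and> (\<forall>b\<in>Basis. Ck k (partial_deriv b f))"

definition Cc_infinity :: "('a::euclidean_space \<Rightarrow> 'b::real_normed_vector) set" where
  "Cc_infinity = {f. (\<forall>k. Ck k f) \<and> compact (closure {x. f x \<noteq> 0})}"

definition Lp_loc :: "real \<Rightarrow> ('a::euclidean_space \<Rightarrow> 'b::real_normed_vector) set" where
  "Lp_loc p = {f \<in> borel_measurable borel.
     \<forall>K. compact K \<longrightarrow> set_integrable lborel K (\<lambda>x. norm (f x) powr p)}"

definition Linf_loc :: "('a::euclidean_space \<Rightarrow> 'b::real_normed_vector) set" where
  "Linf_loc = {f \<in> borel_measurable borel.
     \<forall>K. compact K \<longrightarrow> (\<exists>C. AE x in lborel. x \<in> K \<longrightarrow> norm (f x) \<le> C)}"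

definition weak_gradient :: "('a::euclidean_space \<Rightarrow> real) \<Rightarrow> ('a \<Rightarrow> 'a) \<Rightarrow> bool" where
  "weak_gradient \<mu> g \<longleftrightarrow> \<mu> \<in> Lp_loc 1 \<and> g \<in> Lp_loc 1 \<and>
     (\<forall>\<phi>\<in>Cc_infinity. \<forall>b\<in>Basis.
        (\<integral>x. \<mu> x * partial_deriv b \<phi> x \<partial>lborel) = - (\<integral>x. (g x \<bullet> b) * \<phi> x \<partial>lborel))"

text \<open>\<open>H1_loc_gradient \<mu> g\<close>: \<open>\<mu>\<close> belongs to \<open>H\<^sup>1\<^sub>l\<^sub>o\<^sub>c\<close> and \<open>g\<close> is (a representative of) \<open>\<nabla>\<mu>\<close>.\<close>

definition H1_loc_gradient :: "('a::euclidean_space \<Rightarrow> real) \<Rightarrow> ('a \<Rightarrow> 'a) \<Rightarrow> bool" where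
  "H1_loc_gradient \<mu> g \<longleftrightarrow> \<mu> \<in> Lp_loc 2 \<and> g \<in> Lp_loc 2 \<and> weak_gradient \<mu> g"


section \<open>Operators on complex \<open>L\<^sup>2\<close>\<close>

text \<open>Elements of \<open>L\<^sup>2(M)\<close> are represented by functions, and equality in \<open>L\<^sup>2(M)\<close> is equality
  almost everywhere. Everywhere defined bounded operators are maps between representatives that
  are linear up to null sets; boundedness and linearity together make them respect
  almost everywhere equality.\<close>

definition L2 :: "'a measure \<Rightarrow> ('a \<Rightarrow> complex) set" where
  "L2 M = {f \<in> borel_measurable M. integrable M (\<lambda>x. (norm (f x))\<^sup>2)}"

definition L2_norm :: "'a measure \<Rightarrow> ('a \<Rightarrow> complex) \<Rightarrow> real" where
  "L2_norm M f = sqrt (\<integral>x. (norm (f x))\<^sup>2 \<partial>M)"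

type_synonym 'a opr = "('a \<Rightarrow> complex) \<Rightarrow> ('a \<Rightarrow> complex)"

definition bounded_opr :: "'a measure \<Rightarrow> 'a opr \<Rightarrow> bool" where
  "bounded_opr M T \<longleftrightarrow>
     (\<forall>f\<in>L2 M. T f \<in> L2 M) \<and>
     (\<forall>f\<in>L2 M. \<forall>h\<in>L2 M. AE x in M. T (\<lambda>y. f y + h y) x = T f x + T h x) \<and>
     (\<forall>c. \<forall>f\<in>L2 M. AE x in M. T (\<lambda>y. c * f y) x = c * T f x) \<and>
     (\<exists>C. \<forall>f\<in>L2 M. L2_norm M (T f) \<le> C * L2_norm M f)"

definition opr_norm :: "'a measure \<Rightarrow> 'a opr \<Rightarrow> real" where
  "opr_norm M T = (SUP f\<in>{f \<in> L2 M. L2_norm M f \<le> 1}. L2_norm M (T f))"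

text \<open>An unbounded operator \<open>B\<close> is represented by its graph, i.e. the set of all pairs
  \<open>(u, w)\<close> of representatives with \<open>u \<in> D(B)\<close> and \<open>Bu = w\<close>.\<close>

type_synonym 'a graph = "(('a \<Rightarrow> complex) \<times> ('a \<Rightarrow> complex)) set"

definition graph_closure :: "'a measure \<Rightarrow> 'a graph \<Rightarrow> 'a graph" where
  "graph_closure M G = {(u, w). u \<in> L2 M \<and> w \<in> L2 M \<and>
     (\<exists>F H. (\<forall>n::nat. (F n, H n) \<in> G) \<and>
        (\<lambda>n. L2_norm M (\<lambda>x. F n x - u x)) \<longlonglongrightarrow> 0 \<and>
        (\<lambda>n. L2_norm M (\<lambda>x. H n x - w x)) \<longlonglongrightarrow> 0)}"

definition uminus_graph :: "'a graph \<Rightarrow> 'a graph" where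
  "uminus_graph G = {(u, \<lambda>x. - w x) | u w. (u, w) \<in> G}"

text \<open>The intersection with \<open>L2 M\<close> matters only for \<open>n = 0\<close>, where \<open>D(B\<^sup>0) = L\<^sup>2(M)\<close>.\<close>

definition dom_power :: "'a measure \<Rightarrow> 'a graph \<Rightarrow> nat \<Rightarrow> ('a \<Rightarrow> complex) set" where
  "dom_power M G n = L2 M \<inter> Domain (G ^^ n)"

text \<open>\<open>is_resolvent M G \<zeta> R\<close>: \<open>R\<close> is a bounded two-sided inverse of \<open>\<zeta> - B\<close>.\<close>

definition is_resolvent :: "'a measure \<Rightarrow> 'a graph \<Rightarrow> complex \<Rightarrow> 'a opr \<Rightarrow> bool" where
  "is_resolvent M G \<zeta> R \<longleftrightarrow> bounded_opr M R \<and>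
     (\<forall>h\<in>L2 M. \<exists>w. (R h, w) \<in> G \<and> (AE x in M. \<zeta> * R h x - w x = h x)) \<and>
     (\<forall>(u, w)\<in>G. AE x in M. R (\<lambda>y. \<zeta> * u y - w y) x = u x)"

definition resolvent_set :: "'a measure \<Rightarrow> 'a graph \<Rightarrow> complex set" where
  "resolvent_set M G = {\<zeta>. \<exists>R. is_resolvent M G \<zeta> R}"

definition spectrum :: "'a measure \<Rightarrow> 'a graph \<Rightarrow> complex set" where
  "spectrum M G = - resolvent_set M G"

text \<open>The resolvent has a pole of order one at the isolated spectral point \<open>z\<close>: its Laurent
  expansion, converging in operator norm, is
  \<open>(\<zeta> - z)\<^sup>-\<^sup>1 P + (\<Sum>k. (\<zeta> - z)\<^sup>k Q\<^sub>k)\<close> with \<open>P \<noteq> 0\<close>.\<close>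

definition simple_pole :: "'a measure \<Rightarrow> 'a graph \<Rightarrow> complex \<Rightarrow> bool" where
  "simple_pole M G z \<longleftrightarrow> z isolated_in spectrum M G \<and>
     (\<exists>P Q. bounded_opr M P \<and> (\<forall>k. bounded_opr M (Q k)) \<and>
        (\<exists>f\<in>L2 M. \<not> (AE x in M. P f x = 0)) \<and>
        (\<exists>r>0. \<forall>\<zeta> R. 0 < norm (\<zeta> - z) \<and> norm (\<zeta> - z) < r \<and> is_resolvent M G \<zeta> R \<longrightarrow>
           (\<lambda>n. opr_norm M (\<lambda>f x. R f x - (P f x / (\<zeta> - z) + (\<Sum>k<n. (\<zeta> - z) ^ k * Q k f x))))
             \<longlonglongrightarrow> 0))"

definition C0_semigroup :: "'a measure \<Rightarrow> (real \<Rightarrow> 'a opr) \<Rightarrow> bool" where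
  "C0_semigroup M T \<longleftrightarrow>
     (\<forall>t\<ge>0. bounded_opr M (T t)) \<and>
     (\<forall>f\<in>L2 M. AE x in M. T 0 f x = f x) \<and>
     (\<forall>s\<ge>0. \<forall>t\<ge>0. \<forall>f\<in>L2 M. AE x in M. T (s + t) f x = T s (T t f) x) \<and>
     (\<forall>f\<in>L2 M. ((\<lambda>t. L2_norm M (\<lambda>x. T t f x - f x)) \<longlongrightarrow> 0) (at_right 0))"

definition generator :: "'a measure \<Rightarrow> (real \<Rightarrow> 'a opr) \<Rightarrow> 'a graph" where
  "generator M T = {(u, w). u \<in> L2 M \<and> w \<in> L2 M \<and>
     ((\<lambda>t. L2_norm M (\<lambda>x. (T t u x - u x) / complex_of_real t - w x)) \<longlongrightarrow> 0) (at_right 0)}"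


section \<open>The operators \<open>L\<close> and \<open>A\<close>\<close>

abbreviation density_measure :: "('a::euclidean_space \<Rightarrow> real) \<Rightarrow> 'a measure" where
  "density_measure \<mu> \<equiv> density lborel (\<lambda>x. ennreal (\<mu> x))"

text \<open>In the following, \<open>g\<close> stands for \<open>\<nabla>\<mu>\<close>.\<close>

definition L_expr ::
    "('a::euclidean_space \<Rightarrow> real) \<Rightarrow> ('a \<Rightarrow> 'a) \<Rightarrow> ('a \<Rightarrow> complex) \<Rightarrow> 'a \<Rightarrow> complex" where
  "L_expr \<mu> g f x =
     (\<Sum>b\<in>Basis. partial_deriv b (partial_deriv b f) x) +
     (\<Sum>b\<in>Basis. complex_of_real ((g x /\<^sub>R \<mu> x) \<bullet> b) * partial_deriv b f x)"

definition L_graph :: "('a::euclidean_space \<Rightarrow> real) \<Rightarrow> ('a \<Rightarrow> 'a) \<Rightarrow> 'a graph" where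
  "L_graph \<mu> g = graph_closure (density_measure \<mu>) {(f, L_expr \<mu> g f) | f. f \<in> Cc_infinity}"

definition A_graph :: "('a::euclidean_space \<Rightarrow> real) \<Rightarrow> ('a \<Rightarrow> 'a) \<Rightarrow> 'a graph" where
  "A_graph \<mu> g = {(u, f). f \<in> L2 (density_measure \<mu>) \<and>
     (\<exists>w. (u, w) \<in> L_graph \<mu> g \<and>
        (\<forall>(v, z) \<in> L_graph \<mu> g.
           (\<integral>x. w x * cnj (z x) \<partial>density_measure \<mu>) =
           (\<integral>x. f x * cnj (v x) \<partial>density_measure \<mu>)))}"


section \<open>Local uniform eventual positivity\<close>

text \<open>The order on \<^typ>\<open>complex\<close> is the one of \<^theory>\<open>HOL-Library.Complex_Order\<close>:
  \<open>a \<le> b\<close> means \<open>Re a \<le> Re b\<close> and \<open>Im a = Im b\<close>.\<close>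

definition L2_pos_on :: "('a::euclidean_space \<Rightarrow> real) \<Rightarrow> 'a set \<Rightarrow> ('a \<Rightarrow> complex) set" where
  "L2_pos_on \<mu> K = {f \<in> L2 (density_measure \<mu>).
     (AE x in lborel. x \<in> K \<longrightarrow> 0 \<le> f x) \<and>
     (\<exists>B\<in>sets borel. B \<subseteq> K \<and> emeasure lborel B > 0 \<and> (\<forall>x\<in>B. 0 < f x))}"

definition loc_unif_eventually_positive ::
    "('a::euclidean_space \<Rightarrow> real) \<Rightarrow> (real \<Rightarrow> 'a opr) \<Rightarrow> bool" where
  "loc_unif_eventually_positive \<mu> T \<longleftrightarrow>
     (\<forall>K. compact K \<longrightarrow> (\<exists>t\<^sub>0>0. \<forall>f\<in>L2_pos_on \<mu> K. \<exists>c::real. c > 0 \<and>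
        (\<forall>t\<ge>t\<^sub>0. AE x in lborel. x \<in> K \<longrightarrow>
           complex_of_real c \<le> T t (\<lambda>y. indicator K y * f y) x)))"

end

theory Submission
  imports Defs
begin

text \<open>The form is symmetric and nonnegative, so \<open>e\<^sup>-\<^sup>t\<^sup>A\<close> is a semigroup of self-adjoint contractions. The
  Laurent expansion at \<open>0\<close> shows that its leading coefficient \<open>P\<close> is the orthogonal projection onto
  the kernel of \<open>A\<close> and that \<open>A\<close> has a spectral gap on the complement, so \<open>e\<^sup>-\<^sup>t\<^sup>A (I - P)\<close> decays
  exponentially. Elements of \<open>ker A = ker L\<close> are \<open>L\<^sup>2\<close>-limits of test functions whose gradients tend to
  \<open>0\<close>; hence they are constants, and \<open>P f = \<integral> f d\<mu>\<close>.

  Self-adjointness improves the decay from \<open>L\<^sup>2\<close> to a bound from \<open>L\<^sup>1(K)\<close> to \<open>L\<^sup>\<infinity>(K)\<close>, which makes \<open>t\<^sub>0\<close> independent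
  of \<open>f\<close>. Let \<open>R\<close> be a resolvent at a small \<open>\<zeta> > 0\<close>. As \<open>R\<^sup>n\<close> maps into \<open>D(A\<^sup>n) \<subseteq> L\<^sup>\<infinity>\<^sub>l\<^sub>o\<^sub>c\<close>, uniform
  boundedness yields \<open>\<parallel>R\<^sup>n \<phi>\<parallel>\<^sub>2 \<le> D \<parallel>\<phi>\<parallel>\<^sub>1\<close> for \<open>\<phi>\<close> supported in \<open>K\<close>, while smoothing of the semigroup yields
  \<open>\<parallel>e\<^sup>-\<^sup>n\<^sup>A \<phi>\<parallel>\<^sub>2 \<le> (\<zeta> + 1)\<^sup>n \<parallel>R\<^sup>n \<phi>\<parallel>\<^sub>2\<close>. Therefore
  \<open>\<bar>\<langle>e\<^sup>-\<^sup>t\<^sup>A f - P f, \<phi>\<rangle>\<bar> \<le> 1/2 \<parallel>f\<parallel>\<^sub>1 \<parallel>\<phi>\<parallel>\<^sub>1\<close> for large \<open>t\<close> and all \<open>f, \<phi>\<close> supported in \<open>K\<close>, and taking for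
  \<open>\<phi>\<close> the indicator of \<open>{x \<in> K. e\<^sup>-\<^sup>t\<^sup>A f(x) < \<integral> f d\<mu> / 2}\<close> shows that this set is null. The values are real because
  \<open>A\<close> commutes with complex conjugation.\<close>

section \<open>Semigroups on Hilbert spaces\<close>

text \<open>That constants lie in the kernel of \<open>A\<close> is not read off from
  \<open>L\<close>, whose domain is a closure of compactly supported functions. It comes from the
  pole: the residue \<open>P\<close> is nonzero, complex linear and has values in the kernel, and
  the kernel consists of constants, so the range of \<open>P\<close> is all constants.

  The order of the quantifiers shapes the estimates. \<open>t0\<close> is chosen before
  \<open>f\<close>, so the error has to be small against the mean of \<open>f\<close> over
  \<open>K\<close>, which for \<open>f\<close> nonnegative on \<open>K\<close> is an
  \<open>L^1\<close> norm; an error measured by the \<open>L^2\<close> norm of \<open>f\<close>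
  could not be absorbed uniformly. Both arguments of the bilinear form must be measured in
  \<open>L^1\<close>, the second because the set on which it is tested varies with \<open>t\<close>
  and may have arbitrarily small measure.

  Bounds for orbits come from differentiating a quadratic expression along elements of the domain
  and extending by density. This asks for a Hilbert space as a type, whereas the statement works
  with representatives and null sets: \<open>L^2\<close> modulo null sets is therefore built as a
  real Hilbert space, and the operators are transported to it.\<close>

text \<open>By Baire's theorem one of the closed level sets \<open>F n\<close> contains a ball.
  Subtracting its centre bounds every \<open>T i\<close> by \<open>2 * real n\<close> on a ball
  around 0, and scaling gives the common operator bound.\<close>

lemma uniform_boundedness:
  fixes T :: "'i \<Rightarrow> 'x::banach \<Rightarrow> 'y::real_normed_vector"
  assumes bl: "\<And>i. i \<in> I \<Longrightarrow> bounded_linear (T i)"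
    and pointwise: "\<And>x. \<exists>C. \<forall>i\<in>I. norm (T i x) \<le> C"
  shows "\<exists>C. \<forall>i\<in>I. \<forall>x. norm (T i x) \<le> C * norm x"
proof -
  define F where "F n = (\<Inter>i\<in>I. {x. norm (T i x) \<le> real n})" for n :: nat
  have closed_F: "closed (F n)" for n
    unfolding F_def
    by (intro closed_INT ballI closed_Collect_le continuous_intros linear_continuous_on bl)
  have "\<exists>n. x \<in> F n" for x
  proof -
    obtain C where "\<forall>i\<in>I. norm (T i x) \<le> C" using pointwise by blast
    moreover obtain n :: nat where "C \<le> real n" using real_arch_simple by blast
    ultimately show ?thesis by (auto simp: F_def intro!: exI[of _ n] intro: order_trans)
  qed
  then have "(\<Union>n. F n) = UNIV" by auto
  then have "\<exists>n. interior (F n) \<noteq> {}"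
    using Baire_category_alt[of "euclidean :: 'x topology" "range F"] closed_F
      completely_metrizable_space_euclidean[where 'a = 'x]
    by (auto simp: interior_of_def interior_def)
  then obtain n x0 where "x0 \<in> interior (F n)" by blast
  then obtain e where e: "e > 0" "cball x0 e \<subseteq> F n"
    by (meson mem_interior_cball)
  have "norm (T i x) \<le> 2 * real n / e * norm x" if i: "i \<in> I" for i x
  proof (cases "x = 0")
    case True
    then show ?thesis using bl[OF i] by (simp add: bounded_linear.linear linear_0)
  next
    case False
    define y where "y = (e / norm x) *\<^sub>R x"
    have lin: "linear (T i)" using bl[OF i] by (rule bounded_linear.linear)
    have "x0 + y \<in> cball x0 e" "x0 \<in> cball x0 e"
      using e False by (auto simp: y_def dist_norm)
    then have "x0 + y \<in> F n" "x0 \<in> F n" using e by blast+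
    then have "norm (T i (x0 + y)) \<le> real n" "norm (T i x0) \<le> real n"
      using i by (auto simp: F_def)
    moreover have "T i y = T i (x0 + y) - T i x0"
      by (simp add: linear_add[OF lin])
    ultimately have "norm (T i y) \<le> 2 * real n"
      using norm_triangle_ineq4[of "T i (x0 + y)" "T i x0"] by simp
    moreover have "norm (T i y) = e / norm x * norm (T i x)"
      using e by (simp add: y_def linear_cmul[OF lin])
    ultimately show ?thesis using e False by (simp add: field_simps)
  qed
  then show ?thesis by blast
qed

text \<open>Each \<open>x\<close> is read as the functional sending \<open>h\<close> to
  \<open>h \<bullet> x\<close>; evaluating the common bound at \<open>h = x\<close> returns the norm
  of \<open>x\<close>.\<close>

lemma weakly_bounded_imp_norm_bounded:
  fixes S :: "'h::{real_inner,banach} set"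
  assumes "\<And>h. \<exists>C. \<forall>x\<in>S. \<bar>h \<bullet> x\<bar> \<le> C"
  shows "\<exists>C. \<forall>x\<in>S. norm x \<le> C"
proof -
  obtain C where C: "\<forall>x\<in>S. \<forall>h. norm (h \<bullet> x) \<le> C * norm h"
    using uniform_boundedness[of S "\<lambda>x h. h \<bullet> x"] assms
    by (auto simp: bounded_linear_inner_left)
  have "norm x \<le> \<bar>C\<bar>" if "x \<in> S" for x
  proof (cases "x = 0")
    case False
    have "norm x * norm x = norm (x \<bullet> x)"
      by (simp add: power2_norm_eq_inner flip: power2_eq_square)
    also have "\<dots> \<le> C * norm x" using C that by blast
    finally show ?thesis using False by simp
  qed simp
  then show ?thesis by blast
qed

text \<open>The engine of the orbit estimates below. The derivative is asked for in the open
  interval because orbits are differentiated at positive times; at the end points continuity is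
  enough.\<close>

lemma derivative_nonpos_imp_le:
  fixes f :: "real \<Rightarrow> real"
  assumes "a \<le> b" "continuous_on {a..b} f"
    and "\<And>x. a < x \<Longrightarrow> x < b \<Longrightarrow> (f has_real_derivative f' x) (at x)"
    and "\<And>x. a < x \<Longrightarrow> x < b \<Longrightarrow> f' x \<le> 0"
  shows "f b \<le> f a"
proof (cases "a = b")
  case False
  then obtain x where "a < x" "x < b" "f b - f a = (b - a) * f' x"
    using mvt[of a b f "\<lambda>x y. y * f' x"] assms
    by (auto simp: has_field_derivative_def mult_commute_abs)
  then show ?thesis using assms(1,4) by (smt (verit) mult_nonneg_nonpos)
qed simp

section \<open>Strongly continuous semigroups on a real Hilbert space\<close>

locale c0_semigroup =
  fixes T :: "real \<Rightarrow> 'h::{real_inner,banach} \<Rightarrow> 'h"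
  assumes bl: "t \<ge> 0 \<Longrightarrow> bounded_linear (T t)"
    and T_0: "T 0 u = u"
    and T_add: "s \<ge> 0 \<Longrightarrow> t \<ge> 0 \<Longrightarrow> T (s + t) u = T s (T t u)"
    and T_lim: "((\<lambda>t. T t u) \<longlongrightarrow> u) (at_right 0)"
begin

definition gen :: "('h \<times> 'h) set" where
  "gen = {(u, w). ((\<lambda>t. (T t u - u) /\<^sub>R t) \<longlongrightarrow> w) (at_right 0)}"

lemma lin: "t \<ge> 0 \<Longrightarrow> linear (T t)"
  using bl bounded_linear.linear by blast

lemma T_lim0: "((\<lambda>t. T t u) \<longlongrightarrow> u) (at 0 within {0..})"
  using T_lim[of u] by (simp add: at_within_Ici_at_right)

text \<open>Otherwise there are times \<open>\<tau> n\<close> tending to 0 whose operators violate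
  the bound \<open>n\<close>. Every orbit converges along \<open>\<tau>\<close>, hence is bounded
  along it, which contradicts uniform boundedness.\<close>

lemma bounded_near_0: "\<exists>\<delta>>0. \<exists>N. \<forall>t\<in>{0..\<delta>}. \<forall>u. norm (T t u) \<le> N * norm u"
proof (rule ccontr)
  assume contr: "\<not> ?thesis"
  have "\<forall>n::nat. \<exists>t. 0 \<le> t \<and> t \<le> inverse (real (Suc n)) \<and> (\<exists>u. norm (T t u) > real n * norm u)"
  proof
    fix n :: nat
    have "inverse (real (Suc n)) > 0" by simp
    then show "\<exists>t. 0 \<le> t \<and> t \<le> inverse (real (Suc n)) \<and> (\<exists>u. norm (T t u) > real n * norm u)"
      using contr by (metis atLeastAtMost_iff linorder_not_le)
  qed
  then obtain \<tau> where \<tau>: "\<And>n. 0 \<le> \<tau> n" "\<And>n. \<tau> n \<le> inverse (real (Suc n))"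
    "\<And>n. \<exists>u. norm (T (\<tau> n) u) > real n * norm u" by metis
  have \<tau>_0: "\<tau> \<longlonglongrightarrow> 0"
    using \<tau> by (intro real_tendsto_sandwich[OF _ _ tendsto_const LIMSEQ_inverse_real_of_nat]) auto
  have "(\<lambda>n. T (\<tau> n) u) \<longlonglongrightarrow> u" for u
  proof -
    have "continuous (at 0 within {0..}) (\<lambda>t. T t u)"
      unfolding continuous_within T_0 by (rule T_lim0)
    then have "(\<lambda>n. T (\<tau> n) u) \<longlonglongrightarrow> T 0 u"
      by (rule continuous_within_tendsto_compose') (use \<tau>(1) \<tau>_0 in auto)
    then show ?thesis by (simp only: T_0)
  qed
  then have "\<exists>C. \<forall>n\<in>UNIV. norm (T (\<tau> n) u) \<le> C" for u
    by (metis Bseq_def convergentI convergent_imp_Bseq)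
  then have "\<exists>C. \<forall>n\<in>UNIV. \<forall>u. norm (T (\<tau> n) u) \<le> C * norm u"
    using \<tau> bl by (intro uniform_boundedness) auto
  then obtain C where C: "norm (T (\<tau> n) u) \<le> C * norm u" for n u by blast
  obtain n :: nat where "C \<le> real n" using real_arch_simple by blast
  with C \<tau>(3)[of n] show False
    by (meson linorder_not_less mult_right_mono norm_ge_zero order_trans)
qed

lemma locally_bounded:
  assumes "t \<ge> 0"
  shows "\<exists>N>0. \<forall>s\<in>{0..t}. \<forall>u. norm (T s u) \<le> N * norm u"
proof -
  obtain \<delta> N where \<delta>: "\<delta> > 0" and N: "\<And>s u. s \<in> {0..\<delta>} \<Longrightarrow> norm (T s u) \<le> N * norm u"
    using bounded_near_0 by blast
  \<comment> \<open>At least 1, so that additional steps of length \<open>\<delta>\<close> never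
    lower the bound.\<close>
  define N' where "N' = max 1 N"
  have N': "norm (T s u) \<le> N' * norm u" if "s \<in> {0..\<delta>}" for s u
    using N[OF that, of u] mult_right_mono[of N N' "norm u"] by (simp add: N'_def)
  have "N' \<ge> 1" by (simp add: N'_def)
  have *: "\<forall>s\<in>{0..real k * \<delta>}. \<forall>u. norm (T s u) \<le> N' ^ k * norm u" for k
  proof (induction k)
    case 0
    then show ?case by (auto simp: T_0)
  next
    case (Suc k)
    show ?case
    proof (intro ballI allI)
      fix s u assume s: "s \<in> {0..real (Suc k) * \<delta>}"
      show "norm (T s u) \<le> N' ^ Suc k * norm u"
      proof (cases "s \<le> \<delta>")
        case True
        then have "norm (T s u) \<le> N' * norm u" using s by (intro N') auto
        also have "\<dots> \<le> N' ^ Suc k * norm u"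
          using \<open>N' \<ge> 1\<close> by (intro mult_right_mono) (auto intro: self_le_power)
        finally show ?thesis .
      next
        case False
        then have "s - \<delta> \<in> {0..real k * \<delta>}" using s by (auto simp: algebra_simps)
        then have "norm (T (s - \<delta>) (T \<delta> u)) \<le> N' ^ k * norm (T \<delta> u)" using Suc by blast
        also have "\<dots> \<le> N' ^ k * (N' * norm u)"
          using \<open>N' \<ge> 1\<close> \<delta> by (intro mult_left_mono N') auto
        finally show ?thesis
          using T_add[of "s - \<delta>" \<delta> u] False \<delta> by (simp add: mult_ac)
      qed
    qed
  qed
  obtain k :: nat where "t / \<delta> \<le> real k" using real_arch_simple by blast
  then have "t \<le> real k * \<delta>" using \<delta> by (simp add: field_simps)
  then show ?thesis using *[of k] \<open>N' \<ge> 1\<close> by (intro exI[of _ "N' ^ k"]) auto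
qed

lemma continuous_orbit: "continuous_on {0..} (\<lambda>t. T t u)"
  unfolding continuous_on_iff
proof (intro ballI allI impI)
  fix t e :: real assume t: "t \<in> {0..}" and e: "e > 0"
  obtain N where N: "N > 0" "\<And>s u. s \<in> {0..t} \<Longrightarrow> norm (T s u) \<le> N * norm u"
    using locally_bounded[of t] t by (meson atLeast_iff)
  obtain d where d: "d > 0" "\<And>h. 0 \<le> h \<Longrightarrow> h < d \<Longrightarrow> norm (T h u - u) < e / N"
  proof -
    have "\<forall>\<^sub>F h in at 0 within {0..}. dist (T h u) u < e / N"
      using T_lim0 e N by (intro tendstoD) auto
    then obtain d where "d > 0" "\<forall>h\<in>{0..}. h \<noteq> 0 \<and> dist h 0 < d \<longrightarrow> dist (T h u) u < e / N"
      unfolding eventually_at by blast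
    then have "norm (T h u - u) < e / N" if "0 \<le> h" "h < d" for h
      using that e N by (cases "h = 0") (auto simp: dist_norm T_0)
    with \<open>d > 0\<close> show thesis by (rule that)
  qed
  have "dist (T s u) (T t u) < e" if s: "s \<in> {0..}" "dist s t < d" for s
  proof -
    \<comment> \<open>Both signs of \<open>s - t\<close> are treated at once: up to sign the
      increment is \<open>T m\<close> applied to \<open>T h u - u\<close>, and
      \<open>m \<le> t\<close> keeps the operator bound fixed while \<open>s\<close> varies.\<close>
    define m h where "m = min s t" and "h = \<bar>s - t\<bar>"
    have "m \<in> {0..t}" "h \<ge> 0" "h < d"
      using s t by (auto simp: m_def h_def dist_norm)
    have "norm (T s u - T t u) = norm (T (m + h) u - T m u)"
      by (cases "s \<le> t") (auto simp: m_def h_def norm_minus_commute)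
    also have "\<dots> = norm (T m (T h u - u))"
      using \<open>m \<in> {0..t}\<close> \<open>h \<ge> 0\<close> by (simp add: T_add linear_diff[OF lin])
    also have "\<dots> \<le> N * norm (T h u - u)" using N \<open>m \<in> {0..t}\<close> by blast
    also have "\<dots> < e" using d(2)[OF \<open>h \<ge> 0\<close> \<open>h < d\<close>] N by (simp add: field_simps)
    finally show ?thesis by (simp add: dist_norm)
  qed
  with d show "\<exists>d>0. \<forall>s\<in>{0..}. dist s t < d \<longrightarrow> dist (T s u) (T t u) < e" by blast
qed

text \<open>A two-sided derivative. To the right the error is \<open>T t\<close> of the error at 0;
  to the left it is \<open>T s\<close> of it, and there replacing \<open>T s w\<close> by
  \<open>T t w\<close> uses continuity of the orbit of \<open>w\<close>.\<close>

lemma has_vector_derivative_orbit: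
  assumes "(u, w) \<in> gen" "t > 0"
  shows "((\<lambda>t. T t u) has_vector_derivative T t w) (at t)"
  unfolding has_vector_derivative_def has_derivative_at_alt
proof (intro conjI allI impI bounded_linear_scaleR_left)
  fix e :: real assume e: "e > 0"
  obtain N where N: "N > 0" "\<And>s u. s \<in> {0..t} \<Longrightarrow> norm (T s u) \<le> N * norm u"
    using locally_bounded[of t] \<open>t > 0\<close> by (meson less_imp_le)
  have "((\<lambda>t. (T t u - u) /\<^sub>R t) \<longlongrightarrow> w) (at_right 0)"
    using assms by (simp add: gen_def)
  then have "\<forall>\<^sub>F h in at_right 0. dist ((T h u - u) /\<^sub>R h) w < e / (2 * N)"
    using e N by (intro tendstoD) auto
  then obtain d where d: "d > 0"
    "\<And>h. 0 < h \<Longrightarrow> h < d \<Longrightarrow> norm ((T h u - u) /\<^sub>R h - w) < e / (2 * N)"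
    unfolding eventually_at_right_field dist_norm by auto
  have d': "norm (T h u - u - h *\<^sub>R w) \<le> e / (2 * N) * h" if "0 < h" "h < d" for h
  proof -
    have "T h u - u - h *\<^sub>R w = h *\<^sub>R ((T h u - u) /\<^sub>R h - w)"
      using that by (simp add: algebra_simps)
    then have "norm (T h u - u - h *\<^sub>R w) = h * norm ((T h u - u) /\<^sub>R h - w)"
      using that by (metis abs_of_pos norm_scaleR)
    also have "\<dots> \<le> h * (e / (2 * N))" using d(2)[OF that] that by (intro mult_left_mono) auto
    finally show ?thesis by (simp only: mult.commute)
  qed
  have "continuous_on {0..} (\<lambda>t. T t w)" by (rule continuous_orbit)
  then obtain d2 where d2: "d2 > 0" "\<And>s. s \<ge> 0 \<Longrightarrow> dist s t < d2 \<Longrightarrow> dist (T s w) (T t w) < e / 2"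
    unfolding continuous_on_iff using e \<open>t > 0\<close>
    by (metis atLeast_iff half_gt_zero less_imp_le)
  define D where "D = Min {d, d2, t}"
  have "D > 0" using d d2 \<open>t > 0\<close> by (auto simp: D_def)
  have "norm (T s u - T t u - (s - t) *\<^sub>R T t w) \<le> e * norm (s - t)" if s: "norm (s - t) < D" for s
  proof -
    define h where "h = \<bar>s - t\<bar>"
    consider "s = t" | "s > t" | "s < t" by linarith
    then show ?thesis
    proof cases
      case 2
      then have h: "0 < h" "h < d" "s = t + h" using s by (auto simp: D_def h_def)
      have "T s u - T t u - (s - t) *\<^sub>R T t w = T t (T h u - u - h *\<^sub>R w)"
        using h \<open>t > 0\<close> lin[of t] by (simp add: T_add linear_diff linear_cmul)
      then have "norm (T s u - T t u - (s - t) *\<^sub>R T t w) \<le> N * norm (T h u - u - h *\<^sub>R w)"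
        using N(2)[of t] \<open>t > 0\<close> by auto
      also have "\<dots> \<le> N * (e / (2 * N) * h)" using N d' h by (intro mult_left_mono) auto
      also have "\<dots> \<le> e * norm (s - t)" using N e h by (simp add: field_simps)
      finally show ?thesis .
    next
      case 3
      then have h: "0 < h" "h < d" "t = s + h" "s \<in> {0..t}" "dist s t < d2"
        using s by (auto simp: D_def h_def dist_norm)
      have t_eq: "T t u = T s (T h u)" "s - t = - h" using h T_add[of s h u] by auto
      have "T s (T h u - u - h *\<^sub>R w) = T s (T h u) - T s u - h *\<^sub>R T s w"
        using h lin[of s] by (simp add: linear_diff linear_cmul)
      then have "T s u - T t u - (s - t) *\<^sub>R T t w =
          - T s (T h u - u - h *\<^sub>R w) - h *\<^sub>R (T s w - T t w)"
        unfolding t_eq by (simp add: scaleR_diff_right)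
      also have "norm \<dots> \<le> norm (T s (T h u - u - h *\<^sub>R w)) + norm (h *\<^sub>R (T s w - T t w))"
        by (metis norm_minus_cancel norm_triangle_ineq4)
      also have "\<dots> \<le> N * norm (T h u - u - h *\<^sub>R w) + h * (e / 2)"
        using N(2)[OF h(4)] d2(2)[of s] h by (intro add_mono) (auto simp: dist_norm)
      also have "\<dots> \<le> N * (e / (2 * N) * h) + h * (e / 2)"
        using N d' h by (intro add_mono mult_left_mono) auto
      also have "\<dots> \<le> e * norm (s - t)" using N e h by (simp add: field_simps)
      finally show ?thesis .
    qed simp
  qed
  with \<open>D > 0\<close> show "\<exists>d>0. \<forall>y. norm (y - t) < d \<longrightarrow>
       norm (T y u - T t u - (y - t) *\<^sub>R T t w) \<le> e * norm (y - t)" by blast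
qed

lemma gen_linear:
  assumes "(u, w) \<in> gen" "(v, z) \<in> gen"
  shows "(a *\<^sub>R u + b *\<^sub>R v, a *\<^sub>R w + b *\<^sub>R z) \<in> gen"
proof -
  have "((\<lambda>t. a *\<^sub>R ((T t u - u) /\<^sub>R t) + b *\<^sub>R ((T t v - v) /\<^sub>R t)) \<longlongrightarrow> a *\<^sub>R w + b *\<^sub>R z) (at_right 0)"
    using assms by (intro tendsto_intros) (auto simp: gen_def)
  moreover have "\<forall>\<^sub>F t in at_right 0. a *\<^sub>R ((T t u - u) /\<^sub>R t) + b *\<^sub>R ((T t v - v) /\<^sub>R t)
      = (T t (a *\<^sub>R u + b *\<^sub>R v) - (a *\<^sub>R u + b *\<^sub>R v)) /\<^sub>R t"
    using eventually_at_right_less[of 0]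
  proof (rule eventually_mono)
    fix t :: real assume "0 < t"
    then show "a *\<^sub>R ((T t u - u) /\<^sub>R t) + b *\<^sub>R ((T t v - v) /\<^sub>R t)
      = (T t (a *\<^sub>R u + b *\<^sub>R v) - (a *\<^sub>R u + b *\<^sub>R v)) /\<^sub>R t"
      using lin[of t] by (simp add: linear_add linear_cmul algebra_simps)
  qed
  ultimately show ?thesis unfolding gen_def by (simp add: tendsto_cong)
qed

lemma gen_diff: "(u, w) \<in> gen \<Longrightarrow> (v, z) \<in> gen \<Longrightarrow> (u - v, w - z) \<in> gen"
  using gen_linear[of u w v z 1 "-1"] by simp

lemma gen_T:
  assumes "(u, w) \<in> gen" "t \<ge> 0"
  shows "(T t u, T t w) \<in> gen"
proof -
  have "((\<lambda>h. T t ((T h u - u) /\<^sub>R h)) \<longlongrightarrow> T t w) (at_right 0)"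
    using assms bounded_linear.tendsto[OF bl] by (auto simp: gen_def)
  moreover have "\<forall>\<^sub>F h in at_right 0. T t ((T h u - u) /\<^sub>R h) = (T h (T t u) - T t u) /\<^sub>R h"
    using eventually_at_right_less[of 0]
  proof (rule eventually_mono)
    fix h :: real assume "0 < h"
    then have "T h (T t u) = T t (T h u)"
      using T_add[of h t u] T_add[of t h u] assms by (simp add: add.commute)
    then show "T t ((T h u - u) /\<^sub>R h) = (T h (T t u) - T t u) /\<^sub>R h"
      using lin[of t] assms by (simp add: linear_diff linear_cmul)
  qed
  ultimately show ?thesis unfolding gen_def by (simp add: tendsto_cong)
qed

text \<open>If \<open>F\<close> is the primitive of the orbit of \<open>u\<close>, then \<open>F (h + r) = F r + T r (F h)\<close>, so \<open>F h / h\<close>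
  lies in the domain of the generator.\<close>

lemma dense_gen: "closure (Domain gen) = UNIV"
proof -
  have "u \<in> closure (Domain gen)" for u
  proof -
    define F where "F t = integral {0..t} (\<lambda>s. T s u)" for t
    have F0: "F 0 = 0" by (simp add: F_def)
    have deriv: "(F has_vector_derivative T t u) (at t within {0..b})" if "t \<in> {0..b}" for t b
      unfolding F_def
      using continuous_on_subset[OF continuous_orbit] that
      by (intro integral_has_vector_derivative) auto
    have right: "((\<lambda>h. (F (t + h) - F t) /\<^sub>R h) \<longlongrightarrow> T t u) (at_right 0)" if "t \<ge> 0" for t
    proof -
      have "(F has_vector_derivative T t u) (at t within {t..t+1})"
        using deriv[of t "t + 1"] that by (rule_tac has_vector_derivative_within_subset) auto
      then have "((\<lambda>x. norm (F x - F t - (x - t) *\<^sub>R T t u) / norm (x - t)) \<longlongrightarrow> 0) (at_right t)"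
        by (simp add: has_vector_derivative_def has_derivative_iff_norm at_within_Icc_at_right)
      moreover have "\<forall>\<^sub>F x in at_right t. norm (F x - F t - (x - t) *\<^sub>R T t u) / norm (x - t)
          = norm ((F x - F t) /\<^sub>R (x - t) - T t u)"
        using eventually_at_right_less[of t]
      proof (rule eventually_mono)
        fix x assume "t < x"
        then have "(F x - F t) /\<^sub>R (x - t) - T t u = (F x - F t - (x - t) *\<^sub>R T t u) /\<^sub>R (x - t)"
          by (simp add: scaleR_diff_right)
        then show "norm (F x - F t - (x - t) *\<^sub>R T t u) / norm (x - t)
          = norm ((F x - F t) /\<^sub>R (x - t) - T t u)"
          by (simp add: divide_inverse_commute)
      qed
      ultimately have "((\<lambda>x. norm ((F x - F t) /\<^sub>R (x - t) - T t u)) \<longlongrightarrow> 0) (at_right t)"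
        by (simp add: tendsto_cong)
      then have "((\<lambda>x. (F x - F t) /\<^sub>R (x - t)) \<longlongrightarrow> T t u) (at_right t)"
        by (rule LIM_zero_cancel[OF tendsto_norm_zero_cancel])
      then show ?thesis
        unfolding at_right_to_0[of t] filterlim_filtermap by (simp add: add.commute)
    qed
    \<comment> \<open>For fixed \<open>r\<close> the two sides agree at \<open>h = 0\<close> and
      have the same derivative in \<open>h\<close>, by the semigroup law.\<close>
    have cocycle: "F (h + r) = F r + T r (F h)" if "h \<ge> 0" "r \<ge> 0" for h r
    proof -
      have "((\<lambda>t. F (t + r) - T r (F t)) has_vector_derivative 0) (at t within {0..h})"
        if t: "t \<in> {0..h}" for t
      proof -
        have F': "(F has_vector_derivative T (t + r) u) (at (t + r) within {0..h + r})"
          using t \<open>r \<ge> 0\<close> by (intro deriv) auto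
        have "((F \<circ> (\<lambda>t. t + r)) has_vector_derivative 1 *\<^sub>R T (t + r) u) (at t within {0..h})"
        proof (intro vector_diff_chain_within)
          show "((\<lambda>t. t + r) has_vector_derivative 1) (at t within {0..h})"
            by (rule has_vector_derivative_add_const[THEN iffD2, OF has_vector_derivative_id])
          show "(F has_vector_derivative T (t + r) u) (at (t + r) within (\<lambda>t. t + r) ` {0..h})"
            by (rule has_vector_derivative_within_subset[OF F'])
              (use \<open>r \<ge> 0\<close> in auto)
        qed
        moreover have "((\<lambda>t. T r (F t)) has_vector_derivative T r (T t u)) (at t within {0..h})"
          by (rule bounded_linear.has_vector_derivative[OF bl[OF \<open>r \<ge> 0\<close>] deriv[OF t]])
        moreover have "T (t + r) u = T r (T t u)"
          using T_add[of r t u] t \<open>r \<ge> 0\<close> by (simp add: add.commute)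
        ultimately show ?thesis
          using has_vector_derivative_diff[of "\<lambda>t. F (t + r)" "T (t + r) u" "at t within {0..h}"
              "\<lambda>t. T r (F t)" "T r (T t u)"] by (simp add: o_def)
      qed
      then obtain c where c: "\<And>t. t \<in> {0..h} \<Longrightarrow> F (t + r) - T r (F t) = c"
        using has_vector_derivative_zero_constant[of "{0..h}" "\<lambda>t. F (t + r) - T r (F t)"] by blast
      have "F (h + r) - T r (F h) = F (0 + r) - T r (F 0)"
        using c[of h] c[of 0] \<open>h \<ge> 0\<close> by simp
      then show ?thesis using F0 linear_0[OF lin[OF \<open>r \<ge> 0\<close>]] by (simp add: algebra_simps)
    qed
    have "(F h, T h u - u) \<in> gen" if "h \<ge> 0" for h
    proof -
      have "((\<lambda>r. (F (h + r) - F h) /\<^sub>R r - (F (0 + r) - F 0) /\<^sub>R r) \<longlongrightarrow> T h u - T 0 u) (at_right 0)"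
        using that by (intro tendsto_diff right) auto
      moreover have "\<forall>\<^sub>F r in at_right 0. (F (h + r) - F h) /\<^sub>R r - (F (0 + r) - F 0) /\<^sub>R r
         = (T r (F h) - F h) /\<^sub>R r"
        using eventually_at_right_less[of 0]
      proof (rule eventually_mono)
        fix r :: real assume "0 < r"
        then have F_add: "F (h + r) = F r + T r (F h)" using cocycle that by simp
        show "(F (h + r) - F h) /\<^sub>R r - (F (0 + r) - F 0) /\<^sub>R r = (T r (F h) - F h) /\<^sub>R r"
          unfolding F_add by (simp add: F0 algebra_simps)
      qed
      ultimately show ?thesis unfolding gen_def by (simp add: tendsto_cong T_0)
    qed
    then have dom: "F h /\<^sub>R h \<in> Domain gen" if "h \<ge> 0" for h
      using gen_linear[of "F h" _ "F h" _ "inverse h" 0] that by auto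
    have "((\<lambda>h. F h /\<^sub>R h) \<longlongrightarrow> u) (at_right 0)"
      using right[of 0] by (simp add: F0 T_0)
    then show ?thesis
    proof (rule Lim_in_closed_set[OF closed_closure _ trivial_limit_at_right_real, rotated])
      show "\<forall>\<^sub>F h in at_right 0. F h /\<^sub>R h \<in> closure (Domain gen)"
        using eventually_at_right_less[of 0]
        by (rule eventually_mono) (use dom closure_subset in force)
    qed
  qed
  then show ?thesis by auto
qed

text \<open>Shaped as an induction rule: a statement is proved by differentiation where orbits are
  differentiable, and closedness of the condition carries it to all vectors.\<close>

lemma gen_dense_induct:
  assumes "\<And>u w. (u, w) \<in> gen \<Longrightarrow> P u" "closed {u. P u}"
  shows "P u"
proof -
  have "closure (Domain gen) \<subseteq> {u. P u}"
    using assms by (intro closure_minimal) auto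
  then show ?thesis using dense_gen by auto
qed

end

section \<open>Self-adjoint semigroups with a pole of the resolvent at zero\<close>

text \<open>For the generator \<open>B\<close>, the pair in the graph is
  \<open>(\<zeta> - B) R h = h\<close> solved for \<open>B (R h)\<close>. Membership of
  \<open>R h\<close> in the domain and the resolvent equation become one statement.\<close>

definition (in c0_semigroup) resolvent_at :: "real \<Rightarrow> ('h \<Rightarrow> 'h) \<Rightarrow> bool" where
  "resolvent_at \<zeta> R \<longleftrightarrow> bounded_linear R \<and> (\<forall>h. (R h, \<zeta> *\<^sub>R R h - h) \<in> gen) \<and>
     (\<forall>(u, w)\<in>gen. R (\<zeta> *\<^sub>R u - w) = u)"

section \<open>Semigroups with a symmetric dissipative generator\<close>

locale selfadjoint_semigroup = c0_semigroup +
  assumes gen_sym: "(u, w) \<in> gen \<Longrightarrow> (v, z) \<in> gen \<Longrightarrow> w \<bullet> v = u \<bullet> z"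
    and gen_nonpos: "(u, w) \<in> gen \<Longrightarrow> w \<bullet> u \<le> 0"
begin

text \<open>The squared norm of an orbit has derivative \<open>2 * (T s w \<bullet> T s u)\<close>,
  which dissipativity makes nonpositive.\<close>

lemma contraction: "t \<ge> 0 \<Longrightarrow> norm (T t u) \<le> norm u"
proof (induction u rule: gen_dense_induct)
  case (1 u w)
  have "T t u \<bullet> T t u \<le> T 0 u \<bullet> T 0 u"
  proof (rule derivative_nonpos_imp_le[of 0 t "\<lambda>s. T s u \<bullet> T s u"])
    show "continuous_on {0..t} (\<lambda>s. T s u \<bullet> T s u)"
      by (intro continuous_intros continuous_on_subset[OF continuous_orbit]) auto
    fix s assume "0 < s" "s < t"
    show "((\<lambda>s. T s u \<bullet> T s u) has_real_derivative T s u \<bullet> T s w + T s w \<bullet> T s u) (at s)"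
      unfolding has_real_derivative_iff_has_vector_derivative
      using has_vector_derivative_orbit[OF 1(1) \<open>0 < s\<close>]
      by (intro bounded_bilinear.has_vector_derivative[OF bounded_bilinear_inner])
    show "T s u \<bullet> T s w + T s w \<bullet> T s u \<le> 0"
      using gen_nonpos[OF gen_T[OF 1(1), of s]] \<open>0 < s\<close> by (simp add: inner_commute)
  qed (use 1 in auto)
  then show ?case by (simp add: T_0 norm_le)
next
  case 2
  have "continuous_on UNIV (T t)" if "t \<ge> 0"
    using bl[OF that] by (rule linear_continuous_on)
  then show ?case
    by (cases "t \<ge> 0") (auto intro!: closed_Collect_le continuous_intros)
qed

text \<open>The orbit of \<open>k\<close> has derivative \<open>T s 0 = 0\<close>, so its squared
  distance from \<open>k\<close> keeps the initial value 0.\<close>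

lemma T_kernel:
  assumes k: "(k, 0) \<in> gen" and "t \<ge> 0"
  shows "T t k = k"
proof -
  have "(T t k - k) \<bullet> (T t k - k) \<le> (T 0 k - k) \<bullet> (T 0 k - k)"
  proof (rule derivative_nonpos_imp_le[of 0 t "\<lambda>s. (T s k - k) \<bullet> (T s k - k)"])
    show "continuous_on {0..t} (\<lambda>s. (T s k - k) \<bullet> (T s k - k))"
      by (intro continuous_intros continuous_on_subset[OF continuous_orbit]) auto
    fix s assume s: "0 < s" "s < t"
    have "T s 0 = 0" using linear_0[OF lin[of s]] s by simp
    then have "((\<lambda>s. T s k - k) has_vector_derivative 0) (at s)"
      using has_vector_derivative_orbit[OF k s(1)] by (simp add: has_vector_derivative_diff_const)
    from bounded_bilinear.has_vector_derivative[OF bounded_bilinear_inner this this]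
    show "((\<lambda>s. (T s k - k) \<bullet> (T s k - k)) has_real_derivative 0) (at s)"
      by (simp add: has_real_derivative_iff_has_vector_derivative)
  qed (use assms in auto)
  then have "norm (T t k - k) \<le> norm (T 0 k - k)" by (simp add: norm_le)
  then show ?thesis by (simp add: T_0)
qed

text \<open>The difference \<open>T t (C u) - C (T t u)\<close> starts at \<open>0\<close> and solves the evolution equation, so its
  norm is nonincreasing by dissipativity.\<close>

lemma T_commute:
  assumes C: "bounded_linear C" and gen_C: "\<And>u w. (u, w) \<in> gen \<Longrightarrow> (C u, C w) \<in> gen"
    and "t \<ge> 0"
  shows "T t (C u) = C (T t u)"
proof (induction u rule: gen_dense_induct)
  case (1 u w)
  define d where "d s = T s (C u) - C (T s u)" for s
  define d' where "d' s = T s (C w) - C (T s w)" for s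
  have "d t \<bullet> d t \<le> d 0 \<bullet> d 0"
  proof (rule derivative_nonpos_imp_le[of 0 t "\<lambda>s. d s \<bullet> d s"])
    show "continuous_on {0..t} (\<lambda>s. d s \<bullet> d s)"
      unfolding d_def
      by (intro continuous_intros bounded_linear.continuous_on[OF C]
          continuous_on_subset[OF continuous_orbit]) auto
    fix s assume s: "0 < s" "s < t"
    have "(d has_vector_derivative d' s) (at s)"
      unfolding d_def[abs_def] d'_def using s
      by (intro has_vector_derivative_diff bounded_linear.has_vector_derivative[OF C]
          has_vector_derivative_orbit gen_C 1)
    then show "((\<lambda>s. d s \<bullet> d s) has_real_derivative d s \<bullet> d' s + d' s \<bullet> d s) (at s)"
      unfolding has_real_derivative_iff_has_vector_derivative
      by (intro bounded_bilinear.has_vector_derivative[OF bounded_bilinear_inner])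
    have "(d s, d' s) \<in> gen"
      unfolding d_def d'_def using s by (intro gen_diff gen_T gen_C 1) auto
    then show "d s \<bullet> d' s + d' s \<bullet> d s \<le> 0"
      using gen_nonpos[of "d s" "d' s"] by (simp add: inner_commute)
  qed (use \<open>t \<ge> 0\<close> in auto)
  then have "norm (d t) \<le> norm (d 0)" by (simp add: norm_le)
  then have "d t = 0" by (simp add: d_def T_0)
  then show ?case by (simp add: d_def)
next
  case 2
  have "continuous_on UNIV (\<lambda>u. T t (C u))"
    using bounded_linear_compose[OF bl[OF \<open>t \<ge> 0\<close>] C] by (rule linear_continuous_on)
  moreover have "continuous_on UNIV (\<lambda>u. C (T t u))"
    using bounded_linear_compose[OF C bl[OF \<open>t \<ge> 0\<close>]] by (rule linear_continuous_on)
  ultimately show ?case by (rule closed_Collect_eq)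
qed

text \<open>For \<open>u\<close> and \<open>v\<close> in the domain,
  \<open>T s u \<bullet> T (t - s) v\<close> is constant in \<open>s\<close>: the two terms of its
  derivative cancel by symmetry of the generator. Its values at \<open>t\<close> and at 0 are the
  two sides.\<close>

lemma T_sym:
  assumes "t \<ge> 0"
  shows "T t u \<bullet> v = u \<bullet> T t v"
proof -
  have cont: "continuous_on UNIV (T t)"
    using bl[OF assms] by (rule linear_continuous_on)
  have dom: "T t u \<bullet> v = u \<bullet> T t v" if u: "(u, w) \<in> gen" and v: "(v, z) \<in> gen" for u v w z
  proof -
    define f where "f s = T s u \<bullet> T (t - s) v" for s
    define f' where "f' s = T s u \<bullet> - T (t - s) z + T s w \<bullet> T (t - s) v" for s
    have cont': "continuous_on {0..t} f"
      unfolding f_def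
      by (intro continuous_intros continuous_on_subset[OF continuous_orbit]
          continuous_on_compose2[OF continuous_orbit]) auto
    have deriv: "(f has_real_derivative f' s) (at s)" if s: "0 < s" "s < t" for s
    proof -
      have "((\<lambda>s. T (t - s) v) has_vector_derivative - T (t - s) z) (at s)"
      proof -
        have "((\<lambda>s. t - s) has_vector_derivative - 1) (at s)"
          by (auto intro!: derivative_eq_intros)
        moreover have "((\<lambda>r. T r v) has_vector_derivative T (t - s) z) (at (t - s))"
          using has_vector_derivative_orbit[OF v] s by simp
        ultimately show ?thesis
          using vector_diff_chain_at[of "\<lambda>s. t - s" "- 1" s "\<lambda>r. T r v"] by (simp add: o_def)
      qed
      then show ?thesis
        unfolding f_def[abs_def] f'_def has_real_derivative_iff_has_vector_derivative
        using has_vector_derivative_orbit[OF u s(1)]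
        by (intro bounded_bilinear.has_vector_derivative[OF bounded_bilinear_inner])
    qed
    have zero: "f' s = 0" if s: "0 < s" "s < t" for s
      using gen_sym[OF gen_T[OF u, of s] gen_T[OF v, of "t - s"]] s by (simp add: f'_def)
    have "f t \<le> f 0" using assms cont' deriv zero by (intro derivative_nonpos_imp_le[of 0 t f f']) auto
    moreover have "- f t \<le> - f 0"
      using assms cont' deriv zero
      by (intro derivative_nonpos_imp_le[of 0 t "\<lambda>s. - f s" "\<lambda>s. - f' s"] DERIV_minus continuous_intros) auto
    ultimately show ?thesis by (simp add: f_def T_0)
  qed
  \<comment> \<open>The arguments are freed from the domain one at a time.\<close>
  have "T t u \<bullet> v = u \<bullet> T t v" if "(v, z) \<in> gen" for u v z
  proof (induction u rule: gen_dense_induct)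
    case 2
    then show ?case using cont by (intro closed_Collect_eq continuous_intros)
  qed (use dom that in blast)
  note * = this
  show ?thesis
  proof (induction v rule: gen_dense_induct)
    case 2
    then show ?case using cont by (intro closed_Collect_eq continuous_intros)
  qed (use * in blast)
qed

text \<open>The function \<open>\<parallel>u(s)\<parallel>\<^sup>2 + 2s\<langle>Au(s),u(s)\<rangle> + 2s\<^sup>2\<parallel>Au(s)\<parallel>\<^sup>2\<close> with \<open>u(s) = T s u\<close> and
  \<open>A\<close> the negative generator is nonincreasing.\<close>

lemma smoothing:
  assumes u: "(u, w) \<in> gen" and w: "(w, x) \<in> gen" and "t \<ge> 0"
  shows "t * norm (T t w) \<le> norm u"
proof -
  define F where "F s = T s u \<bullet> T s u - 2 * s * (T s w \<bullet> T s u) + 2 * s\<^sup>2 * (T s w \<bullet> T s w)" for s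
  have "F t \<le> F 0"
  proof (rule derivative_nonpos_imp_le[of 0 t "F"])
    show "continuous_on {0..t} F"
      unfolding F_def by (intro continuous_intros continuous_on_subset[OF continuous_orbit]) auto
    fix s assume s: "0 < s" "s < t"
    note du = has_vector_derivative_orbit[OF u s(1)]
    note dw = has_vector_derivative_orbit[OF w s(1)]
    note inner = bounded_bilinear.has_vector_derivative[OF bounded_bilinear_inner,
        folded has_real_derivative_iff_has_vector_derivative]
    \<comment> \<open>Symmetry trades the second-order term for a square; every term in the
      derivative of \<open>F\<close> then cancels except the dissipative one in \<open>x\<close> and
      \<open>w\<close>.\<close>
    have sym: "T s x \<bullet> T s u = T s w \<bullet> T s w"
      using gen_sym[OF gen_T[OF w, of s] gen_T[OF u, of s]] s by simp
    have "(F has_real_derivative (T s u \<bullet> T s w + T s w \<bullet> T s u)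
        - (2 * (T s w \<bullet> T s u) + (T s w \<bullet> T s w + T s x \<bullet> T s u) * (2 * s))
        + (4 * s * (T s w \<bullet> T s w) + (T s w \<bullet> T s x + T s x \<bullet> T s w) * (2 * s\<^sup>2))) (at s)"
      unfolding F_def[abs_def]
      by (rule derivative_eq_intros inner[OF du du] inner[OF dw du] inner[OF dw dw] refl)+ simp
    also have "(T s u \<bullet> T s w + T s w \<bullet> T s u)
        - (2 * (T s w \<bullet> T s u) + (T s w \<bullet> T s w + T s x \<bullet> T s u) * (2 * s))
        + (4 * s * (T s w \<bullet> T s w) + (T s w \<bullet> T s x + T s x \<bullet> T s w) * (2 * s\<^sup>2))
        = 4 * s\<^sup>2 * (T s x \<bullet> T s w)"
      using sym by (simp add: inner_commute algebra_simps)
    finally show "(F has_real_derivative 4 * s\<^sup>2 * (T s x \<bullet> T s w)) (at s)" .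
    show "4 * s\<^sup>2 * (T s x \<bullet> T s w) \<le> 0"
      using gen_nonpos[OF gen_T[OF w, of s]] s by (intro mult_nonneg_nonpos) auto
  qed (use assms in auto)
  moreover have "F 0 = (norm u)\<^sup>2" by (simp add: F_def T_0 power2_norm_eq_inner)
  \<comment> \<open>The first two terms of \<open>F t\<close> are nonnegative and are dropped; the
    factor 2 is given away afterwards.\<close>
  moreover have "F t \<ge> 2 * (t * norm (T t w))\<^sup>2"
  proof -
    have "t * (T t w \<bullet> T t u) \<le> 0"
      using gen_nonpos[OF gen_T[OF u \<open>t \<ge> 0\<close>]] \<open>t \<ge> 0\<close> by (intro mult_nonneg_nonpos)
    moreover have "T t u \<bullet> T t u \<ge> 0" by simp
    ultimately show ?thesis
      unfolding F_def power_mult_distrib power2_norm_eq_inner by linarith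
  qed
  ultimately have "(t * norm (T t w))\<^sup>2 \<le> (norm u)\<^sup>2"
    by (smt (verit) zero_le_power2)
  then show ?thesis by (rule power2_le_imp_le) simp
qed

section \<open>Comparison of the semigroup with powers of a resolvent\<close>

context
  fixes \<zeta> R assumes R: "resolvent_at \<zeta> R" and \<zeta>: "\<zeta> > 0"
begin

lemma bounded_linear_R: "bounded_linear R"
  and R_gen: "(R h, \<zeta> *\<^sub>R R h - h) \<in> gen"
  and R_inverse: "(u, w) \<in> gen \<Longrightarrow> R (\<zeta> *\<^sub>R u - w) = u"
  using R by (auto simp: resolvent_at_def)

text \<open>Symmetry of the generator at \<open>R h\<close> and \<open>R k\<close>; the terms with
  \<open>\<zeta>\<close> are the same on both sides and drop out.\<close>

lemma R_sym: "R h \<bullet> k = h \<bullet> R k"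
  using gen_sym[OF R_gen[of h] R_gen[of k]] by (simp add: inner_diff_left inner_diff_right)

lemma R_nonneg: "0 \<le> R h \<bullet> h"
proof -
  have "\<zeta> * (R h \<bullet> R h) \<le> h \<bullet> R h"
    using gen_nonpos[OF R_gen[of h]] by (simp add: inner_diff_left)
  moreover have "\<zeta> * (R h \<bullet> R h) \<ge> 0" using \<zeta> by simp
  ultimately show ?thesis by (simp add: inner_commute)
qed

text \<open>By \<open>T_commute\<close> it suffices that \<open>R\<close> preserves the graph, and
  \<open>R w = \<zeta> *\<^sub>R R u - u\<close> is the generator at \<open>R u\<close>.\<close>

lemma T_R: "t \<ge> 0 \<Longrightarrow> T t (R h) = R (T t h)"
proof (rule T_commute[OF bounded_linear_R])
  fix u w assume "(u, w) \<in> gen"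
  then have "R (\<zeta> *\<^sub>R u - w) = u" by (rule R_inverse)
  then have "\<zeta> *\<^sub>R R u - u = R w"
    using bounded_linear.linear[OF bounded_linear_R] by (simp add: linear_diff linear_cmul algebra_simps)
  then show "(R u, R w) \<in> gen" using R_gen[of u] by simp
qed

text \<open>\<open>h\<close> is \<open>\<zeta> *\<^sub>R R h\<close> minus the generator at
  \<open>R h\<close>. Contraction bounds \<open>T 1\<close> of the first part by
  \<open>\<zeta> * norm (R h)\<close>, and \<open>smoothing\<close> at time 1 bounds that of the
  second by \<open>norm (R h)\<close>. Smoothing applies the generator twice to \<open>R h\<close>,
  hence the start with \<open>h\<close> in the domain.\<close>

lemma T_1_le_R: "norm (T 1 h) \<le> (\<zeta> + 1) * norm (R h)"
proof (induction h rule: gen_dense_induct)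
  case (1 h x)
  have "norm (T 1 (\<zeta> *\<^sub>R R h - h)) \<le> norm (R h)"
  proof -
    have "(\<zeta> *\<^sub>R R h - h, \<zeta> *\<^sub>R (\<zeta> *\<^sub>R R h - h) - x) \<in> gen"
      using gen_diff[OF gen_linear[OF R_gen R_gen, of \<zeta> h 0 h] 1] by simp
    from smoothing[OF R_gen this, of 1] show ?thesis by simp
  qed
  moreover have "T 1 h = \<zeta> *\<^sub>R T 1 (R h) - T 1 (\<zeta> *\<^sub>R R h - h)"
    using lin[of 1] by (simp add: linear_diff linear_cmul)
  moreover have "norm (\<zeta> *\<^sub>R T 1 (R h)) \<le> \<zeta> * norm (R h)"
    using contraction[of 1 "R h"] \<zeta> by simp
  ultimately show ?case
    using norm_triangle_ineq4[of "\<zeta> *\<^sub>R T 1 (R h)" "T 1 (\<zeta> *\<^sub>R R h - h)"]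
    by (simp add: distrib_right)
next
  case 2
  show ?case
    using bl[of 1] bounded_linear_R
    by (intro closed_Collect_le continuous_intros linear_continuous_on) auto
qed

text \<open>Each unit of time buys one power of \<open>R\<close>; since \<open>T\<close> commutes
  with \<open>R\<close>, the one-step bound can be iterated.\<close>

lemma T_nat_le_R_power: "norm (T (real n) h) \<le> (\<zeta> + 1) ^ n * norm ((R ^^ n) h)"
proof (induction n arbitrary: h)
  case 0
  then show ?case by (simp add: T_0)
next
  case (Suc n)
  have "norm (T (real (Suc n)) h) = norm (T 1 (T (real n) h))"
    using T_add[of 1 "real n" h] by simp
  also have "\<dots> \<le> (\<zeta> + 1) * norm (T (real n) (R h))"
    using T_1_le_R[of "T (real n) h"] T_R[of "real n" h] by simp
  also have "\<dots> \<le> (\<zeta> + 1) * ((\<zeta> + 1) ^ n * norm ((R ^^ n) (R h)))"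
    using \<zeta> by (intro mult_left_mono Suc) auto
  finally show ?case by (simp add: funpow_swap1 mult.assoc)
qed

end

end

section \<open>The residue at zero: projection, spectral gap and decay\<close>

text \<open>The Laurent expansion enters as a bound, uniform along the positive real axis near 0,
  for the regular part left after subtracting \<open>P h /\<^sub>R \<zeta>\<close>. The same
  \<open>C\<close> becomes the time scale of the decay off the kernel.\<close>

locale selfadjoint_semigroup_pole = selfadjoint_semigroup +
  fixes P :: "'a \<Rightarrow> 'a" and C r :: real
  assumes bounded_linear_P: "bounded_linear P"
    and r: "r > 0" and C: "C > 0"
    and pole: "0 < \<zeta> \<Longrightarrow> \<zeta> < r \<Longrightarrow>
      \<exists>R. resolvent_at \<zeta> R \<and> (\<forall>h. norm (R h - P h /\<^sub>R \<zeta>) \<le> C * norm h)"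
begin

lemma tendsto_0_at_right_mult:
  fixes a :: real
  shows "((\<lambda>\<zeta>. \<zeta> * a) \<longlongrightarrow> 0) (at_right 0)"
  by (auto intro!: tendsto_eq_intros)

text \<open>The third property is the bound on the regular part multiplied by
  \<open>\<zeta>\<close>. It exhibits \<open>P\<close> as a strong limit, from which the algebra of
  \<open>P\<close> is read off.\<close>

lemma resolvent_family:
  obtains R where "\<And>\<zeta>. 0 < \<zeta> \<Longrightarrow> \<zeta> < r \<Longrightarrow> resolvent_at \<zeta> (R \<zeta>)"
    "\<And>\<zeta> h. 0 < \<zeta> \<Longrightarrow> \<zeta> < r \<Longrightarrow> norm (R \<zeta> h - P h /\<^sub>R \<zeta>) \<le> C * norm h"
    "\<And>h. ((\<lambda>\<zeta>. \<zeta> *\<^sub>R R \<zeta> h) \<longlongrightarrow> P h) (at_right 0)"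
proof -
  obtain R where R: "\<And>\<zeta>. 0 < \<zeta> \<Longrightarrow> \<zeta> < r \<Longrightarrow> resolvent_at \<zeta> (R \<zeta>)"
    "\<And>\<zeta> h. 0 < \<zeta> \<Longrightarrow> \<zeta> < r \<Longrightarrow> norm (R \<zeta> h - P h /\<^sub>R \<zeta>) \<le> C * norm h"
    using pole by metis
  have "((\<lambda>\<zeta>. \<zeta> *\<^sub>R R \<zeta> h - P h) \<longlongrightarrow> 0) (at_right 0)" for h
  proof (rule Lim_null_comparison)
    show "\<forall>\<^sub>F \<zeta> in at_right 0. norm (\<zeta> *\<^sub>R R \<zeta> h - P h) \<le> \<zeta> * (C * norm h)"
      unfolding eventually_at_right_field
    proof (intro exI[of _ r] conjI allI impI r)
      fix \<zeta> :: real assume \<zeta>: "0 < \<zeta>" "\<zeta> < r"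
      have "\<zeta> *\<^sub>R R \<zeta> h - P h = \<zeta> *\<^sub>R (R \<zeta> h - P h /\<^sub>R \<zeta>)"
        using \<zeta> by (simp add: scaleR_diff_right)
      then show "norm (\<zeta> *\<^sub>R R \<zeta> h - P h) \<le> \<zeta> * (C * norm h)"
        using R(2)[OF \<zeta>, of h] \<zeta> by simp
    qed
  qed (rule tendsto_0_at_right_mult)
  then have "((\<lambda>\<zeta>. \<zeta> *\<^sub>R R \<zeta> h) \<longlongrightarrow> P h) (at_right 0)" for h
    by (rule LIM_zero_cancel)
  with R show thesis by (rule that)
qed

lemma P_kernel:
  assumes "(k, 0) \<in> gen"
  shows "P k = k"
proof -
  obtain R where R: "\<And>\<zeta>. 0 < \<zeta> \<Longrightarrow> \<zeta> < r \<Longrightarrow> resolvent_at \<zeta> (R \<zeta>)"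
    "\<And>h. ((\<lambda>\<zeta>. \<zeta> *\<^sub>R R \<zeta> h) \<longlongrightarrow> P h) (at_right 0)"
    using resolvent_family by metis
  have "\<forall>\<^sub>F \<zeta> in at_right 0. \<zeta> *\<^sub>R R \<zeta> k = k"
    unfolding eventually_at_right_field
  proof (intro exI[of _ r] conjI allI impI r)
    fix \<zeta> :: real assume \<zeta>: "0 < \<zeta>" "\<zeta> < r"
    show "\<zeta> *\<^sub>R R \<zeta> k = k"
      using R_inverse[OF R(1)[OF \<zeta>] \<zeta>(1) assms] bounded_linear_R[OF R(1)[OF \<zeta>] \<zeta>(1)]
      by (simp add: bounded_linear.linear linear_cmul)
  qed
  then have "((\<lambda>\<zeta>. \<zeta> *\<^sub>R R \<zeta> k) \<longlongrightarrow> k) (at_right 0)"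
    by (simp add: tendsto_cong)
  then show ?thesis
    using R(2)[of k] tendsto_unique[OF trivial_limit_at_right_real] by blast
qed

text \<open>The resolvent at a fixed \<open>\<xi>\<close> inverts \<open>\<xi>\<close> minus the
  generator at the vector \<open>\<zeta> *\<^sub>R R \<zeta> h\<close>. As \<open>\<zeta>\<close>
  tends to 0 this becomes \<open>R \<xi> (\<xi> *\<^sub>R P h) = P h\<close>, which puts
  \<open>P h\<close> in the domain with generator value 0.\<close>

lemma P_in_kernel: "(P h, 0) \<in> gen"
proof -
  obtain R where R: "\<And>\<zeta>. 0 < \<zeta> \<Longrightarrow> \<zeta> < r \<Longrightarrow> resolvent_at \<zeta> (R \<zeta>)"
    "\<And>h. ((\<lambda>\<zeta>. \<zeta> *\<^sub>R R \<zeta> h) \<longlongrightarrow> P h) (at_right 0)"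
    using resolvent_family by metis
  define \<xi> where "\<xi> = r / 2"
  have \<xi>: "0 < \<xi>" "\<xi> < r" using r by (auto simp: \<xi>_def)
  note R_\<xi> = R(1)[OF \<xi>]
  have bl: "bounded_linear (R \<xi>)" using bounded_linear_R[OF R_\<xi> \<xi>(1)] .
  have "((\<lambda>\<zeta>. R \<xi> (\<xi> *\<^sub>R (\<zeta> *\<^sub>R R \<zeta> h) - \<zeta> *\<^sub>R (\<zeta> *\<^sub>R R \<zeta> h) + \<zeta> *\<^sub>R h)) \<longlongrightarrow>
      R \<xi> (\<xi> *\<^sub>R P h - 0 *\<^sub>R P h + 0 *\<^sub>R h)) (at_right 0)"
    by (intro bounded_linear.tendsto[OF bl] tendsto_intros R(2))
  moreover have "\<forall>\<^sub>F \<zeta> in at_right 0.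
      R \<xi> (\<xi> *\<^sub>R (\<zeta> *\<^sub>R R \<zeta> h) - \<zeta> *\<^sub>R (\<zeta> *\<^sub>R R \<zeta> h) + \<zeta> *\<^sub>R h) = \<zeta> *\<^sub>R R \<zeta> h"
    unfolding eventually_at_right_field
  proof (intro exI[of _ r] conjI allI impI r)
    fix \<zeta> :: real assume \<zeta>: "0 < \<zeta>" "\<zeta> < r"
    have "R \<xi> (\<xi> *\<^sub>R R \<zeta> h - (\<zeta> *\<^sub>R R \<zeta> h - h)) = R \<zeta> h"
      using R_inverse[OF R_\<xi> \<xi>(1) R_gen[OF R(1)[OF \<zeta>] \<zeta>(1)]] .
    moreover have "\<xi> *\<^sub>R (\<zeta> *\<^sub>R R \<zeta> h) - \<zeta> *\<^sub>R (\<zeta> *\<^sub>R R \<zeta> h) + \<zeta> *\<^sub>R h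
      = \<zeta> *\<^sub>R (\<xi> *\<^sub>R R \<zeta> h - (\<zeta> *\<^sub>R R \<zeta> h - h))"
      by (simp add: algebra_simps)
    ultimately show "R \<xi> (\<xi> *\<^sub>R (\<zeta> *\<^sub>R R \<zeta> h) - \<zeta> *\<^sub>R (\<zeta> *\<^sub>R R \<zeta> h) + \<zeta> *\<^sub>R h) = \<zeta> *\<^sub>R R \<zeta> h"
      by (simp only: linear_cmul[OF bounded_linear.linear[OF bl]])
  qed
  ultimately have "((\<lambda>\<zeta>. \<zeta> *\<^sub>R R \<zeta> h) \<longlongrightarrow> R \<xi> (\<xi> *\<^sub>R P h)) (at_right 0)"
    by (simp add: tendsto_cong)
  then have "R \<xi> (\<xi> *\<^sub>R P h) = P h"
    using R(2)[of h] tendsto_unique[OF trivial_limit_at_right_real] by blast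
  then show ?thesis using R_gen[OF R_\<xi> \<xi>(1), of "\<xi> *\<^sub>R P h"] by simp
qed

lemma P_P: "P (P h) = P h"
  using P_kernel P_in_kernel by blast

lemma P_sym: "P h \<bullet> k = h \<bullet> P k"
proof -
  obtain R where R: "\<And>\<zeta>. 0 < \<zeta> \<Longrightarrow> \<zeta> < r \<Longrightarrow> resolvent_at \<zeta> (R \<zeta>)"
    "\<And>h. ((\<lambda>\<zeta>. \<zeta> *\<^sub>R R \<zeta> h) \<longlongrightarrow> P h) (at_right 0)"
    using resolvent_family by metis
  have lim: "((\<lambda>\<zeta>. (\<zeta> *\<^sub>R R \<zeta> h) \<bullet> k) \<longlongrightarrow> P h \<bullet> k) (at_right 0)"
    by (intro tendsto_intros R)
  have "((\<lambda>\<zeta>. h \<bullet> (\<zeta> *\<^sub>R R \<zeta> k)) \<longlongrightarrow> h \<bullet> P k) (at_right 0)"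
    by (intro tendsto_intros R)
  moreover have "\<forall>\<^sub>F \<zeta> in at_right 0. h \<bullet> (\<zeta> *\<^sub>R R \<zeta> k) = (\<zeta> *\<^sub>R R \<zeta> h) \<bullet> k"
    unfolding eventually_at_right_field
    using R_sym[OF R(1)] r by (intro exI[of _ r]) auto
  ultimately have "((\<lambda>\<zeta>. (\<zeta> *\<^sub>R R \<zeta> h) \<bullet> k) \<longlongrightarrow> h \<bullet> P k) (at_right 0)"
    by (rule Lim_transform_eventually)
  with lim show ?thesis by (rule tendsto_unique[OF trivial_limit_at_right_real])
qed

lemma linear_P: "linear P"
  using bounded_linear_P bounded_linear.linear by blast

text \<open>\<open>P w\<close> lies in the kernel, so symmetry turns
  \<open>P w \<bullet> P w = w \<bullet> P w\<close> into \<open>u \<bullet> 0\<close>.\<close>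

lemma P_gen:
  assumes "(u, w) \<in> gen"
  shows "P w = 0"
proof -
  have "P w \<bullet> P w = w \<bullet> P w" using P_sym[of w "P w"] P_P by simp
  also have "\<dots> = u \<bullet> 0" using gen_sym[OF assms P_in_kernel] .
  finally show ?thesis by simp
qed

lemma P_T:
  assumes "t \<ge> 0"
  shows "T t (P h) = P (T t h)"
proof (rule T_commute[OF bounded_linear_P _ assms])
  fix u w assume uw: "(u, w) \<in> gen"
  show "(P u, P w) \<in> gen" using P_in_kernel P_gen[OF uw] by simp
qed

text \<open>For \<open>\<zeta> > 0\<close> the resolvent is positive and bounded by \<open>C\<close> on the kernel of \<open>P\<close>; the
  Cauchy-Schwarz inequality for its form gives \<open>\<parallel>R h\<parallel>\<^sup>2 \<le> C \<langle>R h, h\<rangle>\<close>.\<close>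

lemma spectral_gap:
  assumes vw: "(v, w) \<in> gen" and Pv: "P v = 0"
  shows "(norm v)\<^sup>2 \<le> - C * (w \<bullet> v)"
proof -
  obtain R where R: "\<And>\<zeta>. 0 < \<zeta> \<Longrightarrow> \<zeta> < r \<Longrightarrow> resolvent_at \<zeta> (R \<zeta>)"
    "\<And>\<zeta> h. 0 < \<zeta> \<Longrightarrow> \<zeta> < r \<Longrightarrow> norm (R \<zeta> h - P h /\<^sub>R \<zeta>) \<le> C * norm h"
    using resolvent_family by metis
  have *: "v \<bullet> v \<le> C * (v \<bullet> (\<zeta> *\<^sub>R v - w))" if \<zeta>: "0 < \<zeta>" "\<zeta> < r" for \<zeta>
  proof -
    note R_\<zeta> = R(1)[OF \<zeta>] \<zeta>(1)
    \<comment> \<open>This makes \<open>R \<zeta> h = v\<close>, so that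
      \<open>v \<bullet> h\<close> and \<open>v \<bullet> v\<close> are the values of the form of
      \<open>R \<zeta>\<close> at the pairs \<open>(h, h)\<close> and \<open>(h, v)\<close>.\<close>
    define h where "h = \<zeta> *\<^sub>R v - w"
    have Rh: "R \<zeta> h = v" unfolding h_def by (rule R_inverse[OF R_\<zeta> vw])
    have lin: "linear (R \<zeta>)" using bounded_linear_R[OF R_\<zeta>] by (rule bounded_linear.linear)
    have Rv: "norm (R \<zeta> v) \<le> C * norm v" using R(2)[OF \<zeta>, of v] Pv by simp
    have CS: "(v \<bullet> v)\<^sup>2 \<le> (v \<bullet> h) * (R \<zeta> v \<bullet> v)"
    proof -
      have "0 \<le> R \<zeta> (x *\<^sub>R h + y *\<^sub>R v) \<bullet> (x *\<^sub>R h + y *\<^sub>R v)" for x y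
        by (rule R_nonneg[OF R_\<zeta>])
      moreover have "R \<zeta> v \<bullet> h = v \<bullet> v" using R_sym[OF R_\<zeta>, of v h] Rh by simp
      ultimately have quad: "0 \<le> x\<^sup>2 * (v \<bullet> h) + 2 * x * y * (v \<bullet> v) + y\<^sup>2 * (R \<zeta> v \<bullet> v)" for x y
        using Rh by (simp add: linear_add[OF lin] linear_cmul[OF lin] inner_add_left inner_add_right
            power2_eq_square algebra_simps)
      have nn: "0 \<le> v \<bullet> h" "0 \<le> R \<zeta> v \<bullet> v"
        using R_nonneg[OF R_\<zeta>, of h] R_nonneg[OF R_\<zeta>, of v] Rh by auto
      show ?thesis
      proof (cases "R \<zeta> v \<bullet> v = 0")
        case True
        have "v \<bullet> v = 0"
        proof (rule ccontr)
          assume nz: "v \<bullet> v \<noteq> 0"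
          \<comment> \<open>In this degenerate case the quadratic expression is affine in
            \<open>y\<close>, and the chosen \<open>y\<close> gives it the value -1.\<close>
          have "0 \<le> (v \<bullet> h) + 2 * (- (v \<bullet> h + 1) / (2 * (v \<bullet> v))) * (v \<bullet> v)"
            using quad[of 1 "- (v \<bullet> h + 1) / (2 * (v \<bullet> v))"] True by simp
          also have "\<dots> = -1" using nz by (simp add: field_simps)
          finally show False by simp
        qed
        then show ?thesis using True by simp
      next
        case False
        then have pos: "R \<zeta> v \<bullet> v > 0" using nn by simp
        \<comment> \<open>The minimising ratio of \<open>x\<close> to \<open>y\<close>, cleared of
          its denominator.\<close>
        have "0 \<le> (R \<zeta> v \<bullet> v)\<^sup>2 * (v \<bullet> h) + 2 * (R \<zeta> v \<bullet> v) * (- (v \<bullet> v)) * (v \<bullet> v)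
            + (- (v \<bullet> v))\<^sup>2 * (R \<zeta> v \<bullet> v)" by (rule quad)
        also have "\<dots> = (R \<zeta> v \<bullet> v) * ((v \<bullet> h) * (R \<zeta> v \<bullet> v) - (v \<bullet> v)\<^sup>2)"
          by (simp add: power2_eq_square algebra_simps)
        finally show ?thesis using pos by (simp add: zero_le_mult_iff)
      qed
    qed
    have "R \<zeta> v \<bullet> v \<le> norm (R \<zeta> v) * norm v" by (rule norm_cauchy_schwarz)
    also have "\<dots> \<le> C * norm v * norm v" using Rv by (intro mult_right_mono) auto
    also have "\<dots> = C * (v \<bullet> v)" by (simp add: power2_eq_square flip: power2_norm_eq_inner)
    finally have le: "R \<zeta> v \<bullet> v \<le> C * (v \<bullet> v)" .
    have "0 \<le> v \<bullet> h" using R_nonneg[OF R_\<zeta>, of h] Rh by simp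
    then have "(v \<bullet> v) * (v \<bullet> v) \<le> (C * (v \<bullet> h)) * (v \<bullet> v)"
      using CS mult_left_mono[OF le \<open>0 \<le> v \<bullet> h\<close>] by (simp add: power2_eq_square mult_ac)
    then show ?thesis
      using \<open>0 \<le> v \<bullet> h\<close> C by (cases "v \<bullet> v = 0") (auto simp: h_def)
  qed
  \<comment> \<open>The bound holds with the same \<open>C\<close> for all small
    \<open>\<zeta>\<close>; in the limit the term with \<open>\<zeta>\<close> disappears.\<close>
  have "v \<bullet> v \<le> C * (v \<bullet> (0 *\<^sub>R v - w))"
  proof (rule tendsto_le[OF trivial_limit_at_right_real])
    show "((\<lambda>\<zeta>. C * (v \<bullet> (\<zeta> *\<^sub>R v - w))) \<longlongrightarrow> C * (v \<bullet> (0 *\<^sub>R v - w))) (at_right 0)"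
      by (intro tendsto_intros)
    show "((\<lambda>\<zeta>. v \<bullet> v) \<longlongrightarrow> v \<bullet> v) (at_right (0::real))" by (rule tendsto_const)
    show "\<forall>\<^sub>F \<zeta> in at_right 0. v \<bullet> v \<le> C * (v \<bullet> (\<zeta> *\<^sub>R v - w))"
      unfolding eventually_at_right_field using * r by blast
  qed
  then show ?thesis by (simp add: power2_norm_eq_inner inner_commute)
qed

text \<open>With the weight \<open>exp (2 * s / C)\<close> the spectral gap makes the squared norm
  of the orbit of \<open>v = u - P u\<close> nonincreasing. The gap is available along the whole
  orbit because \<open>P\<close> commutes with \<open>T s\<close>.\<close>

lemma exponential_decay:
  assumes "t \<ge> 0"
  shows "norm (T t (u - P u)) \<le> exp (- t / C) * norm (u - P u)"
proof (induction u rule: gen_dense_induct)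
  case (1 u w)
  define v where "v = u - P u"
  have vw: "(v, w) \<in> gen" unfolding v_def using gen_diff[OF 1 P_in_kernel] by simp
  have Pv: "P v = 0" by (simp add: v_def linear_diff[OF linear_P] P_P)
  define F where "F s = exp (2 * s / C) * (T s v \<bullet> T s v)" for s
  have "F t \<le> F 0"
  proof (rule derivative_nonpos_imp_le[of 0 t "F"])
    show "continuous_on {0..t} F"
      unfolding F_def using C by (intro continuous_intros continuous_on_subset[OF continuous_orbit]) auto
    fix s assume s: "0 < s" "s < t"
    note dv = has_vector_derivative_orbit[OF vw s(1)]
    note inner = bounded_bilinear.has_vector_derivative[OF bounded_bilinear_inner,
        folded has_real_derivative_iff_has_vector_derivative]
    have "(F has_real_derivative (exp (2 * s / C) * (2 / C) * (T s v \<bullet> T s v)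
        + (T s v \<bullet> T s w + T s w \<bullet> T s v) * exp (2 * s / C))) (at s)"
      unfolding F_def[abs_def]
    proof (rule DERIV_mult[OF _ inner[OF dv dv]])
      have "((\<lambda>s. exp (s * (2 / C))) has_real_derivative exp (s * (2 / C)) * (2 / C)) (at s)"
        using C by (auto intro!: derivative_eq_intros)
      then show "((\<lambda>s. exp (2 * s / C)) has_real_derivative exp (2 * s / C) * (2 / C)) (at s)"
        by (simp add: mult.commute)
    qed
    also have "exp (2 * s / C) * (2 / C) * (T s v \<bullet> T s v)
        + (T s v \<bullet> T s w + T s w \<bullet> T s v) * exp (2 * s / C)
        = 2 / C * exp (2 * s / C) * (T s v \<bullet> T s v + C * (T s w \<bullet> T s v))"
      using C by (simp add: inner_commute field_simps)
    finally show "(F has_real_derivative 2 / C * exp (2 * s / C) *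
      (T s v \<bullet> T s v + C * (T s w \<bullet> T s v))) (at s)" .
    have "P (T s v) = 0"
      using P_T[of s v] Pv s linear_0[OF lin[of s]] by simp
    then have "(norm (T s v))\<^sup>2 \<le> - C * (T s w \<bullet> T s v)"
      using s by (intro spectral_gap gen_T vw) auto
    then show "2 / C * exp (2 * s / C) * (T s v \<bullet> T s v + C * (T s w \<bullet> T s v)) \<le> 0"
      using C by (intro mult_nonneg_nonpos) (auto simp: power2_norm_eq_inner)
  qed (use assms in auto)
  then have "exp (2 * t / C) * (norm (T t v))\<^sup>2 \<le> (norm v)\<^sup>2"
    by (simp add: F_def T_0 power2_norm_eq_inner)
  moreover have "exp (2 * t / C) = (exp (t / C))\<^sup>2"
    by (simp add: power2_eq_square flip: exp_add)
  ultimately have "(exp (t / C) * norm (T t v))\<^sup>2 \<le> (norm v)\<^sup>2"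
    by (simp add: power_mult_distrib)
  then have "exp (t / C) * norm (T t v) \<le> norm v" by (rule power2_le_imp_le) simp
  then have "exp (- t / C) * (exp (t / C) * norm (T t v)) \<le> exp (- t / C) * norm v"
    by (intro mult_left_mono) auto
  then show ?case by (simp add: v_def mult.assoc[symmetric] flip: exp_add)
next
  case 2
  have "bounded_linear (\<lambda>u. u - P u)"
    by (intro bounded_linear_sub bounded_linear_ident bounded_linear_P)
  then have "continuous_on UNIV (\<lambda>u. u - P u)" "continuous_on UNIV (\<lambda>u. T t (u - P u))"
    using bounded_linear_compose[OF bl[OF assms]] linear_continuous_on by blast+
  then show ?case
    using linear_continuous_on[OF bounded_linear_P] by (intro closed_Collect_le continuous_intros)
qed

text \<open>Pythagoras for the symmetric idempotent \<open>P\<close>.\<close>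

lemma norm_diff_P_le: "norm (h - P h) \<le> norm h"
proof -
  have "(h - P h) \<bullet> (h - P h) = h \<bullet> h - P h \<bullet> P h"
    using P_sym[of h h] P_sym[of h "P h"] P_P[of h]
    by (simp add: inner_diff_left inner_diff_right inner_commute)
  also have "\<dots> \<le> h \<bullet> h" by simp
  finally show ?thesis by (simp add: norm_le)
qed

text \<open>The time is split as \<open>n + s + n\<close>. Symmetry moves one outer piece onto
  \<open>k\<close>, both outer pieces are paid for by powers of \<open>R\<close>, and the middle
  piece decays exponentially on \<open>g - P g\<close>.\<close>

lemma decay_estimate:
  assumes R: "resolvent_at \<zeta> R" and \<zeta>: "\<zeta> > 0" and t: "t \<ge> 2 * real n"
  shows "\<bar>(T t f - P f) \<bullet> k\<bar> \<le>
    (\<zeta> + 1) ^ (2 * n) * exp (- (t - 2 * real n) / C) * norm ((R ^^ n) f) * norm ((R ^^ n) k)"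
proof -
  define s where "s = t - 2 * real n"
  have s: "s \<ge> 0" "t \<ge> 0" using t by (auto simp: s_def)
  define g where "g = T (real n) f"
  have T_P: "T (real n) (f - P f) = g - P g"
    using linear_diff[OF lin[of "real n"]] P_T[of "real n" f] by (simp add: g_def)
  \<comment> \<open>The semigroup is the identity on the range of \<open>P\<close>.\<close>
  have "T t f - P f = T t (f - P f)"
    using T_kernel[OF P_in_kernel s(2)] linear_diff[OF lin[OF s(2)]] by simp
  also have "\<dots> = T (real n) (T s (g - P g))"
    using T_add[of "real n + s" "real n" "f - P f"] T_add[of "real n" s "g - P g"] s T_P
    by (simp add: s_def)
  finally have "(T t f - P f) \<bullet> k = T s (g - P g) \<bullet> T (real n) k"
    using T_sym[of "real n"] by simp
  then have "\<bar>(T t f - P f) \<bullet> k\<bar> \<le> norm (T s (g - P g)) * norm (T (real n) k)"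
    by (metis Cauchy_Schwarz_ineq2)
  also have "\<dots> \<le> (exp (- s / C) * norm g) * norm (T (real n) k)"
  proof (intro mult_right_mono norm_ge_zero)
    have "norm (T s (g - P g)) \<le> exp (- s / C) * norm (g - P g)"
      using s by (intro exponential_decay)
    also have "\<dots> \<le> exp (- s / C) * norm g"
      by (intro mult_left_mono norm_diff_P_le) auto
    finally show "norm (T s (g - P g)) \<le> exp (- s / C) * norm g" .
  qed
  also have "\<dots> \<le> (exp (- s / C) * ((\<zeta> + 1) ^ n * norm ((R ^^ n) f))) *
      ((\<zeta> + 1) ^ n * norm ((R ^^ n) k))"
    using T_nat_le_R_power[OF R \<zeta>] \<zeta> unfolding g_def
    by (intro mult_mono mult_nonneg_nonneg) auto
  also have "\<dots> = (\<zeta> + 1) ^ (2 * n) * exp (- (t - 2 * real n) / C) *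
      norm ((R ^^ n) f) * norm ((R ^^ n) k)"
    by (simp add: s_def power_mult power2_eq_square mult_ac)
  finally show ?thesis .
qed

end

section \<open>The Hilbert space of square integrable functions\<close>

lemma L2_measurable: "f \<in> L2 M \<Longrightarrow> f \<in> borel_measurable M"
  by (simp add: L2_def)

lemma L2_integrable: "f \<in> L2 M \<Longrightarrow> integrable M (\<lambda>x. (norm (f x))\<^sup>2)"
  by (simp add: L2_def)

lemma L2_zero: "(\<lambda>x. 0) \<in> L2 M"
  by (simp add: L2_def)

lemma L2_mult: "f \<in> L2 M \<Longrightarrow> (\<lambda>x. c * f x) \<in> L2 M"
  by (auto simp: L2_def norm_mult power_mult_distrib)

lemma L2_scaleR: "f \<in> L2 M \<Longrightarrow> (\<lambda>x. a *\<^sub>R f x) \<in> L2 M"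
  unfolding scaleR_conv_of_real by (rule L2_mult)

lemma L2_uminus: "f \<in> L2 M \<Longrightarrow> (\<lambda>x. - f x) \<in> L2 M"
  using L2_mult[of f M "-1"] by simp

lemma L2_add:
  assumes "f \<in> L2 M" "g \<in> L2 M"
  shows "(\<lambda>x. f x + g x) \<in> L2 M"
proof -
  have "integrable M (\<lambda>x. (norm (f x + g x))\<^sup>2)"
  proof (rule Bochner_Integration.integrable_bound)
    show "integrable M (\<lambda>x. 2 * (norm (f x))\<^sup>2 + 2 * (norm (g x))\<^sup>2)"
      using assms by (auto simp: L2_def)
    show "(\<lambda>x. (norm (f x + g x))\<^sup>2) \<in> borel_measurable M"
      using assms by (auto simp: L2_def)
    have "(norm (a + b))\<^sup>2 \<le> 2 * (norm a)\<^sup>2 + 2 * (norm b)\<^sup>2" for a b :: complex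
    proof -
      have "0 \<le> (a - b) \<bullet> (a - b)" by simp
      then show ?thesis
        by (simp add: power2_norm_eq_inner inner_add_left inner_add_right inner_diff_left
            inner_diff_right inner_commute)
    qed
    then show "AE x in M. norm ((norm (f x + g x))\<^sup>2) \<le> norm (2 * (norm (f x))\<^sup>2 + 2 * (norm (g x))\<^sup>2)"
      by auto
  qed
  then show ?thesis using assms by (auto simp: L2_def)
qed

lemma L2_diff: "f \<in> L2 M \<Longrightarrow> g \<in> L2 M \<Longrightarrow> (\<lambda>x. f x - g x) \<in> L2 M"
  using L2_add[OF _ L2_uminus] by fastforce

lemma L2_cnj: "f \<in> L2 M \<Longrightarrow> (\<lambda>x. cnj (f x)) \<in> L2 M"
  using measurable_compose[OF _ borel_measurable_continuous_onI[OF linear_continuous_on[OF bounded_linear_cnj]]]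
  by (auto simp: L2_def)

lemma L2_norm_nonneg: "0 \<le> L2_norm M f"
  by (simp add: L2_norm_def)

lemma L2_bounded:
  assumes "finite_measure M" "f \<in> borel_measurable M" "\<And>x. norm (f x) \<le> B"
  shows "f \<in> L2 M"
proof -
  interpret finite_measure M by fact
  have "integrable M (\<lambda>x. (norm (f x))\<^sup>2)"
    using assms by (intro integrable_const_bound[of _ "B\<^sup>2"]) (auto intro!: power_mono)
  then show ?thesis using assms by (simp add: L2_def)
qed

lemma integrable_norm_mult_L2:
  assumes "f \<in> L2 M" "g \<in> L2 M"
  shows "integrable M (\<lambda>x. norm (f x) * norm (g x))"
proof (rule Bochner_Integration.integrable_bound)
  show "integrable M (\<lambda>x. (norm (f x))\<^sup>2 + (norm (g x))\<^sup>2)"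
    using assms by (auto simp: L2_def)
  show "(\<lambda>x. norm (f x) * norm (g x)) \<in> borel_measurable M"
    using assms by (auto simp: L2_def)
  have "a * b \<le> a\<^sup>2 + b\<^sup>2" if "a \<ge> 0" "b \<ge> 0" for a b :: real
    using that sum_squares_bound[of a b] mult_nonneg_nonneg[of a b] by linarith
  then show "AE x in M. norm (norm (f x) * norm (g x)) \<le> norm ((norm (f x))\<^sup>2 + (norm (g x))\<^sup>2)"
    by auto
qed

lemma integrable_mult_L2:
  assumes "f \<in> L2 M" "g \<in> L2 M"
  shows "integrable M (\<lambda>x. f x * cnj (g x))"
  using L2_measurable[OF assms(1)] L2_measurable[OF L2_cnj[OF assms(2)]]
  by (intro Bochner_Integration.integrable_bound[OF integrable_norm_mult_L2[OF assms]])
    (auto simp: norm_mult)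

lemma integrable_inner_L2:
  assumes "f \<in> L2 M" "g \<in> L2 M"
  shows "integrable M (\<lambda>x. f x \<bullet> g x)"
  using assms by (intro Bochner_Integration.integrable_bound[OF integrable_norm_mult_L2[OF assms]])
    (auto simp: L2_def Cauchy_Schwarz_ineq2)

text \<open>The bridge from the complex form that defines \<open>A\<close> to the real inner product
  of the Hilbert space.\<close>

lemma integral_inner_eq_Re:
  assumes "f \<in> L2 M" "g \<in> L2 M"
  shows "(\<integral>x. f x \<bullet> g x \<partial>M) = Re (\<integral>x. f x * cnj (g x) \<partial>M)"
  using integral_Re[OF integrable_mult_L2[OF assms]] by (simp add: inner_complex_def)

text \<open>Riesz-Fischer. Along a subsequence with squared increments below
  \<open>(1/8) ^ k\<close> in the mean, the series of squares weighted by \<open>4 ^ k\<close> still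
  has finite integral, so almost everywhere the increments are dominated by a multiple of
  \<open>(1/2) ^ k\<close>. Fatou's lemma turns the pointwise limit into an \<open>L^2\<close> limit
  of the full sequence.\<close>

lemma L2_Cauchy_limit:
  fixes f :: "nat \<Rightarrow> 'a \<Rightarrow> complex"
  assumes f: "\<And>n. f n \<in> L2 M"
    and Cauchy: "\<And>e. e > 0 \<Longrightarrow> \<exists>N. \<forall>m\<ge>N. \<forall>n\<ge>N. (\<integral>x. (norm (f m x - f n x))\<^sup>2 \<partial>M) < e"
  shows "\<exists>g\<in>L2 M. (\<lambda>n. \<integral>x. (norm (f n x - g x))\<^sup>2 \<partial>M) \<longlonglongrightarrow> 0"
proof -
  note [measurable] = L2_measurable[OF f]
  have nn: "(\<integral>\<^sup>+x. ennreal ((norm (f m x - f n x))\<^sup>2) \<partial>M)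
      = ennreal (\<integral>x. (norm (f m x - f n x))\<^sup>2 \<partial>M)" for m n
    by (intro nn_integral_eq_integral L2_integrable[OF L2_diff[OF f f]]) auto
  have "\<exists>s. \<forall>k::nat. s k < s (Suc k) \<and> (\<forall>m\<ge>s k. \<forall>n\<ge>s k. (\<integral>x. (norm (f m x - f n x))\<^sup>2 \<partial>M) < (1/8) ^ k)"
  proof -
    have "\<exists>s. \<forall>k::nat. (\<forall>m\<ge>s k. \<forall>n\<ge>s k. (\<integral>x. (norm (f m x - f n x))\<^sup>2 \<partial>M) < (1/8) ^ k) \<and> s k < s (Suc k)"
    proof (rule dependent_nat_choice)
      show "\<exists>N. \<forall>m\<ge>N. \<forall>n\<ge>N. (\<integral>x. (norm (f m x - f n x))\<^sup>2 \<partial>M) < (1/8) ^ 0"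
        by (rule Cauchy) simp
      fix a k :: nat
      obtain N where "\<forall>m\<ge>N. \<forall>n\<ge>N. (\<integral>x. (norm (f m x - f n x))\<^sup>2 \<partial>M) < (1/8) ^ Suc k"
        using Cauchy[of "(1/8) ^ Suc k"] by auto
      then show "\<exists>N. (\<forall>m\<ge>N. \<forall>n\<ge>N. (\<integral>x. (norm (f m x - f n x))\<^sup>2 \<partial>M) < (1/8) ^ Suc k) \<and> a < N"
        by (intro exI[of _ "max N (Suc a)"]) auto
    qed
    then show ?thesis by blast
  qed
  then obtain s where s: "\<And>k. s k < s (Suc k)"
    "\<And>k m n. m \<ge> s k \<Longrightarrow> n \<ge> s k \<Longrightarrow> (\<integral>x. (norm (f m x - f n x))\<^sup>2 \<partial>M) < (1/8) ^ k"
    by blast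
  define d where "d k x = f (s (Suc k)) x - f (s k) x" for k x
  have [measurable]: "d k \<in> borel_measurable M" for k
    unfolding d_def[abs_def] by measurable
  have "AE x in M. summable (\<lambda>k. 4 ^ k * (norm (d k x))\<^sup>2)"
  proof -
    have "(\<integral>\<^sup>+x. (\<Sum>k. ennreal (4 ^ k * (norm (d k x))\<^sup>2)) \<partial>M)
        = (\<Sum>k. \<integral>\<^sup>+x. ennreal (4 ^ k * (norm (d k x))\<^sup>2) \<partial>M)"
      by (rule nn_integral_suminf) measurable
    also have "\<dots> \<le> (\<Sum>k. ennreal ((1/2) ^ k))"
    proof (intro suminf_le allI)
      fix k
      have "(\<integral>\<^sup>+x. ennreal (4 ^ k * (norm (d k x))\<^sup>2) \<partial>M)
          = ennreal (4 ^ k) * (\<integral>\<^sup>+x. ennreal ((norm (d k x))\<^sup>2) \<partial>M)"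
        by (simp add: ennreal_mult nn_integral_cmult)
      also have "\<dots> \<le> ennreal (4 ^ k) * ennreal ((1/8) ^ k)"
        unfolding d_def nn using s(2)[of k "s (Suc k)" "s k"] s(1)[of k]
        by (intro mult_left_mono ennreal_leI) auto
      also have "\<dots> = ennreal ((1/2) ^ k)"
        by (simp flip: ennreal_mult power_mult_distrib)
      finally show "(\<integral>\<^sup>+x. ennreal (4 ^ k * (norm (d k x))\<^sup>2) \<partial>M) \<le> ennreal ((1/2) ^ k)" .
    qed auto
    also have "\<dots> = ennreal (\<Sum>k. (1/2) ^ k)"
      by (intro suminf_ennreal2 summable_geometric) auto
    finally have "(\<integral>\<^sup>+x. (\<Sum>k. ennreal (4 ^ k * (norm (d k x))\<^sup>2)) \<partial>M) \<noteq> \<infinity>"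
      by (auto simp: top_unique)
    then have "AE x in M. (\<Sum>k. ennreal (4 ^ k * (norm (d k x))\<^sup>2)) \<noteq> \<infinity>"
      by (intro nn_integral_PInf_AE) auto
    then show ?thesis
      by (rule AE_mp) (auto intro!: AE_I2 summable_suminf_not_top)
  qed
  then have conv: "AE x in M. convergent (\<lambda>k. f (s k) x)"
  proof (rule AE_mp, intro AE_I2 impI)
    fix x assume "summable (\<lambda>k. 4 ^ k * (norm (d k x))\<^sup>2)"
    then have "Bseq (\<lambda>k. 4 ^ k * (norm (d k x))\<^sup>2)"
      using summable_LIMSEQ_zero convergentI convergent_imp_Bseq by blast
    then obtain B where B: "B > 0" "\<And>k. 4 ^ k * (norm (d k x))\<^sup>2 \<le> B"
      unfolding Bseq_def by auto
    have bound: "norm (d k x) \<le> sqrt B * (1/2) ^ k" for k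
    proof (rule power2_le_imp_le)
      have "(norm (d k x))\<^sup>2 \<le> B * (1/4) ^ k"
        using B(2)[of k] by (simp add: power_divide field_simps)
      also have "\<dots> = (sqrt B * (1/2) ^ k)\<^sup>2"
        using B(1) by (simp add: power_mult_distrib power_mult[symmetric] mult.commute[of k] power_divide)
          (simp add: power_mult)
      finally show "(norm (d k x))\<^sup>2 \<le> (sqrt B * (1/2) ^ k)\<^sup>2" .
    qed (use B in simp)
    have "summable (\<lambda>k. d k x)"
      by (rule summable_comparison_test'[OF summable_mult[OF summable_geometric] bound]) auto
    then have "convergent (\<lambda>n. \<Sum>k<n. d k x)" by (simp add: summable_iff_convergent)
    moreover have "(\<Sum>k<n. d k x) = f (s n) x - f (s 0) x" for n
      unfolding d_def by (rule sum_lessThan_telescope)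
    ultimately show "convergent (\<lambda>k. f (s k) x)"
      by (simp add: convergent_diff_const_right_iff)
  qed
  define g where "g x = lim (\<lambda>k. f (s k) x)" for x
  have [measurable]: "g \<in> borel_measurable M"
    unfolding g_def[abs_def] by (rule borel_measurable_lim_metric) measurable
  have lim: "AE x in M. (\<lambda>k. f (s k) x) \<longlonglongrightarrow> g x"
    using conv by eventually_elim (simp add: g_def convergent_LIMSEQ_iff)
  have s_ge: "s k \<ge> k" for k
    using s(1) strict_mono_imp_increasing[of s k] strict_mono_Suc_iff by blast
  \<comment> \<open>The subsequence takes the place of the second index; \<open>s k \<ge> k\<close>
    brings it past \<open>N\<close>.\<close>
  have Fatou: "(\<integral>\<^sup>+x. ennreal ((norm (f m x - g x))\<^sup>2) \<partial>M) \<le> ennreal e"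
    if N: "\<forall>m\<ge>N. \<forall>n\<ge>N. (\<integral>x. (norm (f m x - f n x))\<^sup>2 \<partial>M) < e" and "m \<ge> N" for e N m
  proof -
    have "(\<integral>\<^sup>+x. ennreal ((norm (f m x - g x))\<^sup>2) \<partial>M)
      = (\<integral>\<^sup>+x. liminf (\<lambda>k. ennreal ((norm (f m x - f (s k) x))\<^sup>2)) \<partial>M)"
    proof (rule nn_integral_cong_AE)
      show "AE x in M. ennreal ((norm (f m x - g x))\<^sup>2) = liminf (\<lambda>k. ennreal ((norm (f m x - f (s k) x))\<^sup>2))"
        using lim
      proof eventually_elim
        fix x assume "(\<lambda>k. f (s k) x) \<longlonglongrightarrow> g x"
        then have "(\<lambda>k. ennreal ((norm (f m x - f (s k) x))\<^sup>2)) \<longlonglongrightarrow> ennreal ((norm (f m x - g x))\<^sup>2)"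
          by (intro tendsto_intros)
        then show "ennreal ((norm (f m x - g x))\<^sup>2) = liminf (\<lambda>k. ennreal ((norm (f m x - f (s k) x))\<^sup>2))"
          using lim_imp_Liminf[OF sequentially_bot] by metis
      qed
    qed
    also have "\<dots> \<le> liminf (\<lambda>k. \<integral>\<^sup>+x. ennreal ((norm (f m x - f (s k) x))\<^sup>2) \<partial>M)"
      by (rule nn_integral_liminf) measurable
    also have "\<dots> \<le> ennreal e"
    proof (rule order_trans[OF Liminf_le_Limsup Limsup_bounded])
      show "\<forall>\<^sub>F k in sequentially. (\<integral>\<^sup>+x. ennreal ((norm (f m x - f (s k) x))\<^sup>2) \<partial>M) \<le> ennreal e"
        unfolding nn using N \<open>m \<ge> N\<close> s_ge
        by (intro eventually_sequentiallyI[of N] ennreal_leI) (meson less_imp_le order_trans)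
    qed simp
    finally show ?thesis .
  qed
  obtain N where N: "\<forall>m\<ge>N. \<forall>n\<ge>N. (\<integral>x. (norm (f m x - f n x))\<^sup>2 \<partial>M) < 1"
    using Cauchy[of 1] by auto
  have "integrable M (\<lambda>x. (norm (f N x - g x))\<^sup>2)"
    using Fatou[OF N order_refl] by (intro integrableI_bounded) (auto simp: less_top[symmetric] top_unique)
  then have "(\<lambda>x. f N x - g x) \<in> L2 M" by (simp add: L2_def)
  from L2_diff[OF f[of N] this] have g: "g \<in> L2 M" by simp
  have "(\<lambda>n. \<integral>x. (norm (f n x - g x))\<^sup>2 \<partial>M) \<longlonglongrightarrow> 0"
    unfolding LIMSEQ_iff
  proof (intro allI impI)
    fix e :: real assume "e > 0"
    then obtain N where N: "\<forall>m\<ge>N. \<forall>n\<ge>N. (\<integral>x. (norm (f m x - f n x))\<^sup>2 \<partial>M) < e / 2"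
      using Cauchy[of "e / 2"] by auto
    have "(\<integral>x. (norm (f m x - g x))\<^sup>2 \<partial>M) \<le> e / 2" if "m \<ge> N" for m
      using Fatou[OF N that] \<open>e > 0\<close>
      by (subst (asm) nn_integral_eq_integral) (auto intro: L2_integrable[OF L2_diff[OF f g]])
    then have "(\<integral>x. (norm (f m x - g x))\<^sup>2 \<partial>M) < e" if "m \<ge> N" for m
      using that \<open>e > 0\<close> by fastforce
    then show "\<exists>no. \<forall>n\<ge>no. norm ((\<integral>x. (norm (f n x - g x))\<^sup>2 \<partial>M) - 0) < e"
      by (intro exI[of _ N]) auto
  qed
  with g show ?thesis by blast
qed

\<comment> \<open>The Hilbert space of classes modulo null sets\<close>
\<comment> \<open>A type cannot depend on the term \<open>\<mu>\<close>, so the space is built once,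
  over Lebesgue measure, and the weighted spaces are mapped onto it later. The relation is partial
  because functions outside \<open>L2 lborel\<close> have no class.\<close>
quotient_type (overloaded) 'a l2 = "'a::euclidean_space \<Rightarrow> complex" /
    partial: "\<lambda>f g. f \<in> L2 lborel \<and> g \<in> L2 lborel \<and> (AE x in lborel. f x = g x)"
  morphisms rep_l2 abs_l2
proof (rule part_equivpI)
  show "\<exists>f::'a \<Rightarrow> complex. f \<in> L2 lborel \<and> f \<in> L2 lborel \<and> (AE x in lborel. f x = f x)"
    using L2_zero by auto
qed (auto intro!: sympI transpI elim: AE_mp)

lemma rep_l2: "rep_l2 F \<in> L2 lborel"
  using Quotient3_rep_reflp[OF Quotient3_l2, of F] by blast

lemma abs_l2_rep [simp]: "abs_l2 (rep_l2 F) = F"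
  by (rule Quotient3_abs_rep[OF Quotient3_l2])

lemma abs_l2_eq_iff:
  "f \<in> L2 lborel \<Longrightarrow> g \<in> L2 lborel \<Longrightarrow> abs_l2 f = abs_l2 g \<longleftrightarrow> (AE x in lborel. f x = g x)"
  using Quotient3_rel[OF Quotient3_l2, of f g] by auto

instantiation l2 :: (euclidean_space) real_vector
begin

lift_definition zero_l2 :: "'a l2" is "\<lambda>x. 0" by (auto intro: L2_zero)

lift_definition plus_l2 :: "'a l2 \<Rightarrow> 'a l2 \<Rightarrow> 'a l2" is "\<lambda>f g x. f x + g x"
  by (auto intro: L2_add elim!: AE_mp)

lift_definition uminus_l2 :: "'a l2 \<Rightarrow> 'a l2" is "\<lambda>f x. - f x"
  by (auto intro: L2_uminus)

lift_definition minus_l2 :: "'a l2 \<Rightarrow> 'a l2 \<Rightarrow> 'a l2" is "\<lambda>f g x. f x - g x"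
  by (auto intro: L2_diff elim!: AE_mp)

lift_definition scaleR_l2 :: "real \<Rightarrow> 'a l2 \<Rightarrow> 'a l2" is "\<lambda>a f x. a *\<^sub>R f x"
  by (auto intro: L2_scaleR)

instance
proof
  fix F G H :: "'a l2" and a b :: real
  show "F + G + H = F + (G + H)" by transfer (auto intro!: L2_add simp: add.assoc)
  show "F + G = G + F" by transfer (auto intro!: L2_add simp: add.commute)
  show "0 + F = F" by transfer auto
  show "- F + F = 0" by transfer (auto intro!: L2_zero)
  show "F - G = F + - G" by transfer (auto intro!: L2_add L2_diff L2_uminus)
  show "a *\<^sub>R (F + G) = a *\<^sub>R F + a *\<^sub>R G"
    by transfer (auto intro!: L2_add L2_scaleR simp: scaleR_add_right)
  show "(a + b) *\<^sub>R F = a *\<^sub>R F + b *\<^sub>R F"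
    by transfer (auto intro!: L2_add L2_scaleR simp: scaleR_add_left)
  show "a *\<^sub>R b *\<^sub>R F = (a * b) *\<^sub>R F" by transfer (auto intro!: L2_scaleR)
  show "1 *\<^sub>R F = F" by transfer auto
qed

end

instantiation l2 :: (euclidean_space) real_inner
begin

lift_definition inner_l2 :: "'a l2 \<Rightarrow> 'a l2 \<Rightarrow> real" is "\<lambda>f g. \<integral>x. f x \<bullet> g x \<partial>lborel"
  by (intro integral_cong_AE borel_measurable_inner) (auto dest: L2_measurable elim!: AE_mp)

definition norm_l2 :: "'a l2 \<Rightarrow> real" where "norm_l2 F = sqrt (F \<bullet> F)"

definition sgn_l2 :: "'a l2 \<Rightarrow> 'a l2" where "sgn_l2 F = F /\<^sub>R norm F"

definition dist_l2 :: "'a l2 \<Rightarrow> 'a l2 \<Rightarrow> real" where "dist_l2 F G = norm (F - G)"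

definition uniformity_l2 :: "('a l2 \<times> 'a l2) filter" where
  "uniformity_l2 = (INF e\<in>{0<..}. principal {(x, y). dist x y < e})"

definition open_l2 :: "'a l2 set \<Rightarrow> bool" where
  "open_l2 U \<longleftrightarrow> (\<forall>x\<in>U. \<forall>\<^sub>F (x', y) in uniformity. x' = x \<longrightarrow> y \<in> U)"

instance
proof
  fix F G H :: "'a l2" and a :: real
  show "dist F G = norm (F - G)" by (simp add: dist_l2_def)
  show "sgn F = F /\<^sub>R norm F" by (simp add: sgn_l2_def)
  show "uniformity = (INF e\<in>{0<..}. principal {(x, y :: 'a l2). dist x y < e})"
    by (simp add: uniformity_l2_def)
  show "open U = (\<forall>x\<in>U. \<forall>\<^sub>F (x', y) in uniformity. x' = x \<longrightarrow> y \<in> U)" for U :: "'a l2 set"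
    by (simp add: open_l2_def)
  show "F \<bullet> G = G \<bullet> F" by transfer (simp add: inner_commute)
  show "(F + G) \<bullet> H = F \<bullet> H + G \<bullet> H"
    by transfer (simp add: inner_add_left integrable_inner_L2)
  show "(a *\<^sub>R F) \<bullet> G = a * (F \<bullet> G)" by transfer simp
  show "0 \<le> F \<bullet> F" by transfer simp
  show "F \<bullet> F = 0 \<longleftrightarrow> F = 0"
  proof (transfer, elim conjE)
    fix f :: "'a \<Rightarrow> complex" assume f: "f \<in> L2 lborel"
    have "(\<integral>x. f x \<bullet> f x \<partial>lborel) = 0 \<longleftrightarrow> (AE x in lborel. f x \<bullet> f x = 0)"
      using f by (intro integral_nonneg_eq_0_iff_AE integrable_inner_L2) auto
    then show "(\<integral>x. f x \<bullet> f x \<partial>lborel) = 0 \<longleftrightarrow>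
        f \<in> L2 lborel \<and> (\<lambda>x. 0) \<in> L2 (lborel :: 'a measure) \<and> (AE x in lborel. f x = 0)"
      using f by (simp add: L2_zero)
  qed
  show "norm F = sqrt (F \<bullet> F)" by (simp add: norm_l2_def)
qed

end

lemma abs_l2_diff: "f \<in> L2 lborel \<Longrightarrow> g \<in> L2 lborel \<Longrightarrow> abs_l2 f - abs_l2 g = abs_l2 (\<lambda>x. f x - g x)"
  by (rule minus_l2.abs_eq) (simp_all)

lemma abs_l2_add: "f \<in> L2 lborel \<Longrightarrow> g \<in> L2 lborel \<Longrightarrow> abs_l2 f + abs_l2 g = abs_l2 (\<lambda>x. f x + g x)"
  by (rule plus_l2.abs_eq) (simp_all)

lemma abs_l2_scaleR: "f \<in> L2 lborel \<Longrightarrow> a *\<^sub>R abs_l2 f = abs_l2 (\<lambda>x. a *\<^sub>R f x)"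
  by (rule scaleR_l2.abs_eq) (simp_all)

lemma abs_l2_inner: "f \<in> L2 lborel \<Longrightarrow> g \<in> L2 lborel \<Longrightarrow> abs_l2 f \<bullet> abs_l2 g = (\<integral>x. f x \<bullet> g x \<partial>lborel)"
  by (rule inner_l2.abs_eq) (simp_all)

lemma norm_abs_l2: "f \<in> L2 lborel \<Longrightarrow> norm (abs_l2 f) = L2_norm lborel f"
  by (simp add: norm_eq_sqrt_inner abs_l2_inner L2_norm_def power2_norm_eq_inner)

instance l2 :: (euclidean_space) banach
proof
  fix X :: "nat \<Rightarrow> 'a l2" assume X: "Cauchy X"
  define f where "f n = rep_l2 (X n)" for n
  have f: "f n \<in> L2 lborel" and X_eq: "X n = abs_l2 (f n)" for n
    by (simp_all add: f_def rep_l2)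
  have norm_diff: "(norm (abs_l2 g - abs_l2 h))\<^sup>2 = (\<integral>x. (norm (g x - h x))\<^sup>2 \<partial>lborel)"
    if "g \<in> L2 lborel" "h \<in> L2 lborel" for g h :: "'a \<Rightarrow> complex"
    using that by (simp add: abs_l2_diff norm_abs_l2 L2_diff L2_norm_def)
  have "\<exists>g\<in>L2 lborel. (\<lambda>n. \<integral>x. (norm (f n x - g x))\<^sup>2 \<partial>lborel) \<longlonglongrightarrow> 0"
  proof (rule L2_Cauchy_limit[OF f])
    fix e :: real assume "e > 0"
    then obtain N where "\<forall>m\<ge>N. \<forall>n\<ge>N. norm (X m - X n) < sqrt e"
      using CauchyD[OF X, of "sqrt e"] by auto
    then have "\<forall>m\<ge>N. \<forall>n\<ge>N. (norm (X m - X n))\<^sup>2 < e"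
      using \<open>e > 0\<close> by (metis norm_ge_zero power_strict_mono pos2 real_sqrt_pow2 less_imp_le)
    then show "\<exists>N. \<forall>m\<ge>N. \<forall>n\<ge>N. (\<integral>x. (norm (f m x - f n x))\<^sup>2 \<partial>lborel) < e"
      unfolding X_eq norm_diff[OF f f] by blast
  qed
  then obtain g where g: "g \<in> L2 lborel" and lim: "(\<lambda>n. \<integral>x. (norm (f n x - g x))\<^sup>2 \<partial>lborel) \<longlonglongrightarrow> 0"
    by blast
  have "(\<lambda>n. (norm (X n - abs_l2 g))\<^sup>2) \<longlonglongrightarrow> 0"
    unfolding X_eq norm_diff[OF f g] by (rule lim)
  then have "(\<lambda>n. sqrt ((norm (X n - abs_l2 g))\<^sup>2)) \<longlonglongrightarrow> sqrt 0"
    by (rule tendsto_real_sqrt)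
  then have "X \<longlonglongrightarrow> abs_l2 g"
    by (simp add: tendsto_norm_zero_iff LIM_zero_iff)
  then show "convergent X" by (rule convergentI)
qed

section \<open>Smooth functions of compact support\<close>

lemma Ck_Suc_imp_Ck: "Ck (Suc k) f \<Longrightarrow> Ck k f"
proof (induction k arbitrary: f)
  case 0
  then show ?case
    by (auto simp: continuous_on_eq_continuous_at differentiable_imp_continuous_within)
qed auto

lemma Ck_imp_continuous: "Ck k f \<Longrightarrow> continuous_on UNIV f"
  by (induction k) (auto simp: continuous_on_eq_continuous_at differentiable_imp_continuous_within)

lemma partial_deriv_eq: "(f has_derivative D) (at x) \<Longrightarrow> partial_deriv b f x = D b"
  unfolding partial_deriv_def using frechet_derivative_at by metis

lemma partial_deriv_add:
  "f differentiable at x \<Longrightarrow> g differentiable at x \<Longrightarrow>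
    partial_deriv b (\<lambda>x. f x + g x) x = partial_deriv b f x + partial_deriv b g x"
  unfolding frechet_derivative_works
  by (subst partial_deriv_eq[OF has_derivative_add]) (auto simp: partial_deriv_def)

lemma partial_deriv_inner:
  "f differentiable at x \<Longrightarrow> g differentiable at x \<Longrightarrow>
    partial_deriv b (\<lambda>x. f x \<bullet> g x) x = f x \<bullet> partial_deriv b g x + partial_deriv b f x \<bullet> g x"
  unfolding frechet_derivative_works
  by (subst partial_deriv_eq[OF has_derivative_inner]) (auto simp: partial_deriv_def)

lemma partial_deriv_bounded_linear:
  assumes "bounded_linear L" "f differentiable at x"
  shows "partial_deriv b (\<lambda>x. L (f x)) x = L (partial_deriv b f x)"
  using assms(2) unfolding frechet_derivative_works
  by (subst partial_deriv_eq[OF bounded_linear.has_derivative[OF assms(1)]]) (auto simp: partial_deriv_def)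

lemma Ck_add: "Ck k f \<Longrightarrow> Ck k g \<Longrightarrow> Ck k (\<lambda>x. f x + g x)"
proof (induction k arbitrary: f g)
  case (Suc k)
  have "partial_deriv b (\<lambda>x. f x + g x) = (\<lambda>x. partial_deriv b f x + partial_deriv b g x)" for b
    using Suc.prems by (auto simp: partial_deriv_add)
  then show ?case using Suc by (auto intro: differentiable_add)
qed (auto intro: continuous_on_add)

lemma Ck_inner:
  fixes f g :: "'a::euclidean_space \<Rightarrow> 'b::real_inner"
  shows "Ck k f \<Longrightarrow> Ck k g \<Longrightarrow> Ck k (\<lambda>x. f x \<bullet> g x)"
proof (induction k arbitrary: f g)
  case (Suc k)
  have "partial_deriv b (\<lambda>x. f x \<bullet> g x) = (\<lambda>x. f x \<bullet> partial_deriv b g x + partial_deriv b f x \<bullet> g x)" for b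
    using Suc.prems by (auto simp: partial_deriv_inner)
  moreover have "Ck k f" "Ck k g" using Suc.prems Ck_Suc_imp_Ck by blast+
  moreover have "(\<lambda>x. f x \<bullet> g x) differentiable at x" for x
    using Suc.prems by (auto intro: differentiable_inner)
  ultimately show ?case using Suc by (auto intro!: Ck_add)
qed (auto intro: continuous_on_inner)

lemma Ck_bounded_linear:
  assumes L: "bounded_linear L"
  shows "Ck k f \<Longrightarrow> Ck k (\<lambda>x. L (f x))"
proof (induction k arbitrary: f)
  case 0
  then show ?case by (auto intro: bounded_linear.continuous_on[OF L])
next
  case (Suc k)
  have "partial_deriv b (\<lambda>x. L (f x)) = (\<lambda>x. L (partial_deriv b f x))" for b
    using Suc.prems by (auto simp: partial_deriv_bounded_linear[OF L])
  moreover have "(\<lambda>x. L (f x)) differentiable at x" for x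
    using Suc.prems bounded_linear.has_derivative[OF L] by (auto simp: differentiable_def) blast
  ultimately show ?case using Suc by auto
qed

lemma Cc_infinity_Ck: "f \<in> Cc_infinity \<Longrightarrow> Ck k f"
  by (simp add: Cc_infinity_def)

lemma Cc_infinity_differentiable: "f \<in> Cc_infinity \<Longrightarrow> f differentiable at x"
  using Cc_infinity_Ck[of f "Suc 0"] by simp

lemma Cc_infinity_continuous: "f \<in> Cc_infinity \<Longrightarrow> continuous_on UNIV f"
  using Cc_infinity_Ck Ck_imp_continuous by blast

lemma Cc_infinity_measurable: "f \<in> Cc_infinity \<Longrightarrow> f \<in> borel_measurable borel"
  using Cc_infinity_continuous borel_measurable_continuous_onI by blast

lemma Cc_infinityI:
  assumes "\<And>k. Ck k f" "compact K" "\<And>x. x \<notin> K \<Longrightarrow> f x = 0"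
  shows "f \<in> Cc_infinity"
proof -
  have "closure {x. f x \<noteq> 0} \<subseteq> K"
    using assms compact_imp_closed by (intro closure_minimal) auto
  then have "compact (closure {x. f x \<noteq> 0})"
    using compact_Int_closed[OF \<open>compact K\<close> closed_closure[of "{x. f x \<noteq> 0}"]]
    by (simp add: Int_absorb1)
  then show ?thesis using assms(1) by (simp add: Cc_infinity_def)
qed

lemma Cc_infinity_support:
  assumes "f \<in> Cc_infinity"
  shows "\<exists>K. compact K \<and> (\<forall>x. x \<notin> K \<longrightarrow> f x = 0)"
proof (intro exI conjI allI impI)
  show "compact (closure {x. f x \<noteq> 0})" using assms by (simp add: Cc_infinity_def)
  show "f x = 0" if "x \<notin> closure {x. f x \<noteq> 0}" for x
    using that closure_subset[of "{x. f x \<noteq> 0}"] by blast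
qed

lemma Cc_infinity_partial_deriv:
  assumes f: "f \<in> Cc_infinity" and b: "b \<in> Basis"
  shows "partial_deriv b f \<in> Cc_infinity"
proof -
  obtain K where K: "compact K" "\<And>x. x \<notin> K \<Longrightarrow> f x = 0" using Cc_infinity_support[OF f] by blast
  have "partial_deriv b f x = 0" if x: "x \<notin> K" for x
  proof -
    have "(f has_derivative (\<lambda>_. 0)) (at x)"
      by (rule has_derivative_transform_within_open[of "\<lambda>_. 0" _ _ _ "- K"])
        (use K x in \<open>auto intro: compact_imp_closed\<close>)
    then show ?thesis by (rule partial_deriv_eq)
  qed
  moreover have "Ck k (partial_deriv b f)" for k
    using Cc_infinity_Ck[OF f, of "Suc k"] b by simp
  ultimately show ?thesis using K(1) by (intro Cc_infinityI[of _ K])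
qed

lemma Cc_infinity_bounded:
  assumes f: "f \<in> Cc_infinity"
  obtains B where "B > 0" "\<And>x. norm (f x) \<le> B"
proof -
  obtain K where K: "compact K" "\<And>x. x \<notin> K \<Longrightarrow> f x = 0" using Cc_infinity_support[OF f] by blast
  have "compact (f ` K)"
    by (intro compact_continuous_image K continuous_on_subset[OF Cc_infinity_continuous[OF f]]) simp
  then obtain B where B: "B > 0" "\<forall>y\<in>f ` K. norm y \<le> B"
    using compact_imp_bounded bounded_pos by metis
  show thesis
  proof (rule that[OF B(1)])
    show "norm (f x) \<le> B" for x
    proof (cases "x \<in> K")
      case False
      then show ?thesis using B(1) K(2) by simp
    qed (use B(2) in simp)
  qed
qed

lemma Cc_infinity_bounded_linear:
  assumes "bounded_linear L" "f \<in> Cc_infinity"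
  shows "(\<lambda>x. L (f x)) \<in> Cc_infinity"
proof -
  obtain K where K: "compact K" "\<And>x. x \<notin> K \<Longrightarrow> f x = 0" using Cc_infinity_support[OF assms(2)] by blast
  show ?thesis
    by (rule Cc_infinityI[OF Ck_bounded_linear[OF assms(1) Cc_infinity_Ck[OF assms(2)]] K(1)])
      (simp add: K(2) linear_0[OF bounded_linear.linear[OF assms(1)]])
qed

lemma Cc_infinity_inner:
  fixes f g :: "'a::euclidean_space \<Rightarrow> 'b::real_inner"
  assumes "f \<in> Cc_infinity" "g \<in> Cc_infinity"
  shows "(\<lambda>x. f x \<bullet> g x) \<in> Cc_infinity"
proof -
  obtain K where K: "compact K" "\<And>x. x \<notin> K \<Longrightarrow> f x = 0" using Cc_infinity_support[OF assms(1)] by blast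
  show ?thesis
    by (rule Cc_infinityI[OF Ck_inner[OF Cc_infinity_Ck[OF assms(1)] Cc_infinity_Ck[OF assms(2)]] K(1)])
      (simp add: K(2))
qed

section \<open>Translations: increments of test functions and invariant functions\<close>

lemma nn_integral_lborel_shift:
  assumes "f \<in> borel_measurable borel"
  shows "(\<integral>\<^sup>+x. f (x + c) \<partial>lborel) = (\<integral>\<^sup>+x. f x \<partial>(lborel :: 'a::euclidean_space measure))"
proof -
  have "(\<integral>\<^sup>+x. f x \<partial>lborel) = (\<integral>\<^sup>+x. f x \<partial>distr lborel borel ((+) c))"
    by (simp add: lborel_distr_plus)
  also have "\<dots> = (\<integral>\<^sup>+x. f (c + x) \<partial>lborel)"
    using assms by (subst nn_integral_distr) auto
  finally show ?thesis by (simp add: add.commute)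
qed

text \<open>The fundamental theorem of calculus on the segment from \<open>x\<close> to
  \<open>x + h\<close>, the directional derivative being bounded through the partial ones. A
  nonnegative integral is used so that Tonelli's theorem applies when \<open>x\<close> is integrated
  next.\<close>

lemma norm_increment_le_nn_integral:
  fixes f :: "'a::euclidean_space \<Rightarrow> complex"
  assumes f: "f \<in> Cc_infinity"
  shows "ennreal (norm (f (x + h) - f x)) \<le>
    (\<integral>\<^sup>+s. indicator {0..1} s * ennreal (norm h * (\<Sum>b\<in>Basis. norm (partial_deriv b f (x + s *\<^sub>R h)))) \<partial>lborel)"
proof -
  define G where "G y = norm h * (\<Sum>b\<in>Basis. norm (partial_deriv b f y))" for y
  define \<phi>' where "\<phi>' s = frechet_derivative f (at (x + s *\<^sub>R h)) h" for s
  have cont_G: "continuous_on UNIV G"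
    unfolding G_def
    by (intro continuous_intros Cc_infinity_continuous Cc_infinity_partial_deriv f)
  have bound: "norm (\<phi>' s) \<le> G (x + s *\<^sub>R h)" for s
  proof -
    define D where "D = frechet_derivative f (at (x + s *\<^sub>R h))"
    have "(f has_derivative D) (at (x + s *\<^sub>R h))"
      using Cc_infinity_differentiable[OF f] by (simp add: D_def frechet_derivative_works)
    then have lin: "linear D" by (rule has_derivative_linear)
    have "D h = D (\<Sum>b\<in>Basis. (h \<bullet> b) *\<^sub>R b)" by (simp add: euclidean_representation)
    also have "\<dots> = (\<Sum>b\<in>Basis. (h \<bullet> b) *\<^sub>R D b)"
      by (simp add: linear_sum[OF lin] linear_cmul[OF lin])
    also have "norm \<dots> \<le> (\<Sum>b\<in>Basis. norm h * norm (D b))"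
      by (rule order_trans[OF norm_sum])
        (auto intro!: sum_mono mult_right_mono simp: Basis_le_norm)
    finally show ?thesis
      by (simp add: G_def \<phi>'_def D_def partial_deriv_def sum_distrib_left)
  qed
  have deriv: "((\<lambda>s. f (x + s *\<^sub>R h)) has_vector_derivative \<phi>' s) (at s within {0..1})" for s
  proof -
    have "(f has_derivative frechet_derivative f (at (x + s *\<^sub>R h))) (at (x + s *\<^sub>R h))"
      using Cc_infinity_differentiable[OF f] by (simp add: frechet_derivative_works)
    moreover have "((\<lambda>s. x + s *\<^sub>R h) has_vector_derivative h) (at s within {0..1})"
      by (auto intro!: derivative_eq_intros)
    ultimately show ?thesis
      unfolding \<phi>'_def
      using vector_derivative_diff_chain_within[of "\<lambda>s. x + s *\<^sub>R h" h s "{0..1}" f]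
      by (auto simp: o_def intro: has_derivative_at_withinI)
  qed
  have int: "(\<phi>' has_integral (f (x + 1 *\<^sub>R h) - f (x + 0 *\<^sub>R h))) {0..1}"
    by (rule fundamental_theorem_of_calculus) (auto intro: deriv)
  have int_G: "(\<lambda>s. G (x + s *\<^sub>R h)) integrable_on {0..1}"
    by (intro integrable_continuous_interval continuous_on_compose2[OF cont_G] continuous_intros) auto
  have "norm (f (x + h) - f x) \<le> integral {0..1} (\<lambda>s. G (x + s *\<^sub>R h))"
    using integral_norm_bound_integral[OF has_integral_integrable[OF int] int_G] bound
      integral_unique[OF int] by simp
  also have "ennreal (integral {0..1} (\<lambda>s. G (x + s *\<^sub>R h)))
      = (\<integral>\<^sup>+s. ennreal (if s \<in> {0..1} then G (x + s *\<^sub>R h) else 0) \<partial>lborel)"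
  proof (rule nn_integral_has_integral_lborel[symmetric])
    show "((\<lambda>s. if s \<in> {0..1} then G (x + s *\<^sub>R h) else 0) has_integral integral {0..1} (\<lambda>s. G (x + s *\<^sub>R h))) UNIV"
      using int_G by (simp only: has_integral_restrict_UNIV has_integral_integral)
    have "(\<lambda>s. G (x + s *\<^sub>R h)) \<in> borel_measurable borel"
      by (intro borel_measurable_continuous_onI continuous_on_compose2[OF cont_G] continuous_intros) auto
    then show "(\<lambda>s. if s \<in> {0..1} then G (x + s *\<^sub>R h) else 0) \<in> borel_measurable borel"
      by measurable
  qed (auto simp: G_def intro!: mult_nonneg_nonneg sum_nonneg)
  also have "\<dots> = (\<integral>\<^sup>+s. indicator {0..1} s * ennreal (G (x + s *\<^sub>R h)) \<partial>lborel)"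
    by (intro nn_integral_cong) auto
  finally show ?thesis by (simp add: G_def ennreal_leI)
qed

text \<open>Tonelli exchanges the segment parameter with \<open>x\<close>. For each \<open>s\<close>
  in \<open>{0..1}\<close> translation by \<open>s *\<^sub>R h\<close> maps the smaller ball into
  the larger one and preserves Lebesgue measure.\<close>

lemma nn_integral_increment_le:
  fixes f :: "'a::euclidean_space \<Rightarrow> complex"
  assumes f: "f \<in> Cc_infinity"
  shows "(\<integral>\<^sup>+x. indicator (cball 0 \<rho>) x * ennreal (norm (f (x + h) - f x)) \<partial>lborel) \<le>
    ennreal (norm h) * (\<Sum>b\<in>Basis. \<integral>\<^sup>+x. indicator (cball 0 (\<rho> + norm h)) x * ennreal (norm (partial_deriv b f x)) \<partial>lborel)"
proof -
  define G where "G y = norm h * (\<Sum>b\<in>Basis. norm (partial_deriv b f y))" for y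
  define B where "B = cball (0::'a) \<rho>"
  define B' where "B' = cball (0::'a) (\<rho> + norm h)"
  have [measurable]: "partial_deriv b f \<in> borel_measurable borel" if "b \<in> Basis" for b
    by (rule Cc_infinity_measurable[OF Cc_infinity_partial_deriv[OF f that]])
  have G_measurable [measurable]: "G \<in> borel_measurable borel"
    unfolding G_def[abs_def] by measurable
  have [measurable]: "B \<in> sets borel" "B' \<in> sets borel" by (auto simp: B_def B'_def)
  have "(\<integral>\<^sup>+x. indicator B x * ennreal (norm (f (x + h) - f x)) \<partial>lborel) \<le>
      (\<integral>\<^sup>+x. (\<integral>\<^sup>+s. indicator B x * (indicator {0..1} s * ennreal (G (x + s *\<^sub>R h))) \<partial>lborel) \<partial>lborel)"
    unfolding G_def using norm_increment_le_nn_integral[OF f, of _ h]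
    by (intro nn_integral_mono) (auto simp: indicator_def)
  also have "\<dots> = (\<integral>\<^sup>+s. (\<integral>\<^sup>+x. indicator B x * (indicator {0..1} s * ennreal (G (x + s *\<^sub>R h))) \<partial>lborel) \<partial>(lborel :: real measure))"
    by (rule lborel_pair.Fubini') (measurable)
  also have "\<dots> \<le> (\<integral>\<^sup>+s. indicator {0..1} s * (\<integral>\<^sup>+x. indicator B' x * ennreal (G x) \<partial>lborel) \<partial>(lborel :: real measure))"
  proof (intro nn_integral_mono)
    fix s :: real
    show "(\<integral>\<^sup>+x. indicator B x * (indicator {0..1} s * ennreal (G (x + s *\<^sub>R h))) \<partial>lborel)
        \<le> indicator {0..1} s * (\<integral>\<^sup>+x. indicator B' x * ennreal (G x) \<partial>lborel)"
    proof (cases "s \<in> {0..1}")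
      case True
      have "x + s *\<^sub>R h \<in> B'" if "x \<in> B" for x
      proof -
        have "norm (x + s *\<^sub>R h) \<le> norm x + \<bar>s\<bar> * norm h" by (rule order_trans[OF norm_triangle_ineq]) simp
        also have "\<dots> \<le> norm x + 1 * norm h" using True by (intro add_left_mono mult_right_mono) auto
        finally show ?thesis using that by (simp add: B_def B'_def)
      qed
      then have "(\<integral>\<^sup>+x. indicator B x * ennreal (G (x + s *\<^sub>R h)) \<partial>lborel)
          \<le> (\<integral>\<^sup>+x. indicator B' (x + s *\<^sub>R h) * ennreal (G (x + s *\<^sub>R h)) \<partial>lborel)"
        by (intro nn_integral_mono) (auto simp: indicator_def)
      also have "\<dots> = (\<integral>\<^sup>+x. indicator B' x * ennreal (G x) \<partial>lborel)"
        by (rule nn_integral_lborel_shift[of "\<lambda>x. indicator B' x * ennreal (G x)"]) measurable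
      finally show ?thesis using True by simp
    qed simp
  qed
  also have "\<dots> = (\<integral>\<^sup>+x. indicator B' x * ennreal (G x) \<partial>lborel)"
    by (subst nn_integral_multc) auto
  also have "\<dots> = (\<integral>\<^sup>+x. ennreal (norm h) * (\<Sum>b\<in>Basis. indicator B' x * ennreal (norm (partial_deriv b f x))) \<partial>lborel)"
    by (intro nn_integral_cong)
      (auto simp: G_def ennreal_mult sum_nonneg sum_distrib_left indicator_def simp flip: sum_ennreal)
  also have "\<dots> = ennreal (norm h) * (\<Sum>b\<in>Basis. \<integral>\<^sup>+x. indicator B' x * ennreal (norm (partial_deriv b f x)) \<partial>lborel)"
    by (subst nn_integral_cmult; (subst nn_integral_sum)?) auto
  finally show ?thesis by (simp add: B_def B'_def)
qed

text \<open>Exchanging the two almost-everywhere quantifiers yields a single \<open>x\<close> with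
  \<open>u (x + h) = u x\<close> for almost all \<open>h\<close>, and then \<open>x + h\<close> runs
  over almost every point.\<close>

lemma AE_const_if_shift_invariant:
  fixes u :: "'a::euclidean_space \<Rightarrow> 'b::{second_countable_topology, t2_space}"
  assumes [measurable]: "u \<in> borel_measurable borel"
    and shift: "\<And>h. AE x in lborel. u (x + h) = u x"
  shows "\<exists>c. AE x in lborel. u x = c"
proof -
  have meas: "{p \<in> space (lborel \<Otimes>\<^sub>M lborel). u (snd p + fst p) = u (snd p)} \<in> sets (lborel \<Otimes>\<^sub>M (lborel :: 'a measure))"
    by measurable
  have "AE h in (lborel :: 'a measure). AE x in (lborel :: 'a measure). u (x + h) = u x"
    using shift by simp
  then have "AE x in (lborel :: 'a measure). AE h in (lborel :: 'a measure). u (x + h) = u x"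
    using lborel_pair.AE_commute[OF meas] by simp
  moreover have "\<not> (AE x in (lborel :: 'a measure). False)"
    by (simp add: AE_iff_null null_sets_def)
  ultimately obtain x where "AE h in (lborel :: 'a measure). u (x + h) = u x"
    by (metis (mono_tags, lifting) eventually_mono)
  then have "AE y in distr lborel borel ((+) x). u y = u x"
    by (subst AE_distr_iff) measurable
  then show ?thesis unfolding lborel_distr_plus by blast
qed

section \<open>The weighted space\<close>

locale weight =
  fixes \<mu> :: "'a::euclidean_space \<Rightarrow> real"
  assumes weight_measurable [measurable]: "\<mu> \<in> borel_measurable borel"
    and weight_pos: "AE x in lborel. 0 < \<mu> x"
begin

abbreviation M :: "'a measure" where "M \<equiv> density_measure \<mu>"

text \<open>\<open>toH\<close> realises the isometry \<open>f \<mapsto> \<surd>\<mu> f\<close> of \<open>L\<^sup>2(\<mu> dx)\<close> onto \<open>L\<^sup>2(dx)\<close>, and \<open>ofH\<close> its inverse.\<close>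

definition toH :: "('a \<Rightarrow> complex) \<Rightarrow> 'a l2" where
  "toH f = abs_l2 (\<lambda>x. sqrt (\<mu> x) *\<^sub>R f x)"

definition ofH :: "'a l2 \<Rightarrow> 'a \<Rightarrow> complex" where
  "ofH F x = rep_l2 F x /\<^sub>R sqrt (\<mu> x)"

text \<open>\<open>T\<close> acts on functions, so a representative is chosen; for a
  \<open>bounded_opr\<close> the class of the result does not depend on it.\<close>

definition lift :: "'a opr \<Rightarrow> 'a l2 \<Rightarrow> 'a l2" where
  "lift T F = toH (T (ofH F))"

lemma measurable_M: "borel_measurable M = borel_measurable borel"
  by (rule measurable_cong_sets) auto

text \<open>Since \<open>\<mu>\<close> is positive almost everywhere, both measures have the same
  null sets.\<close>

lemma AE_M: "(AE x in M. P x) \<longleftrightarrow> (AE x in lborel. P x)"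
proof -
  have "(AE x in M. P x) \<longleftrightarrow> (AE x in lborel. 0 < ennreal (\<mu> x) \<longrightarrow> P x)"
    by (rule AE_density) measurable
  also have "\<dots> \<longleftrightarrow> (AE x in lborel. P x)"
    using weight_pos by (auto elim: AE_mp)
  finally show ?thesis .
qed

lemma weight_nonneg: "AE x in lborel. 0 \<le> \<mu> x"
  using weight_pos by eventually_elim simp

lemma integrable_M:
  fixes f :: "'a \<Rightarrow> 'b::{banach, second_countable_topology}"
  shows "f \<in> borel_measurable borel \<Longrightarrow> integrable M f \<longleftrightarrow> integrable lborel (\<lambda>x. \<mu> x *\<^sub>R f x)"
  by (rule integrable_density) (use weight_nonneg in auto)

lemma integral_M:
  fixes f :: "'a \<Rightarrow> 'b::{banach, second_countable_topology}"
  shows "f \<in> borel_measurable borel \<Longrightarrow> (\<integral>x. f x \<partial>M) = (\<integral>x. \<mu> x *\<^sub>R f x \<partial>lborel)"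
  by (rule integral_density) (use weight_nonneg in auto)

lemma L2_M_measurable: "f \<in> L2 M \<Longrightarrow> f \<in> borel_measurable borel"
  using L2_measurable measurable_M by blast

lemma L2_sqrt:
  assumes "f \<in> L2 M"
  shows "(\<lambda>x. sqrt (\<mu> x) *\<^sub>R f x) \<in> L2 lborel"
proof -
  have [measurable]: "f \<in> borel_measurable borel" by (rule L2_M_measurable[OF assms])
  have "integrable lborel (\<lambda>x. \<mu> x *\<^sub>R (norm (f x))\<^sup>2)"
    using L2_integrable[OF assms] by (subst integrable_M[symmetric]) auto
  moreover have "AE x in lborel. \<mu> x *\<^sub>R (norm (f x))\<^sup>2 = (norm (sqrt (\<mu> x) *\<^sub>R f x))\<^sup>2"
    using weight_nonneg by eventually_elim (simp add: power_mult_distrib)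
  ultimately have "integrable lborel (\<lambda>x. (norm (sqrt (\<mu> x) *\<^sub>R f x))\<^sup>2)"
    by (subst (asm) integrable_cong_AE) auto
  then show ?thesis by (simp add: L2_def)
qed

lemma ofH_L2: "ofH F \<in> L2 M"
proof -
  have [measurable]: "rep_l2 F \<in> borel_measurable borel"
    using L2_measurable[OF rep_l2[of F]] by simp
  have [measurable]: "ofH F \<in> borel_measurable borel"
    unfolding ofH_def[abs_def] by measurable
  have "AE x in lborel. (norm (rep_l2 F x))\<^sup>2 = \<mu> x *\<^sub>R (norm (ofH F x))\<^sup>2"
    using weight_pos by eventually_elim (simp add: ofH_def power_mult_distrib power_inverse)
  then have "integrable lborel (\<lambda>x. \<mu> x *\<^sub>R (norm (ofH F x))\<^sup>2)"
    using L2_integrable[OF rep_l2[of F]] by (subst (asm) integrable_cong_AE) auto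
  then show ?thesis by (simp add: L2_def integrable_M measurable_M)
qed

lemma toH_eq_iff: "f \<in> L2 M \<Longrightarrow> g \<in> L2 M \<Longrightarrow> toH f = toH g \<longleftrightarrow> (AE x in M. f x = g x)"
  unfolding toH_def AE_M
  using weight_pos by (subst abs_l2_eq_iff) (auto intro: L2_sqrt elim: AE_mp)

lemma toH_ofH [simp]: "toH (ofH F) = F"
proof -
  have "toH (ofH F) = abs_l2 (rep_l2 F)"
    unfolding toH_def
    by (subst abs_l2_eq_iff[OF L2_sqrt[OF ofH_L2] rep_l2])
      (use weight_pos in \<open>eventually_elim; simp add: ofH_def\<close>)
  then show ?thesis by simp
qed

lemma ofH_toH: "f \<in> L2 M \<Longrightarrow> AE x in M. ofH (toH f) x = f x"
  using toH_eq_iff[OF ofH_L2, of f "toH f"] by simp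

lemma toH_add: "f \<in> L2 M \<Longrightarrow> g \<in> L2 M \<Longrightarrow> toH (\<lambda>x. f x + g x) = toH f + toH g"
  by (simp add: toH_def abs_l2_add L2_sqrt scaleR_add_right)

lemma toH_diff: "f \<in> L2 M \<Longrightarrow> g \<in> L2 M \<Longrightarrow> toH (\<lambda>x. f x - g x) = toH f - toH g"
  by (simp add: toH_def abs_l2_diff L2_sqrt scaleR_diff_right)

lemma toH_scaleR: "f \<in> L2 M \<Longrightarrow> toH (\<lambda>x. complex_of_real a * f x) = a *\<^sub>R toH f"
  unfolding toH_def abs_l2_scaleR[OF L2_sqrt] by (simp add: scaleR_conv_of_real mult_ac)

lemma toH_uminus: "f \<in> L2 M \<Longrightarrow> toH (\<lambda>x. - f x) = - toH f"
  using toH_scaleR[of f "-1"] by simp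

lemma toH_zero: "toH (\<lambda>x. 0) = 0"
  using toH_scaleR[OF L2_zero, of 0] by simp

lemma toH_inner:
  assumes "f \<in> L2 M" "g \<in> L2 M"
  shows "toH f \<bullet> toH g = (\<integral>x. f x \<bullet> g x \<partial>M)"
proof -
  have [measurable]: "f \<in> borel_measurable borel" "g \<in> borel_measurable borel"
    using L2_M_measurable assms by auto
  have "toH f \<bullet> toH g = (\<integral>x. (sqrt (\<mu> x) *\<^sub>R f x) \<bullet> (sqrt (\<mu> x) *\<^sub>R g x) \<partial>lborel)"
    unfolding toH_def by (intro abs_l2_inner L2_sqrt assms)
  also have "\<dots> = (\<integral>x. \<mu> x *\<^sub>R (f x \<bullet> g x) \<partial>lborel)"
    by (intro integral_cong_AE) (use weight_nonneg in \<open>auto elim!: AE_mp simp: algebra_simps\<close>)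
  finally show ?thesis by (simp add: integral_M)
qed

lemma norm_toH: "f \<in> L2 M \<Longrightarrow> norm (toH f) = L2_norm M f"
  by (simp add: norm_eq_sqrt_inner toH_inner L2_norm_def power2_norm_eq_inner)

lemma norm_toH_diff: "f \<in> L2 M \<Longrightarrow> g \<in> L2 M \<Longrightarrow> norm (toH f - toH g) = L2_norm M (\<lambda>x. f x - g x)"
  by (simp add: toH_diff[symmetric] norm_toH L2_diff)

lemma L2_norm_ofH: "L2_norm M (ofH F) = norm F"
  using norm_toH[OF ofH_L2, of F] by simp

lemma toH_tendsto_iff:
  assumes "\<And>n. f n \<in> L2 M" "u \<in> L2 M"
  shows "((\<lambda>n. L2_norm M (\<lambda>x. f n x - u x)) \<longlongrightarrow> 0) F \<longleftrightarrow> ((\<lambda>n. toH (f n)) \<longlongrightarrow> toH u) F"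
  by (subst LIM_zero_iff[symmetric], subst tendsto_norm_zero_iff[symmetric])
    (simp add: norm_toH_diff assms)

section \<open>Bounded operators transported to the Hilbert space\<close>

lemma bounded_opr_L2: "bounded_opr M T \<Longrightarrow> f \<in> L2 M \<Longrightarrow> T f \<in> L2 M"
  by (simp add: bounded_opr_def)

lemma bounded_opr_AE_add:
  "bounded_opr M T \<Longrightarrow> f \<in> L2 M \<Longrightarrow> h \<in> L2 M \<Longrightarrow>
    AE x in M. T (\<lambda>y. f y + h y) x = T f x + T h x"
  by (simp add: bounded_opr_def)

lemma bounded_opr_AE_mult:
  "bounded_opr M T \<Longrightarrow> f \<in> L2 M \<Longrightarrow> AE x in M. T (\<lambda>y. c * f y) x = c * T f x"
  by (simp add: bounded_opr_def)

text \<open>The difference of two representatives has norm 0, so the norm bound sends it to a null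
  function; linearity up to null sets turns this into equality of the images.\<close>

lemma bounded_opr_cong:
  assumes T: "bounded_opr M T" and f: "f \<in> L2 M" and g: "g \<in> L2 M" and eq: "AE x in M. f x = g x"
  shows "toH (T f) = toH (T g)"
proof -
  have g': "(\<lambda>x. -1 * g x) \<in> L2 M" by (rule L2_mult[OF g])
  define d where "d x = f x + -1 * g x" for x
  have d: "d \<in> L2 M" unfolding d_def[abs_def] by (rule L2_add[OF f g'])
  have "toH d = 0"
    using toH_eq_iff[OF d L2_zero] eq toH_zero by (simp add: d_def)
  then have "L2_norm M d = 0" using norm_toH[OF d] by simp
  moreover obtain C where "L2_norm M (T d) \<le> C * L2_norm M d"
    using T d by (auto simp: bounded_opr_def)
  ultimately have "toH (T d) = 0"
    using norm_toH[OF bounded_opr_L2[OF T d]] L2_norm_nonneg[of M "T d"] by simp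
  moreover have "AE x in M. T d x = T f x + T (\<lambda>x. -1 * g x) x"
    unfolding d_def[abs_def] by (rule bounded_opr_AE_add[OF T f g'])
  moreover have "AE x in M. T (\<lambda>x. -1 * g x) x = -1 * T g x"
    by (rule bounded_opr_AE_mult[OF T g])
  ultimately have "AE x in M. T d x = T f x - T g x" by (auto elim: AE_mp)
  then have "toH (T d) = toH (T f) - toH (T g)"
    using bounded_opr_L2[OF T] f g d
    by (subst toH_diff[symmetric]) (auto simp: toH_eq_iff L2_diff)
  with \<open>toH (T d) = 0\<close> show ?thesis by simp
qed

lemma lift_toH: "bounded_opr M T \<Longrightarrow> f \<in> L2 M \<Longrightarrow> lift T (toH f) = toH (T f)"
  unfolding lift_def by (rule bounded_opr_cong) (auto intro: ofH_L2 ofH_toH)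

lemma bounded_linear_lift:
  assumes T: "bounded_opr M T"
  shows "bounded_linear (lift T)"
proof -
  obtain C where C: "\<And>f. f \<in> L2 M \<Longrightarrow> L2_norm M (T f) \<le> C * L2_norm M f"
    using T unfolding bounded_opr_def by blast
  show ?thesis
  proof (rule bounded_linear_intro[of _ C])
    fix F G :: "'a l2"
    have "lift T (F + G) = lift T (toH (\<lambda>x. ofH F x + ofH G x))"
      by (simp add: toH_add ofH_L2)
    also have "\<dots> = toH (T (\<lambda>x. ofH F x + ofH G x))"
      by (intro lift_toH T L2_add ofH_L2)
    also have "\<dots> = toH (\<lambda>x. T (ofH F) x + T (ofH G) x)"
      using T ofH_L2[of F] ofH_L2[of G]
      by (subst toH_eq_iff[OF bounded_opr_L2[OF T] L2_add[OF bounded_opr_L2[OF T] bounded_opr_L2[OF T]]])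
        (auto intro: L2_add simp: bounded_opr_def)
    also have "\<dots> = lift T F + lift T G"
      by (simp add: lift_def toH_add bounded_opr_L2[OF T] ofH_L2)
    finally show "lift T (F + G) = lift T F + lift T G" .
  next
    fix F :: "'a l2" and a :: real
    have "lift T (a *\<^sub>R F) = lift T (toH (\<lambda>x. complex_of_real a * ofH F x))"
      by (simp add: toH_scaleR ofH_L2)
    also have "\<dots> = toH (T (\<lambda>x. complex_of_real a * ofH F x))"
      by (intro lift_toH T L2_mult ofH_L2)
    also have "\<dots> = toH (\<lambda>x. complex_of_real a * T (ofH F) x)"
      using T ofH_L2[of F]
      by (subst toH_eq_iff[OF bounded_opr_L2[OF T] L2_mult[OF bounded_opr_L2[OF T]]])
        (auto intro: L2_mult simp: bounded_opr_def)
    also have "\<dots> = a *\<^sub>R lift T F"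
      by (simp add: lift_def toH_scaleR bounded_opr_L2[OF T] ofH_L2)
    finally show "lift T (a *\<^sub>R F) = a *\<^sub>R lift T F" .
  next
    fix F :: "'a l2"
    show "norm (lift T F) \<le> norm F * C"
      using C[OF ofH_L2[of F]] by (simp add: lift_def norm_toH bounded_opr_L2[OF T] ofH_L2 L2_norm_ofH mult.commute)
  qed
qed

lemma bounded_oprI:
  assumes "\<And>f. f \<in> L2 M \<Longrightarrow> T f \<in> L2 M"
    and "\<And>f g. f \<in> L2 M \<Longrightarrow> g \<in> L2 M \<Longrightarrow> AE x in M. T (\<lambda>y. f y + g y) x = T f x + T g x"
    and "\<And>c f. f \<in> L2 M \<Longrightarrow> AE x in M. T (\<lambda>y. c * f y) x = c * T f x"
    and "bounded_linear B" "\<And>f. f \<in> L2 M \<Longrightarrow> toH (T f) = B (toH f)"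
  shows "bounded_opr M T"
proof -
  obtain C where C: "\<And>F. norm (B F) \<le> norm F * C"
    using bounded_linear.bounded[OF assms(4)] by blast
  have "L2_norm M (T f) \<le> C * L2_norm M f" if "f \<in> L2 M" for f
    using C[of "toH f"] that assms(1,5) by (simp add: norm_toH[symmetric] mult.commute)
  then show ?thesis using assms(1-3) unfolding bounded_opr_def by blast
qed

lemma bounded_opr_zero: "bounded_opr M (\<lambda>f x. 0)"
  by (rule bounded_oprI[of _ "\<lambda>_. 0"]) (auto simp: toH_zero L2_zero)

lemma bounded_opr_add:
  assumes S: "bounded_opr M S" and T: "bounded_opr M T"
  shows "bounded_opr M (\<lambda>f x. S f x + T f x)"
proof (rule bounded_oprI)
  show "(\<lambda>x. S f x + T f x) \<in> L2 M" if "f \<in> L2 M" for f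
    by (rule L2_add[OF bounded_opr_L2[OF S that] bounded_opr_L2[OF T that]])
  show "bounded_linear (\<lambda>F. lift S F + lift T F)"
    by (intro bounded_linear_add bounded_linear_lift S T)
  show "toH (\<lambda>x. S f x + T f x) = lift S (toH f) + lift T (toH f)" if "f \<in> L2 M" for f
    using that S T by (simp add: toH_add bounded_opr_L2 lift_toH)
  fix f g assume fg: "f \<in> L2 M" "g \<in> L2 M"
  from bounded_opr_AE_add[OF S fg] bounded_opr_AE_add[OF T fg]
  show "AE x in M. S (\<lambda>y. f y + g y) x + T (\<lambda>y. f y + g y) x = S f x + T f x + (S g x + T g x)"
    by eventually_elim simp
next
  fix c f assume f: "f \<in> L2 M"
  from bounded_opr_AE_mult[OF S f, of c] bounded_opr_AE_mult[OF T f, of c]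
  show "AE x in M. S (\<lambda>y. c * f y) x + T (\<lambda>y. c * f y) x = c * (S f x + T f x)"
    by eventually_elim (simp add: distrib_left)
qed

lemma bounded_opr_cmult:
  assumes T: "bounded_opr M T"
  shows "bounded_opr M (\<lambda>f x. complex_of_real a * T f x)"
proof (rule bounded_oprI)
  show "(\<lambda>x. complex_of_real a * T f x) \<in> L2 M" if "f \<in> L2 M" for f
    by (rule L2_mult[OF bounded_opr_L2[OF T that]])
  show "bounded_linear (\<lambda>F. a *\<^sub>R lift T F)"
    by (intro bounded_linear_const_scaleR bounded_linear_lift T)
  show "toH (\<lambda>x. complex_of_real a * T f x) = a *\<^sub>R lift T (toH f)" if "f \<in> L2 M" for f
    using that T by (simp add: toH_scaleR bounded_opr_L2 lift_toH)
  fix f g assume fg: "f \<in> L2 M" "g \<in> L2 M"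
  from bounded_opr_AE_add[OF T fg]
  show "AE x in M. complex_of_real a * T (\<lambda>y. f y + g y) x =
      complex_of_real a * T f x + complex_of_real a * T g x"
    by eventually_elim (simp add: distrib_left)
next
  fix c f assume f: "f \<in> L2 M"
  from bounded_opr_AE_mult[OF T f, of c]
  show "AE x in M. complex_of_real a * T (\<lambda>y. c * f y) x = c * (complex_of_real a * T f x)"
    by eventually_elim simp
qed

lemma bounded_opr_sum:
  "(\<And>k. bounded_opr M (S k)) \<Longrightarrow> bounded_opr M (\<lambda>f x. \<Sum>k<n::nat. S k f x)"
  by (induction n) (auto intro: bounded_opr_zero bounded_opr_add)

text \<open>The supremum is taken in the reals, so the set has to be shown bounded above; the bound
  of the lifted operator does this.\<close>

lemma norm_lift_le_opr_norm:
  assumes T: "bounded_opr M T"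
  shows "norm (lift T F) \<le> opr_norm M T * norm F"
proof -
  obtain C where C: "\<And>F. norm (lift T F) \<le> norm F * C" "C > 0"
    using bounded_linear.pos_bounded[OF bounded_linear_lift[OF T]] by blast
  have le: "norm (lift T G) \<le> opr_norm M T" if "norm G \<le> 1" for G
  proof -
    have "L2_norm M (T (ofH G)) \<le> opr_norm M T"
      unfolding opr_norm_def
    proof (rule cSUP_upper)
      show "ofH G \<in> {f \<in> L2 M. L2_norm M f \<le> 1}"
        using that by (simp add: ofH_L2 L2_norm_ofH)
      show "bdd_above ((\<lambda>f. L2_norm M (T f)) ` {f \<in> L2 M. L2_norm M f \<le> 1})"
      proof (rule bdd_aboveI2)
        fix f assume f: "f \<in> {f \<in> L2 M. L2_norm M f \<le> 1}"
        have "L2_norm M (T f) = norm (lift T (toH f))"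
          using f T by (simp add: lift_toH norm_toH bounded_opr_L2)
        also have "\<dots> \<le> norm (toH f) * C" by (rule C)
        also have "\<dots> \<le> 1 * C" using f C(2) by (intro mult_right_mono) (auto simp: norm_toH)
        finally show "L2_norm M (T f) \<le> 1 * C" .
      qed
    qed
    then show ?thesis by (simp add: lift_def norm_toH bounded_opr_L2[OF T] ofH_L2)
  qed
  show ?thesis
  proof (cases "F = 0")
    case True
    then show ?thesis
      using linear_0[OF bounded_linear.linear[OF bounded_linear_lift[OF T]]] by simp
  next
    case False
    then have "norm (lift T (F /\<^sub>R norm F)) \<le> opr_norm M T" by (intro le) simp
    then have "norm (lift T F) / norm F \<le> opr_norm M T"
      using linear_cmul[OF bounded_linear.linear[OF bounded_linear_lift[OF T]]]
      by (simp add: divide_inverse mult.commute)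
    then show ?thesis using False by (simp add: divide_le_eq)
  qed
qed

end

section \<open>The operator \<open>L\<close> on test functions, its energy and its kernel\<close>

locale elliptic_weight = weight +
  fixes g :: "'a \<Rightarrow> 'a"
  assumes weight_integrable: "integrable lborel \<mu>"
    and prob: "prob_space M"
    and H1: "H1_loc_gradient \<mu> g"
    and bounded_below: "compact K \<Longrightarrow> \<exists>\<delta>>0. AE x in lborel. x \<in> K \<longrightarrow> \<delta> \<le> \<mu> x"
begin

lemma finite_M: "finite_measure M"
  using prob by (rule prob_space.finite_measure)

lemma g_measurable [measurable]: "g \<in> borel_measurable borel"
  using H1 by (simp add: H1_loc_gradient_def Lp_loc_def)

lemma Cc_infinity_L2:
  fixes f :: "'a \<Rightarrow> complex"
  assumes "f \<in> Cc_infinity"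
  shows "f \<in> L2 M"
proof -
  obtain B where "\<And>x. norm (f x) \<le> B" using Cc_infinity_bounded[OF assms] by blast
  then show ?thesis
    using Cc_infinity_measurable[OF assms] by (intro L2_bounded[OF finite_M]) (auto simp: measurable_M)
qed

lemma L2_sum: "(\<And>i. i \<in> I \<Longrightarrow> f i \<in> L2 M) \<Longrightarrow> (\<lambda>x. \<Sum>i\<in>I. f i x) \<in> L2 M"
  by (induction I rule: infinite_finite_induct) (auto intro: L2_zero L2_add)

text \<open>The first-order term is the delicate one. Its weighted square is at most
  \<open>|grad \<mu>|^2 / \<mu>\<close> times a bounded factor; on the support \<open>\<mu>\<close>
  is bounded below by \<open>\<delta>\<close>, and the gradient is locally square
  integrable.\<close>

lemma L_expr_L2:
  fixes f :: "'a \<Rightarrow> complex"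
  assumes f: "f \<in> Cc_infinity"
  shows "L_expr \<mu> g f \<in> L2 M"
proof -
  have "(\<lambda>x. complex_of_real ((g x /\<^sub>R \<mu> x) \<bullet> b) * partial_deriv b f x) \<in> L2 M"
    if b: "b \<in> Basis" for b
  proof -
    define h where "h = partial_deriv b f"
    have h: "h \<in> Cc_infinity" unfolding h_def by (rule Cc_infinity_partial_deriv[OF f b])
    have [measurable]: "h \<in> borel_measurable borel" by (rule Cc_infinity_measurable[OF h])
    obtain K where K: "compact K" "\<And>x. x \<notin> K \<Longrightarrow> h x = 0" using Cc_infinity_support[OF h] by blast
    obtain B where B: "B > 0" "\<And>x. norm (h x) \<le> B" using Cc_infinity_bounded[OF h] by blast
    obtain \<delta> where \<delta>: "\<delta> > 0" "AE x in lborel. x \<in> K \<longrightarrow> \<delta> \<le> \<mu> x" using bounded_below[OF K(1)] by blast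
    have "integrable lborel (\<lambda>x. \<mu> x *\<^sub>R (norm (complex_of_real ((g x /\<^sub>R \<mu> x) \<bullet> b) * h x))\<^sup>2)"
    proof (rule Bochner_Integration.integrable_bound)
      have "set_integrable lborel K (\<lambda>x. norm (g x) powr 2)"
        using H1 K(1) by (simp add: H1_loc_gradient_def Lp_loc_def)
      then show "integrable lborel (\<lambda>x. (B\<^sup>2 / \<delta>) * (indicator K x *\<^sub>R (norm (g x) powr 2)))"
        unfolding set_integrable_def by (intro integrable_mult_right)
      show "AE x in lborel. norm (\<mu> x *\<^sub>R (norm (complex_of_real ((g x /\<^sub>R \<mu> x) \<bullet> b) * h x))\<^sup>2)
          \<le> norm ((B\<^sup>2 / \<delta>) * (indicator K x *\<^sub>R (norm (g x) powr 2)))"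
        using \<delta>(2) weight_pos
      proof eventually_elim
        fix x assume x: "x \<in> K \<longrightarrow> \<delta> \<le> \<mu> x" "0 < \<mu> x"
        show "norm (\<mu> x *\<^sub>R (norm (complex_of_real ((g x /\<^sub>R \<mu> x) \<bullet> b) * h x))\<^sup>2)
          \<le> norm ((B\<^sup>2 / \<delta>) * (indicator K x *\<^sub>R (norm (g x) powr 2)))"
        proof (cases "x \<in> K")
          case True
          have gb: "(g x \<bullet> b)\<^sup>2 \<le> (norm (g x))\<^sup>2"
            using Basis_le_norm[OF b, of "g x"] by (simp add: abs_le_square_iff[symmetric])
          have hB: "(norm (h x))\<^sup>2 \<le> B\<^sup>2" using B by (intro power_mono) auto
          have "norm (complex_of_real ((g x /\<^sub>R \<mu> x) \<bullet> b) * h x) = \<bar>g x \<bullet> b\<bar> / \<mu> x * norm (h x)"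
            using x unfolding norm_mult norm_of_real by (simp add: abs_mult divide_inverse mult.commute)
          then have "\<mu> x * (norm (complex_of_real ((g x /\<^sub>R \<mu> x) \<bullet> b) * h x))\<^sup>2
              = (g x \<bullet> b)\<^sup>2 * (norm (h x))\<^sup>2 / \<mu> x"
            using x by (simp add: power_mult_distrib power_divide power2_eq_square[of "\<mu> x"])
          also have "\<dots> \<le> (norm (g x))\<^sup>2 * B\<^sup>2 / \<delta>"
            using x True \<delta>(1) gb hB by (intro frac_le mult_mono) auto
          finally show ?thesis using True x \<delta>(1) by (simp add: mult.commute powr_numeral)
        qed (use K in simp)
      qed
    qed measurable
    then show ?thesis
      unfolding h_def[symmetric] by (simp add: L2_def measurable_M integrable_M)
  qed
  then have "(\<lambda>x. \<Sum>b\<in>Basis. complex_of_real ((g x /\<^sub>R \<mu> x) \<bullet> b) * partial_deriv b f x) \<in> L2 M"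
    by (rule L2_sum)
  moreover have "(\<lambda>x. \<Sum>b\<in>Basis. partial_deriv b (partial_deriv b f) x) \<in> L2 M"
    by (intro L2_sum Cc_infinity_L2 Cc_infinity_partial_deriv f)
  ultimately show ?thesis
    unfolding L_expr_def[abs_def] by (intro L2_add)
qed

text \<open>The weak gradient of \<open>\<mu>\<close> is tested with \<open>Re (f \<partial>\<^sub>b f\<^sup>*)\<close>.\<close>

lemma energy_identity:
  assumes f: "f \<in> Cc_infinity"
  shows "toH (L_expr \<mu> g f) \<bullet> toH f = - (\<Sum>b\<in>Basis. (L2_norm M (partial_deriv b f))\<^sup>2)"
proof -
  define D where "D b = partial_deriv b f" for b
  define \<phi> where "\<phi> b x = f x \<bullet> D b x" for b x
  have D: "D b \<in> Cc_infinity" if "b \<in> Basis" for b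
    unfolding D_def by (rule Cc_infinity_partial_deriv[OF f that])
  have \<phi>: "\<phi> b \<in> Cc_infinity" if "b \<in> Basis" for b
    unfolding \<phi>_def[abs_def] by (rule Cc_infinity_inner[OF f D[OF that]])
  have pd_\<phi>: "partial_deriv b (\<phi> b) x = f x \<bullet> partial_deriv b (D b) x + (norm (D b x))\<^sup>2"
    if "b \<in> Basis" for b x
    unfolding \<phi>_def[abs_def]
    using partial_deriv_inner[OF Cc_infinity_differentiable[OF f] Cc_infinity_differentiable[OF D[OF that]], of b x]
    by (simp add: D_def power2_norm_eq_inner)
  have [measurable]: "f \<in> borel_measurable borel" "L_expr \<mu> g f \<in> borel_measurable borel"
    using Cc_infinity_measurable[OF f] L2_M_measurable[OF L_expr_L2[OF f]] by auto
  have [measurable]: "D b \<in> borel_measurable borel" "\<phi> b \<in> borel_measurable borel"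
    "partial_deriv b (\<phi> b) \<in> borel_measurable borel" if "b \<in> Basis" for b
    using Cc_infinity_measurable D \<phi> Cc_infinity_partial_deriv that by blast+
  have int1: "integrable lborel (\<lambda>x. \<mu> x * h x)" if h: "h \<in> Cc_infinity" for h :: "'a \<Rightarrow> real"
  proof -
    obtain B where B: "\<And>x. norm (h x) \<le> B" using Cc_infinity_bounded[OF h] by blast
    have [measurable]: "h \<in> borel_measurable borel" by (rule Cc_infinity_measurable[OF h])
    show ?thesis
    proof (rule Bochner_Integration.integrable_bound)
      show "integrable lborel (\<lambda>x. B * \<mu> x)" using weight_integrable by simp
      have "\<bar>\<mu> x\<bar> * \<bar>h x\<bar> \<le> \<bar>\<mu> x\<bar> * \<bar>B\<bar>" for x
        using B[of x] by (intro mult_left_mono) auto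
      then show "AE x in lborel. norm (\<mu> x * h x) \<le> norm (B * \<mu> x)"
        by (simp add: abs_mult mult.commute)
    qed measurable
  qed
  have int2: "integrable lborel (\<lambda>x. \<mu> x * (norm (D b x))\<^sup>2)" if b: "b \<in> Basis" for b
    using int1[OF Cc_infinity_inner[OF D[OF b] D[OF b]]] by (simp add: power2_norm_eq_inner)
  have int3: "integrable lborel (\<lambda>x. (g x \<bullet> b) * \<phi> b x)" if b: "b \<in> Basis" for b
  proof -
    obtain B where B: "B > 0" "\<And>x. norm (\<phi> b x) \<le> B" using Cc_infinity_bounded[OF \<phi>[OF b]] by blast
    obtain K where K: "compact K" "\<And>x. x \<notin> K \<Longrightarrow> \<phi> b x = 0" using Cc_infinity_support[OF \<phi>[OF b]] by blast
    show ?thesis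
    proof (rule Bochner_Integration.integrable_bound)
      have "set_integrable lborel K (\<lambda>x. norm (g x) powr 1)"
        using H1 K(1) by (simp add: H1_loc_gradient_def weak_gradient_def Lp_loc_def)
      then show "integrable lborel (\<lambda>x. B * (indicator K x *\<^sub>R (norm (g x) powr 1)))"
        unfolding set_integrable_def by (intro integrable_mult_right)
      have "\<bar>g x \<bullet> b\<bar> * \<bar>\<phi> b x\<bar> \<le> norm (g x) * B" for x
        using B Basis_le_norm[OF b, of "g x"] by (intro mult_mono) auto
      then show "AE x in lborel. norm ((g x \<bullet> b) * \<phi> b x) \<le> norm (B * (indicator K x *\<^sub>R (norm (g x) powr 1)))"
        using B(1) K(2) by (intro AE_I2) (auto simp: abs_mult indicator_def mult.commute)
    qed (use b in measurable)
  qed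
  have weak: "(\<integral>x. \<mu> x * partial_deriv b (\<phi> b) x \<partial>lborel) = - (\<integral>x. (g x \<bullet> b) * \<phi> b x \<partial>lborel)"
    if b: "b \<in> Basis" for b
    using H1 \<phi>[OF b] b by (simp add: H1_loc_gradient_def weak_gradient_def)
  have "toH (L_expr \<mu> g f) \<bullet> toH f = (\<integral>x. \<mu> x *\<^sub>R (L_expr \<mu> g f x \<bullet> f x) \<partial>lborel)"
    using toH_inner[OF L_expr_L2[OF f] Cc_infinity_L2[OF f]] by (simp add: integral_M)
  \<comment> \<open>The product rule writes \<open>f x \<bullet> partial_deriv b (D b) x\<close> as
    the derivative of \<open>\<phi> b\<close> minus a square; the factor \<open>\<mu> x\<close>
    cancels the denominator of the drift.\<close>
  also have "\<dots> = (\<integral>x. (\<Sum>b\<in>Basis. \<mu> x * partial_deriv b (\<phi> b) x - \<mu> x * (norm (D b x))\<^sup>2 + (g x \<bullet> b) * \<phi> b x) \<partial>lborel)"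
  proof (rule integral_cong_AE)
    show "AE x in lborel. \<mu> x *\<^sub>R (L_expr \<mu> g f x \<bullet> f x) =
      (\<Sum>b\<in>Basis. \<mu> x * partial_deriv b (\<phi> b) x - \<mu> x * (norm (D b x))\<^sup>2 + (g x \<bullet> b) * \<phi> b x)"
      using weight_pos
    proof eventually_elim
      fix x assume x: "0 < \<mu> x"
      have "L_expr \<mu> g f x \<bullet> f x = (\<Sum>b\<in>Basis. f x \<bullet> partial_deriv b (D b) x + ((g x \<bullet> b) / \<mu> x) * \<phi> b x)"
        unfolding L_expr_def \<phi>_def D_def scaleR_conv_of_real[symmetric]
        by (simp add: inner_add_right inner_sum_right sum.distrib inner_commute divide_inverse mult_ac)
      then show "\<mu> x *\<^sub>R (L_expr \<mu> g f x \<bullet> f x) =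
        (\<Sum>b\<in>Basis. \<mu> x * partial_deriv b (\<phi> b) x - \<mu> x * (norm (D b x))\<^sup>2 + (g x \<bullet> b) * \<phi> b x)"
        using x by (simp add: sum_distrib_left distrib_left pd_\<phi> cong: sum.cong)
    qed
  qed measurable
  also have "\<dots> = (\<Sum>b\<in>Basis. (\<integral>x. \<mu> x * partial_deriv b (\<phi> b) x \<partial>lborel)
      - (\<integral>x. \<mu> x * (norm (D b x))\<^sup>2 \<partial>lborel) + (\<integral>x. (g x \<bullet> b) * \<phi> b x \<partial>lborel))"
    using int1[OF Cc_infinity_partial_deriv[OF \<phi>]] int2 int3
    by (subst Bochner_Integration.integral_sum) (auto intro!: sum.cong)
  \<comment> \<open>The weak gradient identity cancels the integral of \<open>\<mu>\<close> against
    the derivative of \<open>\<phi> b\<close> with that of \<open>g\<close> against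
    \<open>\<phi> b\<close>; the squares remain.\<close>
  also have "\<dots> = (\<Sum>b\<in>Basis. - (L2_norm M (D b))\<^sup>2)"
  proof (intro sum.cong refl)
    fix b :: 'a assume b: "b \<in> Basis"
    have "(L2_norm M (D b))\<^sup>2 = (\<integral>x. (norm (D b x))\<^sup>2 \<partial>M)"
      by (simp add: L2_norm_def)
    also have "\<dots> = (\<integral>x. \<mu> x * (norm (D b x))\<^sup>2 \<partial>lborel)"
      using b by (simp add: integral_M)
    finally have "(L2_norm M (D b))\<^sup>2 = (\<integral>x. \<mu> x * (norm (D b x))\<^sup>2 \<partial>lborel)" .
    then show "(\<integral>x. \<mu> x * partial_deriv b (\<phi> b) x \<partial>lborel)
      - (\<integral>x. \<mu> x * (norm (D b x))\<^sup>2 \<partial>lborel) + (\<integral>x. (g x \<bullet> b) * \<phi> b x \<partial>lborel) = - (L2_norm M (D b))\<^sup>2"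
      using weak[OF b] by simp
  qed
  finally show ?thesis by (simp add: D_def sum_negf)
qed

text \<open>In a probability space the variance of \<open>norm (h x)\<close> is nonnegative.\<close>

lemma integral_norm_le_L2_norm:
  assumes h: "h \<in> L2 M"
  shows "integrable M (\<lambda>x. norm (h x))" "(\<integral>x. norm (h x) \<partial>M) \<le> L2_norm M h"
proof -
  interpret prob_space M by (rule prob)
  have one: "(\<lambda>x. 1) \<in> L2 M" by (simp add: L2_def)
  show int: "integrable M (\<lambda>x. norm (h x))"
    using integrable_norm_mult_L2[OF h one] by simp
  have "(\<integral>x. norm (h x) \<partial>M)\<^sup>2 \<le> (\<integral>x. (norm (h x))\<^sup>2 \<partial>M)"
    using variance_eq[OF int L2_integrable[OF h]] variance_positive[of "\<lambda>x. norm (h x)"] by simp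
  then show "(\<integral>x. norm (h x) \<partial>M) \<le> L2_norm M h"
    unfolding L2_norm_def by (rule real_le_rsqrt)
qed

text \<open>On \<open>K\<close> the lower bound gives \<open>1 \<le> \<mu> x / \<delta>\<close>, so
  Lebesgue integrals over \<open>K\<close> are controlled by weighted ones.\<close>

lemma local_L1_bound:
  assumes K: "compact K"
  shows "\<exists>C\<ge>0. \<forall>h\<in>L2 M. (\<integral>\<^sup>+x. indicator K x * ennreal (norm (h x)) \<partial>lborel) \<le> ennreal (C * L2_norm M h)"
proof -
  obtain \<delta> where \<delta>: "\<delta> > 0" "AE x in lborel. x \<in> K \<longrightarrow> \<delta> \<le> \<mu> x" using bounded_below[OF K] by blast
  have "(\<integral>\<^sup>+x. indicator K x * ennreal (norm (h x)) \<partial>lborel) \<le> ennreal (1 / \<delta> * L2_norm M h)"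
    if h: "h \<in> L2 M" for h
  proof -
    have [measurable]: "h \<in> borel_measurable borel" by (rule L2_M_measurable[OF h])
    have "(\<integral>\<^sup>+x. indicator K x * ennreal (norm (h x)) \<partial>lborel)
        \<le> (\<integral>\<^sup>+x. ennreal (1 / \<delta>) * (ennreal (\<mu> x) * ennreal (norm (h x))) \<partial>lborel)"
    proof (rule nn_integral_mono_AE)
      show "AE x in lborel. indicator K x * ennreal (norm (h x)) \<le> ennreal (1 / \<delta>) * (ennreal (\<mu> x) * ennreal (norm (h x)))"
        using \<delta>(2)
      proof eventually_elim
        fix x assume x: "x \<in> K \<longrightarrow> \<delta> \<le> \<mu> x"
        show "indicator K x * ennreal (norm (h x)) \<le> ennreal (1 / \<delta>) * (ennreal (\<mu> x) * ennreal (norm (h x)))"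
        proof (cases "x \<in> K")
          case True
          then have "1 \<le> 1 / \<delta> * \<mu> x" using x \<delta>(1) by (simp add: field_simps)
          then have "1 * norm (h x) \<le> (1 / \<delta> * \<mu> x) * norm (h x)" by (intro mult_right_mono) auto
          then have "ennreal (norm (h x)) \<le> ennreal (1 / \<delta> * (\<mu> x * norm (h x)))"
            by (intro ennreal_leI) (simp add: mult_ac)
          also have "ennreal (1 / \<delta> * (\<mu> x * norm (h x))) = ennreal (1 / \<delta>) * (ennreal (\<mu> x) * ennreal (norm (h x)))"
          proof -
            have "0 \<le> \<mu> x" "0 \<le> 1 / \<delta>" using True x \<delta>(1) by auto
            then show ?thesis by (simp only: ennreal_mult mult_nonneg_nonneg norm_ge_zero)
          qed
          finally show ?thesis using True by simp
        qed simp
      qed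
    qed
    also have "\<dots> = ennreal (1 / \<delta>) * (\<integral>\<^sup>+x. ennreal (norm (h x)) \<partial>M)"
      by (simp add: nn_integral_cmult nn_integral_density)
    also have "\<dots> = ennreal (1 / \<delta>) * ennreal (\<integral>x. norm (h x) \<partial>M)"
      by (subst nn_integral_eq_integral[OF integral_norm_le_L2_norm(1)[OF h]]) auto
    also have "\<dots> \<le> ennreal (1 / \<delta>) * ennreal (L2_norm M h)"
      using integral_norm_le_L2_norm(2)[OF h] by (intro mult_left_mono ennreal_leI) auto
    also have "\<dots> = ennreal (1 / \<delta> * L2_norm M h)"
      using \<delta>(1) by (intro ennreal_mult[symmetric]) (auto simp: L2_norm_nonneg)
    finally show ?thesis .
  qed
  then show ?thesis using \<delta>(1) by (intro exI[of _ "1 / \<delta>"]) auto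
qed

lemma L_graph_L2: "(u, w) \<in> L_graph \<mu> g \<Longrightarrow> u \<in> L2 M \<and> w \<in> L2 M"
  by (simp add: L_graph_def graph_closure_def)

lemma L_graph_approx:
  assumes "(u, w) \<in> L_graph \<mu> g"
  obtains F where "\<And>n::nat. F n \<in> Cc_infinity" "(\<lambda>n. toH (F n)) \<longlonglongrightarrow> toH u"
    "(\<lambda>n. toH (L_expr \<mu> g (F n))) \<longlonglongrightarrow> toH w"
proof -
  obtain F H where FH: "\<And>n::nat. (F n, H n) \<in> {(f, L_expr \<mu> g f) | f. f \<in> Cc_infinity}"
    and lim: "(\<lambda>n. L2_norm M (\<lambda>x. F n x - u x)) \<longlonglongrightarrow> 0" "(\<lambda>n. L2_norm M (\<lambda>x. H n x - w x)) \<longlonglongrightarrow> 0"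
    using assms unfolding L_graph_def graph_closure_def by blast
  have F: "F n \<in> Cc_infinity" and H: "H n = L_expr \<mu> g (F n)" for n
    using FH[of n] by auto
  have "u \<in> L2 M" "w \<in> L2 M" using L_graph_L2[OF assms] by auto
  with lim show thesis
    by (intro that[of F])
      (auto simp: F H toH_tendsto_iff[symmetric] Cc_infinity_L2 L_expr_L2)
qed

text \<open>The gradients of the approximating test functions tend to 0 in the weighted norm, hence
  in \<open>L^1\<close> of every ball. Their translation increments vanish in the limit, so
  \<open>u\<close> agrees almost everywhere with each of its translates.\<close>

lemma L_kernel_const:
  assumes uw: "(u, w) \<in> L_graph \<mu> g" and w: "AE x in M. w x = 0"
  shows "\<exists>c. AE x in M. u x = c"
proof -
  obtain F where F: "\<And>n::nat. F n \<in> Cc_infinity" and lim_F: "(\<lambda>n. toH (F n)) \<longlonglongrightarrow> toH u"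
    and lim_H: "(\<lambda>n. toH (L_expr \<mu> g (F n))) \<longlonglongrightarrow> toH w"
    using L_graph_approx[OF uw] by blast
  have u: "u \<in> L2 M" and wL2: "w \<in> L2 M" using L_graph_L2[OF uw] by auto
  note [measurable] = L2_M_measurable[OF u] Cc_infinity_measurable[OF F]
  have F_L2: "F n \<in> L2 M" for n by (rule Cc_infinity_L2[OF F])
  have "toH w = 0"
    using toH_eq_iff[OF wL2 L2_zero] w by (simp add: toH_zero)
  \<comment> \<open>The energy is the pairing of \<open>L_expr \<mu> g (F n)\<close>, which tends to
    0, with the convergent \<open>F n\<close>.\<close>
  then have "(\<lambda>n. - (toH (L_expr \<mu> g (F n)) \<bullet> toH (F n))) \<longlonglongrightarrow> - (0 \<bullet> toH u)"
    using lim_H lim_F by (intro tendsto_intros) auto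
  then have lim_sum: "(\<lambda>n. \<Sum>b\<in>Basis. (L2_norm M (partial_deriv b (F n)))\<^sup>2) \<longlonglongrightarrow> 0"
    by (simp add: energy_identity[OF F])
  have lim_grad: "(\<lambda>n. L2_norm M (partial_deriv b (F n))) \<longlonglongrightarrow> 0" if b: "b \<in> Basis" for b
  proof -
    have "(\<lambda>n. (L2_norm M (partial_deriv b (F n)))\<^sup>2) \<longlonglongrightarrow> 0"
      by (rule real_tendsto_sandwich[OF _ _ tendsto_const lim_sum])
        (use b in \<open>auto intro!: always_eventually member_le_sum\<close>)
    then have "(\<lambda>n. sqrt ((L2_norm M (partial_deriv b (F n)))\<^sup>2)) \<longlonglongrightarrow> sqrt 0"
      by (rule tendsto_real_sqrt)
    then show ?thesis by (simp add: L2_norm_nonneg)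
  qed
  have "AE x in lborel. u (x + h) = u x" for h
  proof -
    have ball: "AE x in lborel. x \<in> cball 0 \<rho> \<longrightarrow> u (x + h) = u x" for \<rho>
    proof -
      define B where "B = cball (0::'a) \<rho>"
      define B' where "B' = cball (0::'a) (\<rho> + norm h)"
      have [measurable]: "B \<in> sets borel" "B' \<in> sets borel" by (auto simp: B_def B'_def)
      have sub: "x \<in> B \<Longrightarrow> x \<in> B'" "x \<in> B \<Longrightarrow> x + h \<in> B'" for x
        using norm_triangle_ineq[of x h] norm_ge_zero[of h] unfolding B_def B'_def mem_cball_0
        by linarith+
      obtain C where C: "C \<ge> 0" "\<And>v. v \<in> L2 M \<Longrightarrow>
          (\<integral>\<^sup>+x. indicator B' x * ennreal (norm (v x)) \<partial>lborel) \<le> ennreal (C * L2_norm M v)"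
        using local_L1_bound[of B'] by (auto simp: B'_def)
      \<comment> \<open>Two errors of replacing \<open>u\<close> by \<open>F n\<close>, at
        \<open>x\<close> and at \<open>x + h\<close>, and the increment of \<open>F n\<close>
        itself.\<close>
      define e where "e n = C * L2_norm M (\<lambda>x. F n x - u x) + C * L2_norm M (\<lambda>x. F n x - u x)
          + norm h * (\<Sum>b\<in>Basis. C * L2_norm M (partial_deriv b (F n)))" for n
      have "(\<integral>\<^sup>+x. indicator B x * ennreal (norm (u (x + h) - u x)) \<partial>lborel) \<le> ennreal (e n)" for n
      proof -
        have diff: "(\<integral>\<^sup>+x. indicator B' x * ennreal (norm (F n x - u x)) \<partial>lborel) \<le>
            ennreal (C * L2_norm M (\<lambda>x. F n x - u x))"
          by (intro C L2_diff F_L2 u)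
        have "(\<integral>\<^sup>+x. indicator B x * ennreal (norm (u (x + h) - u x)) \<partial>lborel) \<le>
          (\<integral>\<^sup>+x. indicator B' (x + h) * ennreal (norm (F n (x + h) - u (x + h)))
            + indicator B' x * ennreal (norm (F n x - u x))
            + indicator B x * ennreal (norm (F n (x + h) - F n x)) \<partial>lborel)"
        proof (rule nn_integral_mono)
          fix x
          have "norm (u (x + h) - u x) \<le> norm (F n (x + h) - u (x + h)) + norm (F n x - u x)
              + norm (F n (x + h) - F n x)"
            by norm
          then have "ennreal (norm (u (x + h) - u x)) \<le> ennreal (norm (F n (x + h) - u (x + h)))
              + ennreal (norm (F n x - u x)) + ennreal (norm (F n (x + h) - F n x))"
            by (simp flip: ennreal_plus add: ennreal_leI)
          then show "indicator B x * ennreal (norm (u (x + h) - u x)) \<le>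
              indicator B' (x + h) * ennreal (norm (F n (x + h) - u (x + h)))
            + indicator B' x * ennreal (norm (F n x - u x))
            + indicator B x * ennreal (norm (F n (x + h) - F n x))"
            using sub[of x] by (cases "x \<in> B") auto
        qed
        also have "\<dots> = (\<integral>\<^sup>+x. indicator B' (x + h) * ennreal (norm (F n (x + h) - u (x + h))) \<partial>lborel)
            + (\<integral>\<^sup>+x. indicator B' x * ennreal (norm (F n x - u x)) \<partial>lborel)
            + (\<integral>\<^sup>+x. indicator B x * ennreal (norm (F n (x + h) - F n x)) \<partial>lborel)"
        proof -
          have "(\<lambda>x. indicator B' (x + h) * ennreal (norm (F n (x + h) - u (x + h)))) \<in> borel_measurable lborel"
            "(\<lambda>x. indicator B' x * ennreal (norm (F n x - u x))) \<in> borel_measurable lborel"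
            "(\<lambda>x. indicator B x * ennreal (norm (F n (x + h) - F n x))) \<in> borel_measurable lborel"
            by measurable
          then show ?thesis by (simp only: nn_integral_add borel_measurable_add)
        qed
        also have "(\<integral>\<^sup>+x. indicator B' (x + h) * ennreal (norm (F n (x + h) - u (x + h))) \<partial>lborel)
            = (\<integral>\<^sup>+x. indicator B' x * ennreal (norm (F n x - u x)) \<partial>lborel)"
          by (rule nn_integral_lborel_shift[of "\<lambda>x. indicator B' x * ennreal (norm (F n x - u x))"]) measurable
        also have "(\<integral>\<^sup>+x. indicator B x * ennreal (norm (F n (x + h) - F n x)) \<partial>lborel) \<le>
            ennreal (norm h) * (\<Sum>b\<in>Basis. \<integral>\<^sup>+x. indicator B' x * ennreal (norm (partial_deriv b (F n) x)) \<partial>lborel)"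
          unfolding B_def B'_def by (rule nn_integral_increment_le[OF F])
        also have "\<dots> \<le> ennreal (norm h) * (\<Sum>b\<in>Basis. ennreal (C * L2_norm M (partial_deriv b (F n))))"
          by (intro mult_left_mono sum_mono C Cc_infinity_L2 Cc_infinity_partial_deriv F) auto
        also have "\<dots> = ennreal (norm h * (\<Sum>b\<in>Basis. C * L2_norm M (partial_deriv b (F n))))"
          using C(1) by (subst sum_ennreal) (simp_all add: L2_norm_nonneg sum_nonneg flip: ennreal_mult)
        finally have "(\<integral>\<^sup>+x. indicator B x * ennreal (norm (u (x + h) - u x)) \<partial>lborel) \<le>
            (\<integral>\<^sup>+x. indicator B' x * ennreal (norm (F n x - u x)) \<partial>lborel)
            + (\<integral>\<^sup>+x. indicator B' x * ennreal (norm (F n x - u x)) \<partial>lborel)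
            + ennreal (norm h * (\<Sum>b\<in>Basis. C * L2_norm M (partial_deriv b (F n))))"
          by (simp add: add_left_mono)
        also have "\<dots> \<le> ennreal (C * L2_norm M (\<lambda>x. F n x - u x)) + ennreal (C * L2_norm M (\<lambda>x. F n x - u x))
            + ennreal (norm h * (\<Sum>b\<in>Basis. C * L2_norm M (partial_deriv b (F n))))"
          by (intro add_mono diff order_refl)
        also have "\<dots> = ennreal (e n)"
          unfolding e_def using C(1)
          by (simp add: L2_norm_nonneg sum_nonneg flip: ennreal_plus)
        finally show ?thesis .
      qed
      moreover have "(\<lambda>n. ennreal (e n)) \<longlonglongrightarrow> ennreal (C * 0 + C * 0 + norm h * (\<Sum>b\<in>(Basis::'a set). C * 0))"
        unfolding e_def
        using toH_tendsto_iff[of F u sequentially, OF F_L2 u] lim_F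
        by (intro tendsto_intros lim_grad) simp_all
      ultimately have "(\<integral>\<^sup>+x. indicator B x * ennreal (norm (u (x + h) - u x)) \<partial>lborel) \<le>
          ennreal (C * 0 + C * 0 + norm h * (\<Sum>b\<in>(Basis::'a set). C * 0))"
        by (intro LIMSEQ_le_const) auto
      then have "(\<integral>\<^sup>+x. indicator B x * ennreal (norm (u (x + h) - u x)) \<partial>lborel) = 0" by simp
      then have "AE x in lborel. indicator B x * ennreal (norm (u (x + h) - u x)) = 0"
        by (subst (asm) nn_integral_0_iff_AE) auto
      then show ?thesis
        by eventually_elim (auto simp: B_def indicator_def split: if_splits)
    qed
    have "AE x in lborel. \<forall>n::nat. x \<in> cball 0 (real n) \<longrightarrow> u (x + h) = u x"
      unfolding AE_all_countable using ball by blast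
    then show ?thesis
    proof eventually_elim
      fix x assume *: "\<forall>n::nat. x \<in> cball 0 (real n) \<longrightarrow> u (x + h) = u x"
      obtain n :: nat where "norm x \<le> real n" using real_arch_simple by blast
      with * show "u (x + h) = u x" by auto
    qed
  qed
  then show ?thesis
    unfolding AE_M by (intro AE_const_if_shift_invariant) auto
qed

end

section \<open>The semigroup on the Hilbert space\<close>

lemma linear_funpow:
  fixes R :: "'v::real_vector \<Rightarrow> 'v"
  assumes "linear R"
  shows "linear (R ^^ n)"
proof (induction n)
  case (Suc n)
  show ?case unfolding funpow.simps by (rule linear_compose[OF Suc assms])
qed (simp add: linear_id flip: id_def)

context weight
begin

lemma lift_add:
  "bounded_opr M S \<Longrightarrow> bounded_opr M T \<Longrightarrow> lift (\<lambda>f x. S f x + T f x) F = lift S F + lift T F"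
  by (simp add: lift_def toH_add bounded_opr_L2 ofH_L2)

lemma lift_cmult: "bounded_opr M T \<Longrightarrow> lift (\<lambda>f x. complex_of_real a * T f x) F = a *\<^sub>R lift T F"
  by (simp add: lift_def toH_scaleR bounded_opr_L2 ofH_L2)

lemma lift_sum:
  "(\<And>k. bounded_opr M (S k)) \<Longrightarrow> lift (\<lambda>f x. \<Sum>k<n::nat. S k f x) F = (\<Sum>k<n. lift (S k) F)"
proof (induction n)
  case 0
  show ?case by (simp add: lift_def toH_zero)
next
  case (Suc n)
  then show ?case by (simp add: lift_add[OF bounded_opr_sum])
qed

text \<open>Complex conjugation as a real-linear map of the Hilbert space; the vectors it fixes are
  the classes of real functions.\<close>

definition cnjH :: "'a l2 \<Rightarrow> 'a l2" where
  "cnjH F = toH (\<lambda>x. cnj (ofH F x))"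

lemma cnjH_toH:
  assumes "f \<in> L2 M"
  shows "cnjH (toH f) = toH (\<lambda>x. cnj (f x))"
  unfolding cnjH_def
proof (subst toH_eq_iff)
  show "AE x in M. cnj (ofH (toH f) x) = cnj (f x)"
    using ofH_toH[OF assms] by eventually_elim simp
qed (intro L2_cnj ofH_L2 assms)+

lemma L2_norm_cnj: "L2_norm M (\<lambda>x. cnj (f x)) = L2_norm M f"
  by (simp add: L2_norm_def)

lemma bounded_linear_cnjH: "bounded_linear cnjH"
proof (rule bounded_linear_intro[of _ 1])
  fix F G :: "'a l2" and a :: real
  show "cnjH (F + G) = cnjH F + cnjH G"
    using cnjH_toH[of "\<lambda>x. ofH F x + ofH G x"]
    by (simp add: cnjH_def toH_add L2_add L2_cnj ofH_L2)
  show "cnjH (a *\<^sub>R F) = a *\<^sub>R cnjH F"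
    using cnjH_toH[of "\<lambda>x. complex_of_real a * ofH F x"]
    by (simp add: cnjH_def toH_scaleR L2_mult L2_cnj ofH_L2)
  show "norm (cnjH F) \<le> norm F * 1"
    by (simp add: cnjH_def norm_toH L2_cnj ofH_L2 L2_norm_cnj L2_norm_ofH)
qed

end

context elliptic_weight
begin

text \<open>The coefficients of \<open>L\<close> are real.\<close>

lemma L_expr_cnj:
  assumes f: "f \<in> Cc_infinity"
  shows "L_expr \<mu> g (\<lambda>x. cnj (f x)) = (\<lambda>x. cnj (L_expr \<mu> g f x))"
proof -
  have pd: "partial_deriv b (\<lambda>x. cnj (h x)) = (\<lambda>x. cnj (partial_deriv b h x))"
    if "h \<in> Cc_infinity" for b and h :: "'a \<Rightarrow> complex"
    by (rule ext) (rule partial_deriv_bounded_linear[OF bounded_linear_cnj Cc_infinity_differentiable[OF that]])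
  show ?thesis
    by (rule ext) (simp add: L_expr_def pd[OF f] pd[OF Cc_infinity_partial_deriv[OF f]] cong: sum.cong)
qed

lemma L_graph_cnj:
  assumes "(u, w) \<in> L_graph \<mu> g"
  shows "((\<lambda>x. cnj (u x)), (\<lambda>x. cnj (w x))) \<in> L_graph \<mu> g"
proof -
  obtain F H where FH: "\<And>n::nat. (F n, H n) \<in> {(f, L_expr \<mu> g f) | f. f \<in> Cc_infinity}"
    and lim: "(\<lambda>n. L2_norm M (\<lambda>x. F n x - u x)) \<longlonglongrightarrow> 0" "(\<lambda>n. L2_norm M (\<lambda>x. H n x - w x)) \<longlonglongrightarrow> 0"
    using assms unfolding L_graph_def graph_closure_def by blast
  have F: "F n \<in> Cc_infinity" and H: "H n = L_expr \<mu> g (F n)" for n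
    using FH[of n] by auto
  have 1: "((\<lambda>x. cnj (F n x)), (\<lambda>x. cnj (H n x))) \<in> {(f, L_expr \<mu> g f) | f. f \<in> Cc_infinity}" for n
    using L_expr_cnj[OF F[of n]] Cc_infinity_bounded_linear[OF bounded_linear_cnj F[of n]] by (auto simp: H)
  have 2: "(\<lambda>n. L2_norm M (\<lambda>x. cnj (F n x) - cnj (u x))) \<longlonglongrightarrow> 0"
    "(\<lambda>n. L2_norm M (\<lambda>x. cnj (H n x) - cnj (w x))) \<longlonglongrightarrow> 0"
    using lim by (simp_all add: L2_norm_cnj flip: complex_cnj_diff)
  show ?thesis
    unfolding L_graph_def graph_closure_def
    using L_graph_L2[OF assms]
    by (intro CollectI case_prodI conjI exI[of _ "\<lambda>n x. cnj (F n x)"] exI[of _ "\<lambda>n x. cnj (H n x)"]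
        allI 1 2 L2_cnj) simp_all
qed

lemma A_graph_cnj:
  assumes "(u, f) \<in> A_graph \<mu> g"
  shows "((\<lambda>x. cnj (u x)), (\<lambda>x. cnj (f x))) \<in> A_graph \<mu> g"
proof -
  obtain w where f: "f \<in> L2 M" and uw: "(u, w) \<in> L_graph \<mu> g"
    and eq: "\<And>v z. (v, z) \<in> L_graph \<mu> g \<Longrightarrow> (\<integral>x. w x * cnj (z x) \<partial>M) = (\<integral>x. f x * cnj (v x) \<partial>M)"
    using assms unfolding A_graph_def by blast
  have "(\<integral>x. cnj (w x) * cnj (z x) \<partial>M) = (\<integral>x. cnj (f x) * cnj (v x) \<partial>M)"
    if "(v, z) \<in> L_graph \<mu> g" for v z
  proof -
    \<comment> \<open>The identity for \<open>(u, f)\<close> is tested with the conjugate of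
      \<open>(v, z)\<close>, which is again in the graph of \<open>L\<close>, and then
      conjugated.\<close>
    have "cnj (\<integral>x. w x * z x \<partial>M) = cnj (\<integral>x. f x * v x \<partial>M)"
      using eq[OF L_graph_cnj[OF that]] by simp
    then show ?thesis
      by (simp only: Bochner_Integration.integral_cnj[symmetric] complex_cnj_mult)
  qed
  then show ?thesis
    using L2_cnj[OF f] L_graph_cnj[OF uw] unfolding A_graph_def by blast
qed

text \<open>The real part of the form identity, expressed in the Hilbert space; \<open>w\<close>
  stands for \<open>L u\<close>.\<close>

lemma A_graph_witness:
  assumes "(u, f) \<in> A_graph \<mu> g"
  obtains w where "(u, w) \<in> L_graph \<mu> g"
    "\<And>v z. (v, z) \<in> L_graph \<mu> g \<Longrightarrow> toH w \<bullet> toH z = toH f \<bullet> toH v"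
proof -
  obtain w where f: "f \<in> L2 M" and uw: "(u, w) \<in> L_graph \<mu> g"
    and eq: "\<And>v z. (v, z) \<in> L_graph \<mu> g \<Longrightarrow> (\<integral>x. w x * cnj (z x) \<partial>M) = (\<integral>x. f x * cnj (v x) \<partial>M)"
    using assms unfolding A_graph_def by blast
  have "toH w \<bullet> toH z = toH f \<bullet> toH v" if vz: "(v, z) \<in> L_graph \<mu> g" for v z
    using L_graph_L2[OF uw] L_graph_L2[OF vz] f eq[OF vz]
    by (simp add: toH_inner integral_inner_eq_Re)
  with uw show thesis using that by blast
qed

end

section \<open>The lifted semigroup, its generator and its resolvents\<close>

locale elliptic_semigroup = elliptic_weight +
  fixes T :: "real \<Rightarrow> 'a opr"
  assumes C0: "C0_semigroup M T"
    and generator_eq: "generator M T = uminus_graph (A_graph \<mu> g)"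
begin

lemma bounded_opr_T: "t \<ge> 0 \<Longrightarrow> bounded_opr M (T t)"
  using C0 by (simp add: C0_semigroup_def)

sublocale H: c0_semigroup "\<lambda>t. lift (T t)"
proof (rule c0_semigroup.intro)
  show "bounded_linear (lift (T t))" if "t \<ge> 0" for t
    using that by (intro bounded_linear_lift bounded_opr_T)
  show "lift (T 0) F = F" for F
  proof -
    have "AE x in M. T 0 (ofH F) x = ofH F x"
      using C0 ofH_L2 by (simp add: C0_semigroup_def)
    then have "toH (T 0 (ofH F)) = toH (ofH F)"
      by (subst toH_eq_iff) (simp_all add: ofH_L2 bounded_opr_L2 bounded_opr_T)
    then show ?thesis by (simp add: lift_def)
  qed
  show "lift (T (s + t)) F = lift (T s) (lift (T t) F)" if st: "s \<ge> 0" "t \<ge> 0" for s t F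
  proof -
    have L2: "T t (ofH F) \<in> L2 M" "T s (T t (ofH F)) \<in> L2 M" "T (s + t) (ofH F) \<in> L2 M"
      using st by (simp_all add: ofH_L2 bounded_opr_L2 bounded_opr_T)
    have "AE x in M. T (s + t) (ofH F) x = T s (T t (ofH F)) x"
      using C0 ofH_L2 st by (simp add: C0_semigroup_def)
    then have "lift (T (s + t)) F = toH (T s (T t (ofH F)))"
      unfolding lift_def by (subst toH_eq_iff) (simp_all add: L2)
    also have "\<dots> = lift (T s) (lift (T t) F)"
      using lift_toH[OF bounded_opr_T[OF st(1)] L2(1)] by (simp add: lift_def)
    finally show ?thesis .
  qed
  show "((\<lambda>t. lift (T t) F) \<longlongrightarrow> F) (at_right 0)" for F
  proof -
    have "((\<lambda>t. L2_norm M (\<lambda>x. T t (ofH F) x - ofH F x)) \<longlongrightarrow> 0) (at_right 0)"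
      using C0 ofH_L2 by (simp add: C0_semigroup_def)
    moreover have "\<forall>\<^sub>F t in at_right 0. L2_norm M (\<lambda>x. T t (ofH F) x - ofH F x) = norm (lift (T t) F - F)"
      using eventually_at_right_less[of 0]
    proof (rule eventually_mono)
      fix t :: real assume "0 < t"
      then show "L2_norm M (\<lambda>x. T t (ofH F) x - ofH F x) = norm (lift (T t) F - F)"
        using norm_toH_diff[of "T t (ofH F)" "ofH F"]
        by (simp add: lift_def ofH_L2 bounded_opr_L2 bounded_opr_T)
    qed
    ultimately have "((\<lambda>t. norm (lift (T t) F - F)) \<longlongrightarrow> 0) (at_right 0)"
      by (rule Lim_transform_eventually)
    then show ?thesis by (rule LIM_zero_cancel[OF tendsto_norm_zero_cancel])
  qed
qed

lemma generator_iff: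
  assumes u: "u \<in> L2 M" and w: "w \<in> L2 M"
  shows "(u, w) \<in> generator M T \<longleftrightarrow> (toH u, toH w) \<in> H.gen"
proof -
  have "L2_norm M (\<lambda>x. (T t u x - u x) / complex_of_real t - w x)
      = norm ((lift (T t) (toH u) - toH u) /\<^sub>R t - toH w)" if t: "t > 0" for t
  proof -
    have Tu: "T t u \<in> L2 M" by (rule bounded_opr_L2[OF bounded_opr_T[OF less_imp_le[OF t]] u])
    have "(lift (T t) (toH u) - toH u) /\<^sub>R t = toH (\<lambda>x. complex_of_real (inverse t) * (T t u x - u x))"
      using t by (simp only: toH_scaleR[OF L2_diff[OF Tu u]] toH_diff[OF Tu u] lift_toH[OF bounded_opr_T u] less_imp_le)
    then have "norm ((lift (T t) (toH u) - toH u) /\<^sub>R t - toH w)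
        = L2_norm M (\<lambda>x. complex_of_real (inverse t) * (T t u x - u x) - w x)"
      by (simp only: norm_toH_diff[OF L2_mult[OF L2_diff[OF Tu u]] w])
    then show ?thesis by (simp add: divide_inverse mult.commute)
  qed
  then have "\<forall>\<^sub>F t in at_right 0. L2_norm M (\<lambda>x. (T t u x - u x) / complex_of_real t - w x)
      = norm ((lift (T t) (toH u) - toH u) /\<^sub>R t - toH w)"
    by (intro eventually_mono[OF eventually_at_right_less[of 0]])
  then have "((\<lambda>t. L2_norm M (\<lambda>x. (T t u x - u x) / complex_of_real t - w x)) \<longlongrightarrow> 0) (at_right 0)
      \<longleftrightarrow> ((\<lambda>t. norm ((lift (T t) (toH u) - toH u) /\<^sub>R t - toH w)) \<longlongrightarrow> 0) (at_right 0)"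
    by (rule tendsto_cong)
  also have "\<dots> \<longleftrightarrow> ((\<lambda>t. (lift (T t) (toH u) - toH u) /\<^sub>R t) \<longlongrightarrow> toH w) (at_right 0)"
    by (simp only: tendsto_norm_zero_iff LIM_zero_iff)
  finally show ?thesis using u w by (simp add: generator_def H.gen_def)
qed

lemma generator_L2: "(u, w) \<in> generator M T \<Longrightarrow> u \<in> L2 M \<and> w \<in> L2 M"
  by (simp add: generator_def)

lemma A_graph_iff:
  assumes u: "u \<in> L2 M" and w: "w \<in> L2 M"
  shows "(u, w) \<in> A_graph \<mu> g \<longleftrightarrow> (toH u, - toH w) \<in> H.gen"
proof -
  have "(u, w) \<in> A_graph \<mu> g \<longleftrightarrow> (u, \<lambda>x. - w x) \<in> uminus_graph (A_graph \<mu> g)"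
  proof
    assume "(u, \<lambda>x. - w x) \<in> uminus_graph (A_graph \<mu> g)"
    then obtain w' where "(\<lambda>x. - w x) = (\<lambda>x. - w' x)" "(u, w') \<in> A_graph \<mu> g"
      unfolding uminus_graph_def by blast
    moreover from this have "w = w'" by (auto simp: fun_eq_iff)
    ultimately show "(u, w) \<in> A_graph \<mu> g" by simp
  qed (auto simp: uminus_graph_def)
  also have "\<dots> \<longleftrightarrow> (toH u, - toH w) \<in> H.gen"
    using generator_iff[OF u L2_uminus[OF w]] by (simp add: generator_eq toH_uminus[OF w])
  finally show ?thesis .
qed

lemma gen_A_graph: "(U, W) \<in> H.gen \<Longrightarrow> (ofH U, ofH (- W)) \<in> A_graph \<mu> g"
  by (simp add: A_graph_iff ofH_L2)

sublocale H: selfadjoint_semigroup "\<lambda>t. lift (T t)"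
proof
  fix U W V Z assume UW: "(U, W) \<in> H.gen" and VZ: "(V, Z) \<in> H.gen"
  obtain a where a: "(ofH U, a) \<in> L_graph \<mu> g"
    "\<And>v z. (v, z) \<in> L_graph \<mu> g \<Longrightarrow> toH a \<bullet> toH z = toH (ofH (- W)) \<bullet> toH v"
    using A_graph_witness[OF gen_A_graph[OF UW]] by blast
  obtain b where b: "(ofH V, b) \<in> L_graph \<mu> g"
    "\<And>v z. (v, z) \<in> L_graph \<mu> g \<Longrightarrow> toH b \<bullet> toH z = toH (ofH (- Z)) \<bullet> toH v"
    using A_graph_witness[OF gen_A_graph[OF VZ]] by blast
  \<comment> \<open>With \<open>a\<close> for \<open>L\<close> at \<open>U\<close> and
    \<open>b\<close> for \<open>L\<close> at \<open>V\<close>, both sides equal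
    \<open>- (toH a \<bullet> toH b)\<close>: the form of each is tested with the other.\<close>
  show "W \<bullet> V = U \<bullet> Z"
    using a(2)[OF b(1)] b(2)[OF a(1)] by (simp add: inner_commute)
next
  fix U W assume UW: "(U, W) \<in> H.gen"
  obtain a where a: "(ofH U, a) \<in> L_graph \<mu> g"
    "\<And>v z. (v, z) \<in> L_graph \<mu> g \<Longrightarrow> toH a \<bullet> toH z = toH (ofH (- W)) \<bullet> toH v"
    using A_graph_witness[OF gen_A_graph[OF UW]] by blast
  have "0 \<le> toH a \<bullet> toH a" by simp
  then show "W \<bullet> U \<le> 0" using a(2)[OF a(1)] by simp
qed

text \<open>Testing the form with \<open>U\<close> itself shows that \<open>L\<close> annihilates
  \<open>U\<close>, and \<open>L_kernel_const\<close> applies.\<close>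

lemma kernel_const:
  assumes "(U, 0) \<in> H.gen"
  obtains c where "U = toH (\<lambda>x. c)"
proof -
  obtain a where a: "(ofH U, a) \<in> L_graph \<mu> g"
    "\<And>v z. (v, z) \<in> L_graph \<mu> g \<Longrightarrow> toH a \<bullet> toH z = toH (ofH (- 0)) \<bullet> toH v"
    using A_graph_witness[OF gen_A_graph[OF assms]] by blast
  have "toH a = toH (\<lambda>x. 0)" using a(2)[OF a(1)] by (simp add: toH_zero)
  then have "AE x in M. a x = 0"
    using toH_eq_iff[of a "\<lambda>x. 0"] L_graph_L2[OF a(1)] L2_zero[of M] by simp
  then obtain c where "AE x in M. ofH U x = c" using L_kernel_const[OF a(1)] by blast
  moreover have "(\<lambda>x. c) \<in> L2 M" by (rule L2_bounded[OF finite_M, of _ "norm c"]) auto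
  ultimately have "U = toH (\<lambda>x. c)" using toH_eq_iff[OF ofH_L2[of U], of "\<lambda>x. c"] by simp
  then show thesis by (rule that)
qed

lemma resolvent_at_lift:
  assumes R: "is_resolvent M (uminus_graph (A_graph \<mu> g)) (complex_of_real \<zeta>) R"
  shows "H.resolvent_at \<zeta> (lift R)"
proof -
  note R' = R[unfolded is_resolvent_def generator_eq[symmetric]]
  have bR: "bounded_opr M R" using R' by blast
  have "(lift R H, \<zeta> *\<^sub>R lift R H - H) \<in> H.gen" for H
  proof -
    obtain w where w: "(R (ofH H), w) \<in> generator M T"
      "AE x in M. complex_of_real \<zeta> * R (ofH H) x - w x = ofH H x"
      using R' ofH_L2[of H] by blast
    have L2: "R (ofH H) \<in> L2 M" "w \<in> L2 M" using generator_L2[OF w(1)] by auto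
    have "toH (\<lambda>x. complex_of_real \<zeta> * R (ofH H) x - w x) = toH (ofH H)"
      using w(2) L2 by (subst toH_eq_iff) (auto intro: L2_diff L2_mult ofH_L2)
    then have "toH w = \<zeta> *\<^sub>R lift R H - H"
      by (simp add: toH_diff[OF L2_mult[OF L2(1)] L2(2)] toH_scaleR[OF L2(1)] lift_def algebra_simps)
    then show ?thesis using w(1) generator_iff[OF L2] by (simp add: lift_def)
  qed
  moreover have "lift R (\<zeta> *\<^sub>R U - W) = U" if UW: "(U, W) \<in> H.gen" for U W
  proof -
    have "(ofH U, ofH W) \<in> generator M T" using UW by (simp add: generator_iff ofH_L2)
    then have "AE x in M. R (\<lambda>y. complex_of_real \<zeta> * ofH U y - ofH W y) x = ofH U x"
      using R' by fast
    then have "toH (R (\<lambda>y. complex_of_real \<zeta> * ofH U y - ofH W y)) = U"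
      using toH_eq_iff[OF bounded_opr_L2[OF bR L2_diff[OF L2_mult[OF ofH_L2] ofH_L2]] ofH_L2] by simp
    then show ?thesis
      using lift_toH[OF bR L2_diff[OF L2_mult[OF ofH_L2] ofH_L2], of "complex_of_real \<zeta>" U W]
      by (simp add: toH_diff[OF L2_mult[OF ofH_L2] ofH_L2] toH_scaleR[OF ofH_L2])
  qed
  ultimately show ?thesis
    unfolding H.resolvent_at_def using bounded_linear_lift[OF bR] by blast
qed

text \<open>The expansion converges at each point separately, and a bound uniform in the point is
  wanted. It is recovered as for power series: at one reference point \<open>\<zeta>\<close> the
  remainders are bounded, so \<open>\<zeta> ^ n\<close> times the norm of the \<open>n\<close>-th
  coefficient is bounded in \<open>n\<close>; at points below \<open>\<zeta> / 2\<close> the regular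
  part is dominated by a geometric series.\<close>

lemma simple_pole_lift:
  assumes "simple_pole M (uminus_graph (A_graph \<mu> g)) 0"
  obtains P C r where "bounded_opr M P" "\<exists>f\<in>L2 M. \<not> (AE x in M. P f x = 0)"
    "selfadjoint_semigroup_pole (\<lambda>t. lift (T t)) (lift P) C r"
proof -
  let ?G = "uminus_graph (A_graph \<mu> g)"
  have isol: "0 isolated_in spectrum M ?G" using assms by (simp add: simple_pole_def)
  obtain P Q r where P: "bounded_opr M P" "\<exists>f\<in>L2 M. \<not> (AE x in M. P f x = 0)"
    and Q: "\<And>k. bounded_opr M (Q k)" and r: "r > 0"
    and expansion: "\<And>\<zeta> R. 0 < norm \<zeta> \<Longrightarrow> norm \<zeta> < r \<Longrightarrow> is_resolvent M ?G \<zeta> R \<Longrightarrow>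
      (\<lambda>n. opr_norm M (\<lambda>f x. R f x - (P f x / \<zeta> + (\<Sum>k<n. \<zeta> ^ k * Q k f x)))) \<longlonglongrightarrow> 0"
  proof -
    obtain P Q r where *: "bounded_opr M P" "\<forall>k. bounded_opr M (Q k)"
      "\<exists>f\<in>L2 M. \<not> (AE x in M. P f x = 0)" "r > 0"
      "\<forall>\<zeta> R. 0 < norm (\<zeta> - 0) \<and> norm (\<zeta> - 0) < r \<and> is_resolvent M ?G \<zeta> R \<longrightarrow>
      (\<lambda>n. opr_norm M (\<lambda>f x. R f x - (P f x / (\<zeta> - 0) + (\<Sum>k<n. (\<zeta> - 0) ^ k * Q k f x)))) \<longlonglongrightarrow> 0"
      using assms unfolding simple_pole_def by (elim conjE exE)
    show thesis
      by (rule that[of P Q r]) (use * in \<open>simp_all only: diff_zero\<close>)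
  qed
  obtain U where U: "open U" "U \<inter> spectrum M ?G = {0}"
    using isol unfolding isolated_in_def by blast
  then obtain \<epsilon> where \<epsilon>: "\<epsilon> > 0" "ball 0 \<epsilon> \<subseteq> U"
    using open_contains_ball by blast
  \<comment> \<open>Below \<open>r\<close> the expansion is available; below
    \<open>\<epsilon>\<close> the point is in the resolvent set, since 0 is isolated in the
    spectrum.\<close>
  define r' where "r' = min r \<epsilon>"
  have r': "r' > 0" using r \<epsilon> by (simp add: r'_def)
  have ex: "\<exists>R a. H.resolvent_at z (lift R) \<and> a \<longlonglongrightarrow> 0 \<and>
      (\<forall>n F. norm (lift R F - (lift P F /\<^sub>R z + (\<Sum>k<n. z ^ k *\<^sub>R lift (Q k) F))) \<le> a n * norm F)"
    if z: "0 < z" "z < r'" for z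
  proof -
    have "complex_of_real z \<in> U" "complex_of_real z \<noteq> 0" using z \<epsilon> by (auto simp: r'_def)
    then have "complex_of_real z \<in> resolvent_set M ?G"
      using U(2) unfolding spectrum_def by blast
    then obtain R where R: "is_resolvent M ?G (complex_of_real z) R"
      unfolding resolvent_set_def by blast
    have bR: "bounded_opr M R" using R by (simp add: is_resolvent_def)
    \<comment> \<open>The remainder is written with sums and real multiples, the operations that
      \<open>bounded_opr\<close> and \<open>lift\<close> are known to respect.\<close>
    define E where "E n = (\<lambda>f x. R f x + complex_of_real (-1) * (complex_of_real (inverse z) * P f x
      + (\<Sum>k<n. complex_of_real (z ^ k) * Q k f x)))" for n
    have E_eq: "E n = (\<lambda>f x. R f x - (P f x / complex_of_real z + (\<Sum>k<n. complex_of_real z ^ k * Q k f x)))" for n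
      by (intro ext) (simp add: E_def divide_inverse mult.commute)
    have lim: "(\<lambda>n. opr_norm M (E n)) \<longlonglongrightarrow> 0"
      unfolding E_eq using z R by (intro expansion) (auto simp: r'_def)
    note bE = bounded_opr_cmult[OF P(1)] bounded_opr_sum[OF bounded_opr_cmult[OF Q]]
    note bE' = bounded_opr_add[OF bE]
    have bE'': "bounded_opr M (E n)" for n
      unfolding E_def by (intro bounded_opr_add[OF bR] bounded_opr_cmult bE')
    have "lift (E n) F = lift R F - (lift P F /\<^sub>R z + (\<Sum>k<n. z ^ k *\<^sub>R lift (Q k) F))" for n F
      unfolding E_def
      by (simp only: lift_add[OF bR bounded_opr_cmult[OF bE']] lift_cmult[OF bE'] lift_add[OF bE]
          lift_cmult[OF P(1)] lift_sum[OF bounded_opr_cmult[OF Q]] lift_cmult[OF Q]) simp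
    with norm_lift_le_opr_norm[OF bE''] lim resolvent_at_lift[OF R] show ?thesis
      by (intro exI[of _ R] exI[of _ "\<lambda>n. opr_norm M (E n)"]) auto
  qed
  define \<zeta> where "\<zeta> = r' / 2"
  have \<zeta>: "0 < \<zeta>" "\<zeta> < r'" using r' by (auto simp: \<zeta>_def)
  obtain R a where a: "a \<longlonglongrightarrow> 0"
    "\<And>n F. norm (lift R F - (lift P F /\<^sub>R \<zeta> + (\<Sum>k<n. \<zeta> ^ k *\<^sub>R lift (Q k) F))) \<le> a n * norm F"
    using ex[OF \<zeta>] by blast
  obtain A where A: "A > 0" "\<And>n. norm (a n) \<le> A"
    using Bseq_def convergentI[OF a(1)] convergent_imp_Bseq by metis
  \<comment> \<open>Consecutive remainders differ by one term of the series, which accounts for the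
    factor 2.\<close>
  have Q_bound: "\<zeta> ^ n * norm (lift (Q n) F) \<le> 2 * A * norm F" for n F
  proof -
    let ?e = "\<lambda>n. lift R F - (lift P F /\<^sub>R \<zeta> + (\<Sum>k<n. \<zeta> ^ k *\<^sub>R lift (Q k) F))"
    have le: "norm (?e n) \<le> A * norm F" for n
      using a(2)[of F n] mult_right_mono[of "a n" A "norm F"] A(2)[of n] by (simp add: abs_le_iff)
    have "\<zeta> ^ n * norm (lift (Q n) F) = norm (\<zeta> ^ n *\<^sub>R lift (Q n) F)" using \<zeta> by simp
    also have "\<zeta> ^ n *\<^sub>R lift (Q n) F = ?e n - ?e (Suc n)" by simp
    also have "norm \<dots> \<le> norm (?e n) + norm (?e (Suc n))" by (rule norm_triangle_ineq4)
    also have "\<dots> \<le> 2 * A * norm F" using le[of n] le[of "Suc n"] by simp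
    finally show ?thesis .
  qed
  \<comment> \<open>\<open>4 * A\<close> is the bound \<open>2 * A\<close> on the coefficients times
    the sum 2 of the geometric series.\<close>
  have "\<exists>R. H.resolvent_at z R \<and> (\<forall>F. norm (R F - lift P F /\<^sub>R z) \<le> 4 * A * norm F)"
    if z: "0 < z" "z < \<zeta> / 2" for z
  proof -
    obtain R b where R: "H.resolvent_at z (lift R)" and b: "b \<longlonglongrightarrow> 0"
      "\<And>n F. norm (lift R F - (lift P F /\<^sub>R z + (\<Sum>k<n. z ^ k *\<^sub>R lift (Q k) F))) \<le> b n * norm F"
      using ex[of z] z \<zeta> by auto
    have "norm (lift R F - lift P F /\<^sub>R z) \<le> 4 * A * norm F" for F
    proof -
      have "norm (lift R F - lift P F /\<^sub>R z) \<le> b n * norm F + 4 * A * norm F" for n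
      proof -
        have summand: "norm (z ^ k *\<^sub>R lift (Q k) F) \<le> 2 * A * norm F * (1/2) ^ k" for k
        proof -
          have "z ^ k \<le> (\<zeta> * (1/2)) ^ k" using z by (intro power_mono) auto
          then have "norm (z ^ k *\<^sub>R lift (Q k) F) \<le> (\<zeta> * (1/2)) ^ k * norm (lift (Q k) F)"
            using z by (simp add: mult_right_mono)
          also have "\<dots> = (\<zeta> ^ k * norm (lift (Q k) F)) * (1/2) ^ k"
            by (simp only: power_mult_distrib mult_ac)
          also have "\<dots> \<le> 2 * A * norm F * (1/2) ^ k"
            by (intro mult_right_mono Q_bound) auto
          finally show ?thesis .
        qed
        have "norm (\<Sum>k<n. z ^ k *\<^sub>R lift (Q k) F) \<le> (\<Sum>k<n. 2 * A * norm F * (1/2) ^ k)"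
          by (rule order_trans[OF norm_sum]) (intro sum_mono summand)
        also have "\<dots> = 2 * A * norm F * (\<Sum>k<n. (1/2) ^ k)" by (simp only: sum_distrib_left)
        also have "\<dots> \<le> 2 * A * norm F * 2"
        proof (intro mult_left_mono)
          show "(\<Sum>k<n. (1/2::real) ^ k) \<le> 2"
            using sum_le_suminf[of "\<lambda>k. (1/2::real) ^ k" "{..<n}"] suminf_geometric[of "1/2::real"] by simp
        qed (use A in simp)
        finally have sum: "norm (\<Sum>k<n. z ^ k *\<^sub>R lift (Q k) F) \<le> 4 * A * norm F" by simp
        have "lift R F - lift P F /\<^sub>R z =
          (lift R F - (lift P F /\<^sub>R z + (\<Sum>k<n. z ^ k *\<^sub>R lift (Q k) F))) + (\<Sum>k<n. z ^ k *\<^sub>R lift (Q k) F)"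
          by simp
        also have "norm \<dots> \<le> b n * norm F + 4 * A * norm F"
          by (intro norm_triangle_le add_mono b(2) sum)
        finally show ?thesis .
      qed
      moreover have "(\<lambda>n. b n * norm F + 4 * A * norm F) \<longlonglongrightarrow> 0 * norm F + 4 * A * norm F"
        by (intro tendsto_intros b(1))
      ultimately have "norm (lift R F - lift P F /\<^sub>R z) \<le> 0 * norm F + 4 * A * norm F"
        by (intro LIMSEQ_le_const[where X = "\<lambda>n. b n * norm F + 4 * A * norm F"]) auto
      then show ?thesis by simp
    qed
    with R show ?thesis by blast
  qed
  then have "selfadjoint_semigroup_pole (\<lambda>t. lift (T t)) (lift P) (4 * A) (\<zeta> / 2)"
    using bounded_linear_lift[OF P(1)] A(1) \<zeta>(1)
    by (intro selfadjoint_semigroup_pole.intro[OF H.selfadjoint_semigroup_axioms]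
        selfadjoint_semigroup_pole_axioms.intro) auto
  with P show thesis using that by blast
qed

lemma T_cnj: "t \<ge> 0 \<Longrightarrow> lift (T t) (cnjH F) = cnjH (lift (T t) F)"
proof (rule H.T_commute[OF bounded_linear_cnjH])
  fix U W assume "(U, W) \<in> H.gen"
  from A_graph_cnj[OF gen_A_graph[OF this]]
  have "(toH (\<lambda>x. cnj (ofH U x)), - toH (\<lambda>x. cnj (ofH (- W) x))) \<in> H.gen"
    by (subst (asm) A_graph_iff) (auto intro: L2_cnj ofH_L2)
  moreover have "toH (\<lambda>x. cnj (ofH (- W) x)) = - cnjH W"
    using linear_neg[OF bounded_linear.linear[OF bounded_linear_cnjH], of W] by (simp add: cnjH_def)
  ultimately show "(cnjH U, cnjH W) \<in> H.gen" by (simp add: cnjH_def)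
qed

text \<open>For \<open>G = (R ^^ n) F\<close> the value of \<open>A\<close> at \<open>R G\<close> is
  \<open>G - \<zeta> *\<^sub>R R G\<close>, again \<open>R ^^ n\<close> of a vector, namely of
  \<open>F - \<zeta> *\<^sub>R R F\<close>. The induction therefore generalises over
  \<open>F\<close>.\<close>

lemma R_power_dom:
  assumes R: "H.resolvent_at \<zeta> R" and "\<zeta> > 0"
  shows "u \<in> L2 M \<Longrightarrow> toH u = (R ^^ n) F \<Longrightarrow> u \<in> Domain (A_graph \<mu> g ^^ n)"
proof (induction n arbitrary: u F)
  case 0
  then show ?case by auto
next
  case (Suc n)
  have lin: "linear R" using H.bounded_linear_R[OF assms] by (rule bounded_linear.linear)
  have lin_pow: "linear (R ^^ n)"
    using lin by (rule linear_funpow)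
  define G where "G = (R ^^ n) F"
  have "(R G, \<zeta> *\<^sub>R R G - G) \<in> H.gen" by (rule H.R_gen[OF assms])
  then have "(u, ofH (G - \<zeta> *\<^sub>R R G)) \<in> A_graph \<mu> g"
    using Suc.prems by (simp add: A_graph_iff ofH_L2 G_def)
  moreover have "ofH (G - \<zeta> *\<^sub>R R G) \<in> Domain (A_graph \<mu> g ^^ n)"
  proof (rule Suc.IH[OF ofH_L2])
    show "toH (ofH (G - \<zeta> *\<^sub>R R G)) = (R ^^ n) (F - \<zeta> *\<^sub>R R F)"
      by (simp add: G_def linear_diff[OF lin_pow] linear_cmul[OF lin_pow] funpow_swap1)
  qed
  ultimately show ?case by (metis DomainE DomainI relpow_Suc_I2)
qed

text \<open>The inclusion in \<open>Linf_loc\<close> carries no constant. For fixed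
  \<open>H\<close>, moving \<open>R ^^ n\<close> onto \<open>H\<close> gives a function bounded on
  \<open>K\<close>, so the images of the \<open>L^1\<close> unit ball over \<open>K\<close> are
  weakly bounded; \<open>weakly_bounded_imp_norm_bounded\<close> then supplies
  \<open>D\<close>.\<close>

lemma R_power_L1_bound:
  assumes R: "H.resolvent_at \<zeta> R" and \<zeta>: "\<zeta> > 0" and K: "compact K"
    and n: "dom_power M (A_graph \<mu> g) n \<subseteq> Linf_loc"
  shows "\<exists>D\<ge>0. \<forall>\<phi>\<in>L2 M. (\<forall>x. x \<notin> K \<longrightarrow> \<phi> x = 0) \<longrightarrow>
    norm ((R ^^ n) (toH \<phi>)) \<le> D * (\<integral>x. norm (\<phi> x) \<partial>M)"
proof -
  note R\<zeta> = R \<zeta>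
  have lin: "linear R" using H.bounded_linear_R[OF R\<zeta>] by (rule bounded_linear.linear)
  have lin_pow: "linear (R ^^ n)"
    using lin by (rule linear_funpow)
  have sym: "(R ^^ n) F \<bullet> G = F \<bullet> (R ^^ n) G" for F G
  proof (induction n arbitrary: F G)
    case (Suc n)
    then show ?case by (simp add: H.R_sym[OF R\<zeta>] funpow_swap1)
  qed simp
  define \<Phi> where "\<Phi> = {\<phi> \<in> L2 M. (\<forall>x. x \<notin> K \<longrightarrow> \<phi> x = 0) \<and> (\<integral>x. norm (\<phi> x) \<partial>M) \<le> 1}"
  have "\<exists>C. \<forall>x\<in>(\<lambda>\<phi>. (R ^^ n) (toH \<phi>)) ` \<Phi>. \<bar>H \<bullet> x\<bar> \<le> C" for H
  proof -
    define v where "v = ofH ((R ^^ n) H)"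
    have v: "v \<in> L2 M" by (simp add: v_def ofH_L2)
    then have "v \<in> dom_power M (A_graph \<mu> g) n"
      using R_power_dom[OF R\<zeta> v] by (simp add: dom_power_def v_def)
    then obtain C where C: "AE x in lborel. x \<in> K \<longrightarrow> norm (v x) \<le> C"
      using n K unfolding Linf_loc_def by blast
    have "\<bar>H \<bullet> (R ^^ n) (toH \<phi>)\<bar> \<le> \<bar>C\<bar>" if \<phi>: "\<phi> \<in> \<Phi>" for \<phi>
    proof -
      have \<phi>': "\<phi> \<in> L2 M" "\<And>x. x \<notin> K \<Longrightarrow> \<phi> x = 0" "(\<integral>x. norm (\<phi> x) \<partial>M) \<le> 1"
        using \<phi> by (auto simp: \<Phi>_def)
      have "H \<bullet> (R ^^ n) (toH \<phi>) = toH v \<bullet> toH \<phi>" by (simp add: sym[symmetric] v_def)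
      also have "\<dots> = (\<integral>x. v x \<bullet> \<phi> x \<partial>M)" by (rule toH_inner[OF v \<phi>'(1)])
      finally have "\<bar>H \<bullet> (R ^^ n) (toH \<phi>)\<bar> \<le> (\<integral>x. \<bar>v x \<bullet> \<phi> x\<bar> \<partial>M)"
        using integral_norm_bound[of M "\<lambda>x. v x \<bullet> \<phi> x"] by simp
      also have "\<dots> \<le> (\<integral>x. \<bar>C\<bar> * norm (\<phi> x) \<partial>M)"
      proof (rule integral_mono_AE)
        show "integrable M (\<lambda>x. \<bar>v x \<bullet> \<phi> x\<bar>)"
          using integrable_inner_L2[OF v \<phi>'(1)] by (rule integrable_abs)
        show "integrable M (\<lambda>x. \<bar>C\<bar> * norm (\<phi> x))"
          using integral_norm_le_L2_norm(1)[OF \<phi>'(1)] by (rule integrable_mult_right)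
        show "AE x in M. \<bar>v x \<bullet> \<phi> x\<bar> \<le> \<bar>C\<bar> * norm (\<phi> x)"
          unfolding AE_M using C
        proof eventually_elim
          fix x assume x: "x \<in> K \<longrightarrow> norm (v x) \<le> C"
          have "\<bar>v x \<bullet> \<phi> x\<bar> \<le> norm (v x) * norm (\<phi> x)" by (rule Cauchy_Schwarz_ineq2)
          also have "\<dots> \<le> \<bar>C\<bar> * norm (\<phi> x)"
            using x \<phi>'(2)[of x] by (cases "x \<in> K") (auto intro: mult_right_mono)
          finally show "\<bar>v x \<bullet> \<phi> x\<bar> \<le> \<bar>C\<bar> * norm (\<phi> x)" .
        qed
      qed
      also have "\<dots> \<le> \<bar>C\<bar> * 1"
        unfolding integral_mult_right_zero using \<phi>'(3) by (intro mult_left_mono) auto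
      finally show ?thesis by simp
    qed
    then show ?thesis by blast
  qed
  then obtain D where D: "\<And>\<phi>. \<phi> \<in> \<Phi> \<Longrightarrow> norm ((R ^^ n) (toH \<phi>)) \<le> D"
    using weakly_bounded_imp_norm_bounded[of "(\<lambda>\<phi>. (R ^^ n) (toH \<phi>)) ` \<Phi>"] by blast
  have "norm ((R ^^ n) (toH \<phi>)) \<le> \<bar>D\<bar> * (\<integral>x. norm (\<phi> x) \<partial>M)"
    if \<phi>: "\<phi> \<in> L2 M" "\<And>x. x \<notin> K \<Longrightarrow> \<phi> x = 0" for \<phi>
  proof -
    define m where "m = (\<integral>x. norm (\<phi> x) \<partial>M)"
    have int: "integrable M (\<lambda>x. norm (\<phi> x))" by (rule integral_norm_le_L2_norm(1)[OF \<phi>(1)])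
    have m: "m \<ge> 0" by (simp add: m_def)
    show ?thesis
    proof (cases "m = 0")
      case True
      then have "AE x in M. \<phi> x = 0"
        using integral_nonneg_eq_0_iff_AE[OF int] by (simp add: m_def)
      then have "toH \<phi> = 0" using toH_eq_iff[OF \<phi>(1) L2_zero] by (simp add: toH_zero)
      then show ?thesis using True linear_0[OF lin_pow] by (simp add: m_def)
    next
      case False
      have "(\<lambda>x. complex_of_real (inverse m) * \<phi> x) \<in> \<Phi>"
        using \<phi> m False L2_mult[OF \<phi>(1)] by (auto simp: \<Phi>_def norm_mult norm_inverse m_def[symmetric] simp del: of_real_inverse)
      then have "norm ((R ^^ n) (toH (\<lambda>x. complex_of_real (inverse m) * \<phi> x))) \<le> D" by (rule D)
      then have "inverse m * norm ((R ^^ n) (toH \<phi>)) \<le> D"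
        unfolding toH_scaleR[OF \<phi>(1)] linear_cmul[OF lin_pow] using m by simp
      then have "norm ((R ^^ n) (toH \<phi>)) \<le> D * m" using m False by (simp add: field_simps)
      also have "\<dots> \<le> \<bar>D\<bar> * m" using m by (intro mult_right_mono) auto
      finally show ?thesis by (simp add: m_def)
    qed
  qed
  then show ?thesis by (intro exI[of _ "\<bar>D\<bar>"]) auto
qed

end

section \<open>Eventual positivity\<close>

locale elliptic_semigroup_pole = elliptic_semigroup +
  assumes pole: "simple_pole M (uminus_graph (A_graph \<mu> g)) 0"
    and smooth: "\<exists>n. dom_power M (A_graph \<mu> g) n \<subseteq> Linf_loc"
begin

lemma const_L2: "(\<lambda>x. c) \<in> L2 M"
  by (rule L2_bounded[OF finite_M, of _ "norm c"]) auto

text \<open>Both resolvent norms in \<open>decay_estimate\<close> are replaced by \<open>L^1\<close>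
  norms at the price of a factor \<open>D\<close> each, and \<open>t0\<close> is so large that the
  decay beats the product of all constants by a factor 2.\<close>

lemma locally_uniform_convergence:
  assumes K: "compact K"
  obtains t0 where "t0 > 0" and
    "\<And>t f k. t \<ge> t0 \<Longrightarrow> f \<in> L2 M \<Longrightarrow> k \<in> L2 M \<Longrightarrow> (\<And>x. x \<notin> K \<Longrightarrow> f x = 0) \<Longrightarrow> (\<And>x. x \<notin> K \<Longrightarrow> k x = 0) \<Longrightarrow>
      \<bar>lift (T t) (toH f) \<bullet> toH k - (\<integral>x. f x \<partial>M) \<bullet> (\<integral>x. k x \<partial>M)\<bar>
      \<le> 1 / 2 * (\<integral>x. norm (f x) \<partial>M) * (\<integral>x. norm (k x) \<partial>M)"
proof -
  interpret prob_space M by (rule prob)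
  obtain P C r where P: "bounded_opr M P" and P_nz: "\<exists>f\<in>L2 M. \<not> (AE x in M. P f x = 0)"
    and Hp: "selfadjoint_semigroup_pole (\<lambda>t. lift (T t)) (lift P) C r"
    using simple_pole_lift[OF pole] by blast
  interpret Hp: selfadjoint_semigroup_pole "\<lambda>t. lift (T t)" "lift P" C r by (rule Hp)
  obtain R \<zeta> where R: "H.resolvent_at \<zeta> R" and \<zeta>: "\<zeta> > 0"
    using Hp.pole[of "r / 2"] Hp.r by auto
  obtain n where n: "dom_power M (A_graph \<mu> g) n \<subseteq> Linf_loc" using smooth by blast
  obtain D where D: "D \<ge> 0" "\<And>\<phi>. \<phi> \<in> L2 M \<Longrightarrow> (\<And>x. x \<notin> K \<Longrightarrow> \<phi> x = 0) \<Longrightarrow>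
      norm ((R ^^ n) (toH \<phi>)) \<le> D * (\<integral>x. norm (\<phi> x) \<partial>M)"
    using R_power_L1_bound[OF R \<zeta> K n] by metis
  \<comment> \<open>A function \<open>f0\<close> that \<open>P\<close> does not annihilate has a
    nonzero constant \<open>c0\<close> as image; multiplying \<open>f0\<close> by the complex number
    \<open>d / c0\<close> produces the constant \<open>d\<close>, which the idempotent
    \<open>P\<close> fixes.\<close>
  have P_const: "lift P (toH (\<lambda>x. d)) = toH (\<lambda>x. d)" for d
  proof -
    obtain f0 where f0: "f0 \<in> L2 M" "\<not> (AE x in M. P f0 x = 0)" using P_nz by blast
    obtain c0 where c0: "lift P (toH f0) = toH (\<lambda>x. c0)"
      using kernel_const[OF Hp.P_in_kernel] by blast
    then have P_f0: "AE x in M. P f0 x = c0"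
      using toH_eq_iff[OF bounded_opr_L2[OF P f0(1)] const_L2] lift_toH[OF P f0(1)] by simp
    then have "c0 \<noteq> 0" using f0(2) by auto
    have "AE x in M. P (\<lambda>y. (d / c0) * f0 y) x = d"
      using bounded_opr_AE_mult[OF P f0(1), of "d / c0"] P_f0
      by eventually_elim (use \<open>c0 \<noteq> 0\<close> in simp)
    then have "toH (\<lambda>x. d) = lift P (toH (\<lambda>y. (d / c0) * f0 y))"
      unfolding lift_toH[OF P L2_mult[OF f0(1)]]
      by (intro toH_eq_iff[THEN iffD2, OF bounded_opr_L2[OF P L2_mult[OF f0(1)]] const_L2, symmetric])
    then show ?thesis by (simp only: Hp.P_P)
  qed
  have int: "integrable M f" if "f \<in> L2 M" for f
    using integrable_mult_L2[OF that const_L2[of 1]] by simp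
  have P_mean: "lift P (toH f) \<bullet> toH k = (\<integral>x. f x \<partial>M) \<bullet> (\<integral>x. k x \<partial>M)"
    if f: "f \<in> L2 M" and k: "k \<in> L2 M" for f k
  proof -
    obtain c where c: "lift P (toH f) = toH (\<lambda>x. c)"
      using kernel_const[OF Hp.P_in_kernel] by blast
    \<comment> \<open>Pairing with all constants \<open>d\<close> determines \<open>c\<close>;
      symmetry moves \<open>P\<close> onto \<open>d\<close>, which it fixes.\<close>
    have "c \<bullet> d = (\<integral>x. f x \<partial>M) \<bullet> d" for d
    proof -
      have "c \<bullet> d = toH (\<lambda>x. c) \<bullet> toH (\<lambda>x. d)"
        using prob_space by (simp add: toH_inner const_L2)
      also have "\<dots> = toH f \<bullet> toH (\<lambda>x. d)"
        by (simp only: c[symmetric] Hp.P_sym P_const)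
      finally show ?thesis by (simp add: toH_inner const_L2 f int)
    qed
    then have "c = (\<integral>x. f x \<partial>M)" using vector_eq_rdot by blast
    then show ?thesis by (simp add: c toH_inner const_L2 k int)
  qed
  define E where "E = (\<zeta> + 1) ^ (2 * n) * D\<^sup>2"
  have E: "E \<ge> 0" using \<zeta> by (simp add: E_def)
  \<comment> \<open>\<open>2 * E * C\<close> makes the decay exponent at least \<open>2 * E\<close>,
    and \<open>exp y \<ge> y\<close> then yields the factor 1/2. The summand 1 keeps
    \<open>t0\<close> positive even when \<open>n\<close> and \<open>E\<close> are 0.\<close>
  define t0 where "t0 = 2 * real n + 2 * E * C + 1"
  have small: "E * exp (- (t - 2 * real n) / C) \<le> 1 / 2" if "t \<ge> t0" for t
  proof -
    have "2 * E \<le> (t - 2 * real n) / C"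
      using that Hp.C by (simp add: t0_def field_simps)
    also have "\<dots> \<le> exp ((t - 2 * real n) / C)"
      by (rule order_trans[OF _ exp_ge_add_one_self]) simp
    finally have "2 * E * exp (- ((t - 2 * real n) / C)) \<le>
        exp ((t - 2 * real n) / C) * exp (- ((t - 2 * real n) / C))"
      by (intro mult_right_mono) auto
    then have "2 * E * exp (- ((t - 2 * real n) / C)) \<le> 1" by (simp flip: exp_add)
    then show ?thesis unfolding minus_divide_left[symmetric] by linarith
  qed
  show thesis
  proof (rule that)
    show "t0 > 0" using E Hp.C by (simp add: t0_def add_nonneg_pos)
    fix t f k assume t: "t \<ge> t0" and f: "f \<in> L2 M" "\<And>x. x \<notin> K \<Longrightarrow> f x = 0"
      and k: "k \<in> L2 M" "\<And>x. x \<notin> K \<Longrightarrow> k x = 0"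
    define I where "I h = (\<integral>x. norm (h x) \<partial>M)" for h :: "'a \<Rightarrow> complex"
    have I: "I h \<ge> 0" for h by (simp add: I_def)
    have "t \<ge> 2 * real n" using t mult_nonneg_nonneg[OF E less_imp_le[OF Hp.C]] by (simp add: t0_def)
    then have "\<bar>(lift (T t) (toH f) - lift P (toH f)) \<bullet> toH k\<bar> \<le>
        (\<zeta> + 1) ^ (2 * n) * exp (- (t - 2 * real n) / C) * norm ((R ^^ n) (toH f)) * norm ((R ^^ n) (toH k))"
      by (rule Hp.decay_estimate[OF R \<zeta>])
    also have "\<dots> \<le> (\<zeta> + 1) ^ (2 * n) * exp (- (t - 2 * real n) / C) * (D * I f) * (D * I k)"
      unfolding I_def using D(2)[OF f] D(2)[OF k] \<zeta> D(1)
      by (intro mult_mono mult_nonneg_nonneg) auto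
    also have "\<dots> = (E * exp (- (t - 2 * real n) / C)) * (I f * I k)"
      by (simp add: E_def power2_eq_square mult_ac)
    also have "\<dots> \<le> 1 / 2 * (I f * I k)"
      by (intro mult_right_mono small t mult_nonneg_nonneg I)
    finally show "\<bar>lift (T t) (toH f) \<bullet> toH k - (\<integral>x. f x \<partial>M) \<bullet> (\<integral>x. k x \<partial>M)\<bar>
      \<le> 1 / 2 * (\<integral>x. norm (f x) \<partial>M) * (\<integral>x. norm (k x) \<partial>M)"
      by (simp add: inner_diff_left P_mean[OF f(1) k(1)] I_def algebra_simps)
  qed
qed

text \<open>The order on complex numbers demands equal imaginary parts, hence this lemma. A real
  function is fixed by \<open>cnjH\<close>, with which the semigroup commutes.\<close>

lemma T_real:
  assumes f: "f \<in> L2 M" "AE x in M. Im (f x) = 0" and t: "t \<ge> 0"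
  shows "AE x in M. Im (T t f x) = 0"
proof -
  have Tf: "T t f \<in> L2 M" by (rule bounded_opr_L2[OF bounded_opr_T[OF t] f(1)])
  have "AE x in M. cnj (f x) = f x" using f(2) by eventually_elim (simp add: complex_eq_iff)
  then have "cnjH (toH f) = toH f"
    using toH_eq_iff[OF L2_cnj[OF f(1)] f(1)] by (simp add: cnjH_toH f(1))
  then have "cnjH (lift (T t) (toH f)) = lift (T t) (toH f)"
    using T_cnj[OF t, of "toH f"] by simp
  then have "toH (\<lambda>x. cnj (T t f x)) = toH (T t f)"
    by (simp add: lift_toH[OF bounded_opr_T[OF t] f(1)] cnjH_toH[OF Tf])
  then have "AE x in M. cnj (T t f x) = T t f x"
    using toH_eq_iff[OF L2_cnj[OF Tf] Tf] by simp
  then show ?thesis by eventually_elim (simp add: complex_eq_iff)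
qed

lemma L2_indicator_mult:
  assumes "f \<in> L2 M" and [measurable]: "B \<in> sets borel"
  shows "(\<lambda>x. indicator B x * f x) \<in> L2 M"
proof -
  have [measurable]: "f \<in> borel_measurable M" by (rule L2_measurable[OF assms(1)])
  have "integrable M (\<lambda>x. (norm (indicator B x * f x))\<^sup>2)"
    by (rule Bochner_Integration.integrable_bound[OF L2_integrable[OF assms(1)]])
      (auto simp: indicator_def)
  then show ?thesis by (simp add: L2_def)
qed

text \<open>The constant is half the weighted integral of \<open>f\<close> over \<open>K\<close>:
  the error is at most half of the main term \<open>m * measure M B\<close>. It depends on
  \<open>f\<close> but not on \<open>t\<close>, whereas \<open>t0\<close> is fixed before
  \<open>f\<close>.\<close>

lemma eventually_positive: "loc_unif_eventually_positive \<mu> T"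
  unfolding loc_unif_eventually_positive_def
proof (intro allI impI)
  interpret prob_space M by (rule prob)
  fix K :: "'a set" assume K: "compact K"
  have [measurable]: "K \<in> sets borel" using K by (intro borel_closed compact_imp_closed)
  obtain t0 where t0: "t0 > 0"
    "\<And>t f k. t \<ge> t0 \<Longrightarrow> f \<in> L2 M \<Longrightarrow> k \<in> L2 M \<Longrightarrow> (\<And>x. x \<notin> K \<Longrightarrow> f x = 0) \<Longrightarrow> (\<And>x. x \<notin> K \<Longrightarrow> k x = 0) \<Longrightarrow>
      \<bar>lift (T t) (toH f) \<bullet> toH k - (\<integral>x. f x \<partial>M) \<bullet> (\<integral>x. k x \<partial>M)\<bar>
      \<le> 1 / 2 * (\<integral>x. norm (f x) \<partial>M) * (\<integral>x. norm (k x) \<partial>M)"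
    using locally_uniform_convergence[OF K] by blast
  show "\<exists>t\<^sub>0>0. \<forall>f\<in>L2_pos_on \<mu> K. \<exists>c>0. \<forall>t\<ge>t\<^sub>0. AE x in lborel. x \<in> K \<longrightarrow>
      complex_of_real c \<le> T t (\<lambda>y. indicator K y * f y) x"
  proof (rule exI[of _ t0], intro conjI ballI t0(1))
    fix f assume "f \<in> L2_pos_on \<mu> K"
    then obtain B0 where f: "f \<in> L2 M" and f_nonneg: "AE x in lborel. x \<in> K \<longrightarrow> 0 \<le> f x"
      and B0: "B0 \<in> sets borel" "B0 \<subseteq> K" "emeasure lborel B0 > 0" "\<forall>x\<in>B0. 0 < f x"
      unfolding L2_pos_on_def by blast
    define F where "F x = indicator K x * f x" for x
    have F: "F \<in> L2 M" unfolding F_def[abs_def] by (rule L2_indicator_mult[OF f]) measurable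
    have F_supp: "F x = 0" if "x \<notin> K" for x using that by (simp add: F_def)
    have F_nonneg: "AE x in M. 0 \<le> F x"
      unfolding AE_M using f_nonneg by eventually_elim (auto simp: F_def indicator_def)
    have F_real: "AE x in M. Im (F x) = 0" "AE x in M. norm (F x) = Re (F x)"
      using F_nonneg by (eventually_elim; simp add: less_eq_complex_def cmod_eq_Re)+
    define m where "m = (\<integral>x. norm (F x) \<partial>M)"
    have int_F: "integrable M (\<lambda>x. norm (F x))" by (rule integral_norm_le_L2_norm(1)[OF F])
    have [measurable]: "F \<in> borel_measurable M" by (rule L2_measurable[OF F])
    have int_F_eq: "(\<integral>x. F x \<partial>M) = complex_of_real m"
    proof -
      have "(\<integral>x. F x \<partial>M) = (\<integral>x. complex_of_real (norm (F x)) \<partial>M)"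
        by (rule integral_cong_AE) (use F_real in \<open>auto elim!: AE_mp simp: complex_eq_iff\<close>)
      then show ?thesis by (simp add: m_def)
    qed
    have m: "m > 0"
    proof -
      have "m \<noteq> 0"
      proof
        assume "m = 0"
        then have "AE x in M. norm (F x) = 0"
          unfolding m_def using integral_nonneg_eq_0_iff_AE[OF int_F] by simp
        then have "AE x in lborel. x \<notin> B0"
          unfolding AE_M
        proof eventually_elim
          fix x assume "norm (F x) = 0"
          then show "x \<notin> B0" using B0(2,4) by (auto simp: F_def)
        qed
        then have "emeasure lborel {x \<in> space lborel. x \<in> B0} = 0" by (rule emeasure_eq_0_AE)
        then show False using B0(3) by simp
      qed
      moreover have "m \<ge> 0" by (simp add: m_def)
      ultimately show ?thesis by simp
    qed
    have "AE x in lborel. x \<in> K \<longrightarrow> complex_of_real (m / 2) \<le> T t (\<lambda>y. indicator K y * f y) x"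
      if t: "t \<ge> t0" for t
    proof -
      have "t \<ge> 0" using t t0(1) by simp
      define w where "w = T t F"
      have w: "w \<in> L2 M" unfolding w_def by (rule bounded_opr_L2[OF bounded_opr_T[OF \<open>t \<ge> 0\<close>] F])
      have [measurable]: "w \<in> borel_measurable borel" by (rule L2_M_measurable[OF w])
      \<comment> \<open>This set varies with \<open>t\<close>; the estimate tolerates that, since it
        has the same factor for all test functions supported in \<open>K\<close>.\<close>
      define B where "B = {x \<in> K. Re (w x) < m / 2}"
      have B_measurable [measurable]: "B \<in> sets borel" unfolding B_def by measurable
      define k :: "'a \<Rightarrow> complex" where "k x = indicator B x" for x
      have k: "k \<in> L2 M"
        unfolding k_def[abs_def] by (rule L2_bounded[OF finite_M, of _ 1]) (auto simp: measurable_M indicator_def)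
      have k_supp: "k x = 0" if "x \<notin> K" for x using that by (simp add: k_def B_def)
      have k_eq: "k x = complex_of_real (indicator B x)" for x by (simp add: k_def indicator_def)
      have int_k: "(\<integral>x. k x \<partial>M) = complex_of_real (measure M B)" "(\<integral>x. norm (k x) \<partial>M) = measure M B"
        by (simp_all add: k_eq)
      have le: "\<bar>toH w \<bullet> toH k - m * measure M B\<bar> \<le> 1 / 2 * m * measure M B"
        using t0(2)[OF t F k F_supp k_supp]
        by (simp add: int_F_eq int_k inner_complex_def lift_toH[OF bounded_opr_T[OF \<open>t \<ge> 0\<close>] F] w_def m_def)
      have ge: "toH w \<bullet> toH k \<ge> m / 2 * measure M B" using abs_le_D2[OF le] by (simp add: field_simps)
      have int_wk: "integrable M (\<lambda>x. w x \<bullet> k x)" by (rule integrable_inner_L2[OF w k])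
      have int_B: "integrable M (\<lambda>x. indicator B x * (m / 2))"
        using m by (intro integrable_const_bound[of _ "m / 2"]) (auto simp: indicator_def measurable_M)
      \<comment> \<open>\<open>d\<close> is nonnegative and strictly positive exactly on
        \<open>B\<close>, while \<open>ge\<close> makes its integral nonpositive; hence
        \<open>B\<close> is null.\<close>
      define d where "d x = indicator B x * (m / 2) - w x \<bullet> k x" for x
      have d_eq: "d x = indicator B x * (m / 2 - Re (w x))" for x
        by (auto simp: d_def k_def indicator_def inner_complex_def)
      have d_nonneg: "d x \<ge> 0" for x by (auto simp: d_eq B_def indicator_def)
      have int_d: "integrable M d"
        unfolding d_def[abs_def] by (intro Bochner_Integration.integrable_diff int_B int_wk)
      have "(\<integral>x. d x \<partial>M) = m / 2 * measure M B - toH w \<bullet> toH k"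
        unfolding d_def toH_inner[OF w k] Bochner_Integration.integral_diff[OF int_B int_wk] by simp
      then have "(\<integral>x. d x \<partial>M) = 0"
        using ge Bochner_Integration.integral_nonneg[of M d, OF d_nonneg] by linarith
      then have "AE x in M. d x = 0"
        using integral_nonneg_eq_0_iff_AE[OF int_d] d_nonneg by simp
      moreover have "AE x in M. Im (w x) = 0"
        unfolding w_def by (rule T_real[OF F F_real(1) \<open>t \<ge> 0\<close>])
      ultimately have "AE x in M. x \<in> K \<longrightarrow> complex_of_real (m / 2) \<le> w x"
      proof eventually_elim
        fix x assume x: "d x = 0" "Im (w x) = 0"
        show "x \<in> K \<longrightarrow> complex_of_real (m / 2) \<le> w x"
          using x by (auto simp: d_eq indicator_def B_def less_eq_complex_def split: if_splits)
      qed
      then show "AE x in lborel. x \<in> K \<longrightarrow> complex_of_real (m / 2) \<le> T t (\<lambda>y. indicator K y * f y) x"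
        unfolding AE_M w_def F_def[abs_def] .
    qed
    then show "\<exists>c>0. \<forall>t\<ge>t0. AE x in lborel. x \<in> K \<longrightarrow>
      complex_of_real c \<le> T t (\<lambda>y. indicator K y * f y) x"
      using half_gt_zero[OF m] by blast
  qed
qed

end

theorem proposition3p8:
  fixes \<mu> :: "'a::euclidean_space \<Rightarrow> real"
    and grad\<mu> :: "'a \<Rightarrow> 'a"
    and T :: "real \<Rightarrow> ('a \<Rightarrow> complex) \<Rightarrow> 'a \<Rightarrow> complex"
    and r :: real
  assumes "integrable lborel \<mu>"
    and "AE x in lborel. 0 \<le> \<mu> x"
    and "prob_space (density_measure \<mu>)"
    and "H1_loc_gradient \<mu> grad\<mu>"
    and "r > real DIM('a)"
    and "(\<lambda>x. grad\<mu> x /\<^sub>R \<mu> x) \<in> Lp_loc r"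
    and "\<And>K. compact K \<Longrightarrow> \<exists>\<delta>>0. AE x in lborel. x \<in> K \<longrightarrow> \<delta> \<le> \<mu> x"
    and "C0_semigroup (density_measure \<mu>) T"
    and "generator (density_measure \<mu>) T = uminus_graph (A_graph \<mu> grad\<mu>)"
    and "\<exists>n. dom_power (density_measure \<mu>) (A_graph \<mu> grad\<mu>) n \<subseteq> Linf_loc"
    and "simple_pole (density_measure \<mu>) (uminus_graph (A_graph \<mu> grad\<mu>)) 0"
  shows "loc_unif_eventually_positive \<mu> T"
proof -
  have "\<mu> \<in> borel_measurable borel" using borel_measurable_integrable[OF assms(1)] by simp
  \<comment> \<open>Balls of integer radius cover the space, and on each of them
    \<open>\<mu>\<close> has a positive lower bound.\<close>
  moreover have "AE x in lborel. 0 < \<mu> x"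
  proof -
    have "AE x in lborel. x \<in> cball 0 (real n) \<longrightarrow> 0 < \<mu> x" for n :: nat
    proof -
      obtain \<delta> where "\<delta> > 0" "AE x in lborel. x \<in> cball 0 (real n) \<longrightarrow> \<delta> \<le> \<mu> x"
        using assms(7)[OF compact_cball[of "0::'a" "real n"]] by blast
      from this(2) show ?thesis by eventually_elim (use \<open>\<delta> > 0\<close> in auto)
    qed
    then have "AE x in lborel. \<forall>n::nat. x \<in> cball 0 (real n) \<longrightarrow> 0 < \<mu> x"
      unfolding AE_all_countable by blast
    then show ?thesis
    proof eventually_elim
      fix x assume *: "\<forall>n::nat. x \<in> cball 0 (real n) \<longrightarrow> 0 < \<mu> x"
      obtain n :: nat where "norm x \<le> real n" using real_arch_simple by blast
      with * show "0 < \<mu> x" by auto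
    qed
  qed
  ultimately interpret elliptic_semigroup_pole \<mu> grad\<mu> T
    by (intro elliptic_semigroup_pole.intro elliptic_semigroup.intro elliptic_weight.intro weight.intro
        elliptic_weight_axioms.intro elliptic_semigroup_axioms.intro elliptic_semigroup_pole_axioms.intro)
      (assumption | rule assms)+
  show ?thesis by (rule eventually_positive)
qed

end
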